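(* Let $(\beta_n)_{n=1}^\infty$ be an arbitrary sequence of positive numbers such that $\lim_{n\to\infty}n^{1/2}\beta_n=0$. For each $n$, let $\sigma$ be drawn from $\mathbb{P}_{n,\beta_n}$, and let $l_1(\sigma)\ge l_2(\sigma)\ge\cdots$ be the sorted cycle lengths of $\sigma$ (with $l_k(\sigma)=0$ for any integer $k$ larger than the number of cycles of $\sigma$). Then as $n\to\infty$, $$\frac1n(l_1(\sigma),l_2(\sigma),\dots)\xrightarrow{d}\text{ Poisson-Dirichlet law with parameter }1.$$ Moreover, for any deterministic sequence $(s_n)_{n=1}^\infty$ such that $s_n\in[n]$ for every $n\in\mathbb{N}^*$, as $n\to\infty$, $$\frac{|\mathcal{C}_{s_n}(\sigma)|}{n}\xrightarrow{d}U([0,1]).$$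
   Context: $\mathbb{N}^*$ is the set of positive integers and $[n]=\{1,\dots,n\}$. $S_n$ is the symmetric group on $[n]$. For $\sigma,\tau\in S_n$, $H(\sigma,\tau)=\sum_{j=1}^n|\sigma(j)-\tau(j)|$, and $Id$ is the identity permutation. For $\beta>0$, $\mathbb{P}_{n,\beta}$ is the probability measure on $S_n$ given by $\mathbb{P}_{n,\beta}(\sigma)=Z_{n,\beta}^{-1}\exp(-\beta H(\sigma,Id))$, where $Z_{n,\beta}$ is the normalizing constant. $\mathcal{C}_s(\sigma)$ is the set of points in the cycle of $\sigma$ that contains $s$. $U([0,1])$ is the uniform distribution on $[0,1]$. $\xrightarrow{d}$ denotes convergence in distribution; for sequences it is on the space of nonincreasing summable sequences of nonnegative reals with the topology induced from the product topology. The Poisson-Dirichlet law with parameter $1$ is the law of the decreasing rearrangement of $(V_1,(1-V_1)V_2,(1-V_1)(1-V_2)V_3,\dots)$ with $V_1,V_2,\dots$ i.i.d. uniform on $[0,1]$. *)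

theory Defs
  imports "HOL-Probability.Probability" "HOL-Combinatorics.Combinatorics"
begin

definition footrule :: "nat \<Rightarrow> (nat \<Rightarrow> nat) \<Rightarrow> (nat \<Rightarrow> nat) \<Rightarrow> real" where
  "footrule n \<sigma> \<tau> = (\<Sum>j\<in>{1..n}. \<bar>real (\<sigma> j) - real (\<tau> j)\<bar>)"

definition mallows_Z :: "nat \<Rightarrow> real \<Rightarrow> real" where
  "mallows_Z n \<beta> = (\<Sum>\<sigma> | \<sigma> permutes {1..n}. exp (- \<beta> * footrule n \<sigma> id))"

definition mallows :: "nat \<Rightarrow> real \<Rightarrow> (nat \<Rightarrow> nat) measure" where
  "mallows n \<beta> = point_measure {\<sigma>. \<sigma> permutes {1..n}}
     (\<lambda>\<sigma>. ennreal (exp (- \<beta> * footrule n \<sigma> id) / mallows_Z n \<beta>))"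

lemma finite_perms: "finite {\<sigma>. \<sigma> permutes {1..n::nat}}"
  by (rule finite_permutations) simp

lemma mallows_Z_pos: "mallows_Z n \<beta> > 0"
  unfolding mallows_Z_def
proof (rule sum_pos)
  show "{\<sigma>. \<sigma> permutes {1..n}} \<noteq> {}" using permutes_id by blast
qed (use finite_perms in auto)

lemma prob_space_mallows: "prob_space (mallows n \<beta>)"
proof
  have "emeasure (mallows n \<beta>) (space (mallows n \<beta>)) =
      (\<Sum>\<sigma> | \<sigma> permutes {1..n}. ennreal (exp (- \<beta> * footrule n \<sigma> id) / mallows_Z n \<beta>))"
    unfolding mallows_def space_point_measure
    by (rule emeasure_point_measure_finite[OF finite_perms order_refl])
  also have "\<dots> = ennreal (\<Sum>\<sigma> | \<sigma> permutes {1..n}. exp (- \<beta> * footrule n \<sigma> id) / mallows_Z n \<beta>)"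
    using mallows_Z_pos[of n \<beta>] by (intro sum_ennreal) auto
  also have "\<dots> = 1"
    using mallows_Z_pos[of n \<beta>]
    by (simp add: mallows_Z_def flip: sum_divide_distrib)
  finally show "emeasure (mallows n \<beta>) (space (mallows n \<beta>)) = 1" .
qed

text \<open>Cycles are taken on \<open>{1..n}\<close>, so that fixed points in \<open>{1..n}\<close> count as cycles of length 1.
  Sequences are indexed from 0: \<open>cycle_len n \<sigma> k\<close> is the \<open>(k + 1)\<close>-st largest cycle length.\<close>

definition cycle_sets :: "nat \<Rightarrow> (nat \<Rightarrow> nat) \<Rightarrow> nat set set" where
  "cycle_sets n \<sigma> = orbit \<sigma> ` {1..n}"

definition cycle_lens :: "nat \<Rightarrow> (nat \<Rightarrow> nat) \<Rightarrow> nat list" where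
  "cycle_lens n \<sigma> = rev (sorted_list_of_multiset (image_mset card (mset_set (cycle_sets n \<sigma>))))"

definition cycle_len :: "nat \<Rightarrow> (nat \<Rightarrow> nat) \<Rightarrow> nat \<Rightarrow> nat" where
  "cycle_len n \<sigma> k = (if k < length (cycle_lens n \<sigma>) then cycle_lens n \<sigma> ! k else 0)"

definition seq_space :: "(nat \<Rightarrow> real) set" where
  "seq_space = {x. decseq x \<and> (\<forall>i. 0 \<le> x i) \<and> summable x}"

text \<open>Weak convergence of measures living on the subspace \<open>S\<close> (with its subspace topology).
  On \<^typ>\<open>nat \<Rightarrow> real\<close> the ambient topology is the product topology.\<close>

definition weak_conv_on :: "'a::topological_space set \<Rightarrow> (nat \<Rightarrow> 'a measure) \<Rightarrow> 'a measure \<Rightarrow> bool" where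
  "weak_conv_on S \<mu> \<nu> \<longleftrightarrow>
     (\<forall>f::'a \<Rightarrow> real. continuous_on S f \<and> bounded (f ` S) \<longrightarrow>
        (\<lambda>n. \<integral>x. f x \<partial>\<mu> n) \<longlonglongrightarrow> (\<integral>x. f x \<partial>\<nu>))"

text \<open>The decreasing rearrangement of a nonnegative sequence tending to 0: \<open>decr_rearr x k\<close> is the
  \<open>(k + 1)\<close>-st largest entry of \<open>x\<close>, counted with multiplicity. The infimum form makes it total
  and measurable even when \<open>x\<close> has zero entries.\<close>

definition decr_rearr :: "(nat \<Rightarrow> real) \<Rightarrow> nat \<Rightarrow> real" where
  "decr_rearr x k = Inf {t. 0 \<le> t \<and> finite {i. x i > t} \<and> card {i. x i > t} \<le> k}"

definition stick_breaking :: "(nat \<Rightarrow> real) \<Rightarrow> nat \<Rightarrow> real" where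
  "stick_breaking v i = (\<Prod>j<i. 1 - v j) * v i"

definition unif01 :: "real measure" where
  "unif01 = uniform_measure lborel {0..1}"

text \<open>The i.i.d. uniform variables are the coordinates of an infinite product space whose underlying
  set is \<open>[0,1]\<^sup>\<nat>\<close>; restricting the factors ensures that the rearranged sequence lies in
  \<^const>\<open>seq_space\<close> everywhere, not just almost surely.\<close>

definition poisson_dirichlet1 :: "(nat \<Rightarrow> real) measure" where
  "poisson_dirichlet1 =
     distr (Pi\<^sub>M UNIV (\<lambda>_. restrict_space unif01 {0..1})) (restrict_space borel seq_space)
       (\<lambda>v. decr_rearr (stick_breaking v))"

lemma countable_finite_nat: "countable {J::nat set. finite J \<and> card J \<le> k}"
  by (rule countable_subset[OF _ countable_Collect_finite]) auto

lemma rearr_set_iff: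
  "finite {i. x i > (t::real)} \<and> card {i. x i > t} \<le> k \<longleftrightarrow>
     (\<exists>J\<in>{J::nat set. finite J \<and> card J \<le> k}. \<forall>i. i \<notin> J \<longrightarrow> x i \<le> t)" (is "?L \<longleftrightarrow> ?R")
proof
  assume ?L then show ?R by (intro bexI[of _ "{i. x i > t}"]) auto
next
  assume ?R
  then obtain J where J: "finite J" "card J \<le> k" "\<And>i. i \<notin> J \<Longrightarrow> x i \<le> t" by blast
  have sub: "{i. x i > t} \<subseteq> J" using J(3) by force
  show ?L using finite_subset[OF sub J(1)] card_mono[OF J(1) sub] J(2) by linarith
qed

lemma rearr_set_nonempty:
  assumes "\<And>i. x i \<le> (C::real)" "0 \<le> C"
  shows "C \<in> {t. 0 \<le> t \<and> finite {i::nat. x i > t} \<and> card {i. x i > t} \<le> k}"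
proof -
  have "{i. x i > C} = {}" using assms(1) by (auto simp: not_less)
  then show ?thesis using assms(2) by simp
qed

lemma decr_rearr_pick:
  fixes x :: "nat \<Rightarrow> real"
  assumes nn: "\<And>i. 0 \<le> x i" and lim: "x \<longlonglongrightarrow> 0" and I: "finite I" "card I \<le> n"
  shows "\<exists>i. i \<notin> I \<and> decr_rearr x n \<le> x i"
proof (rule ccontr)
  assume "\<not> ?thesis"
  then have less: "\<And>i. i \<notin> I \<Longrightarrow> x i < decr_rearr x n" by force
  define t0 where "t0 = decr_rearr x n"
  obtain j where "j \<notin> I" using I(1) ex_new_if_finite infinite_UNIV_nat by blast
  then have t0: "t0 > 0" using less[of j] nn[of j] by (simp add: t0_def)
  define F where "F = {i. x i > t0 / 2}"
  have "eventually (\<lambda>i. x i < t0 / 2) sequentially" using order_tendstoD(2)[OF lim, of "t0 / 2"] t0 by simp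
  then obtain N where N: "\<And>i. i \<ge> N \<Longrightarrow> x i < t0 / 2" by (auto simp: eventually_sequentially)
  have "F \<subseteq> {..<N}" using N unfolding F_def by (force simp: not_le[symmetric])
  then have F: "finite F" using finite_subset by blast
  define t where "t = Max (insert (t0 / 2) (x ` (F - I)))"
  have t_less: "t < t0" unfolding t_def using F less t0 by (subst Max_less_iff) (auto simp: t0_def)
  have t_ge: "t0 / 2 \<le> t" unfolding t_def using F by (intro Max_ge) auto
  have "x i \<le> t" if "i \<notin> I" for i
  proof (cases "i \<in> F")
    case True then show ?thesis unfolding t_def using F that by (intro Max_ge) auto
  next
    case False then show ?thesis using t_ge by (auto simp: F_def)
  qed
  then have "t \<in> {t. 0 \<le> t \<and> finite {i. x i > t} \<and> card {i. x i > t} \<le> n}"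
    using I t_ge t0 unfolding mem_Collect_eq rearr_set_iff by auto
  then have "decr_rearr x n \<le> t" unfolding decr_rearr_def
    by (rule cInf_lower) (auto intro!: bdd_belowI[of _ 0])
  then show False using t_less by (simp add: t0_def)
qed

lemma decr_rearr_in_seq_space:
  fixes x :: "nat \<Rightarrow> real"
  assumes nn: "\<And>i. 0 \<le> x i" and sm: "summable x"
  shows "decr_rearr x \<in> seq_space"
proof -
  have le: "x i \<le> suminf x" for i
    using sum_le_suminf[OF sm, of "{i}"] nn by auto
  have S0: "0 \<le> suminf x" using suminf_nonneg[OF sm nn] .
  note ne = rearr_set_nonempty[of x "suminf x", OF le S0]
  have ge0: "0 \<le> decr_rearr x k" for k
    unfolding decr_rearr_def using ne[of k] by (intro cInf_greatest) auto
  have "decr_rearr x (Suc k) \<le> decr_rearr x k" for k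
    unfolding decr_rearr_def using ne[of k]
    by (intro cInf_superset_mono) (auto intro!: bdd_belowI[of _ 0])
  then have dec: "decseq (decr_rearr x)" by (rule decseq_SucI)
  have ex: "\<exists>I. finite I \<and> card I = n \<and> (\<Sum>k<n. decr_rearr x k) \<le> sum x I" for n
  proof (induction n)
    case 0 show ?case by (intro exI[of _ "{}"]) auto
  next
    case (Suc n)
    then obtain I where I: "finite I" "card I = n" "(\<Sum>k<n. decr_rearr x k) \<le> sum x I" by blast
    obtain i where "i \<notin> I" "decr_rearr x n \<le> x i"
      using decr_rearr_pick[OF nn summable_LIMSEQ_zero[OF sm] I(1)] I(2) by blast
    then show ?case using I by (intro exI[of _ "insert i I"]) auto
  qed
  have "(\<Sum>k<n. decr_rearr x k) \<le> suminf x" for n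
  proof -
    obtain I where I: "finite I" "(\<Sum>k<n. decr_rearr x k) \<le> sum x I" using ex[of n] by blast
    have "sum x I \<le> suminf x" using sum_le_suminf[OF sm I(1)] nn by auto
    with I(2) show ?thesis by linarith
  qed
  then have "summable (decr_rearr x)" using ge0 by (intro summableI_nonneg_bounded) auto
  with dec ge0 show ?thesis by (simp add: seq_space_def)
qed

lemma stick_breaking_sum: "(\<Sum>i<n. stick_breaking v i) = 1 - (\<Prod>j<n. 1 - v j)"
  by (induction n) (auto simp: stick_breaking_def algebra_simps)

lemma stick_breaking_props:
  assumes v: "\<And>i. v i \<in> {0..1}"
  shows "0 \<le> stick_breaking v i" "summable (stick_breaking v)" "stick_breaking v i \<le> 1"
proof -
  have p: "0 \<le> (\<Prod>j<n. 1 - v j)" for n using v by (intro prod_nonneg) auto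
  show nn: "0 \<le> stick_breaking v i" for i using p[of i] v[of i] by (auto simp: stick_breaking_def)
  have b: "(\<Sum>i<n. stick_breaking v i) \<le> 1" for n using p[of n] by (simp add: stick_breaking_sum)
  show "summable (stick_breaking v)" using nn b by (intro summableI_nonneg_bounded) auto
  show "stick_breaking v i \<le> 1" using b[of "Suc i"] sum_nonneg[of "{..<i}" "stick_breaking v"] nn by simp
qed

lemma space_unif_product:
  "space (Pi\<^sub>M UNIV (\<lambda>_::nat. restrict_space unif01 {0..1})) = {v. \<forall>i. v i \<in> {0..1}}"
  by (auto simp: space_PiM space_restrict_space unif01_def PiE_def Pi_def)

lemma measurable_poisson_dirichlet1:
  "(\<lambda>v. decr_rearr (stick_breaking v)) \<in>
     Pi\<^sub>M UNIV (\<lambda>_. restrict_space unif01 {0..1}) \<rightarrow>\<^sub>M restrict_space borel seq_space"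
proof -
  define M where "M = Pi\<^sub>M UNIV (\<lambda>_::nat. restrict_space unif01 {0..1::real})"
  have sp: "space M = {v. \<forall>i. v i \<in> {0..1}}" unfolding M_def by (rule space_unif_product)
  have coord: "(\<lambda>v. v i) \<in> borel_measurable M" for i
  proof -
    have "(\<lambda>v. v i) \<in> M \<rightarrow>\<^sub>M restrict_space unif01 {0..1}"
      unfolding M_def by (rule measurable_component_singleton) simp
    moreover have "(\<lambda>x. x) \<in> restrict_space unif01 {0..1} \<rightarrow>\<^sub>M borel"
      by (rule measurable_restrict_space1) (simp add: unif01_def)
    ultimately show ?thesis by (rule measurable_compose)
  qed
  have sb: "(\<lambda>v. stick_breaking v i) \<in> borel_measurable M" for i
    unfolding stick_breaking_def using coord by measurable
  have comp: "(\<lambda>v. decr_rearr (stick_breaking v) k) \<in> borel_measurable M" for k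
  proof (rule borel_measurableI_less)
    fix a :: real
    have iff: "decr_rearr (stick_breaking v) k < a \<longleftrightarrow>
        (\<exists>q\<in>{q\<in>\<rat>. 0 \<le> q \<and> q < a}. \<exists>J\<in>{J::nat set. finite J \<and> card J \<le> k}.
           \<forall>i. i \<notin> J \<longrightarrow> stick_breaking v i \<le> q)" if "v \<in> space M" for v
    proof -
      let ?A = "{t. 0 \<le> t \<and> finite {i. stick_breaking v i > t} \<and> card {i. stick_breaking v i > t} \<le> k}"
      have vi: "\<And>i. v i \<in> {0..1}" using that sp by auto
      have "1 \<in> ?A" using stick_breaking_props(3)[OF vi] by (intro rearr_set_nonempty) auto
      then have "?A \<noteq> {}" by blast
      then have 1: "decr_rearr (stick_breaking v) k < a \<longleftrightarrow> (\<exists>t\<in>?A. t < a)"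
        unfolding decr_rearr_def by (rule cInf_less_iff) (auto intro!: bdd_belowI[of _ 0])
      have "(\<exists>t\<in>?A. t < a) \<longleftrightarrow> (\<exists>q\<in>{q\<in>\<rat>. 0 \<le> q \<and> q < a}. q \<in> ?A)"
      proof
        assume "\<exists>t\<in>?A. t < a"
        then obtain t where t: "t \<in> ?A" "t < a" by blast
        obtain q where q: "q \<in> \<rat>" "t < q" "q < a" using Rats_dense_in_real[OF t(2)] by blast
        have sub: "{i. stick_breaking v i > q} \<subseteq> {i. stick_breaking v i > t}" using q by auto
        have fin: "finite {i. stick_breaking v i > t}" using t by blast
        have "q \<in> ?A" using t q finite_subset[OF sub fin] card_mono[OF fin sub] by auto
        then show "\<exists>q\<in>{q\<in>\<rat>. 0 \<le> q \<and> q < a}. q \<in> ?A" using q by auto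
      qed auto
      then show ?thesis unfolding 1 mem_Collect_eq rearr_set_iff by blast
    qed
    have "{v \<in> space M. \<exists>q\<in>{q\<in>\<rat>. 0 \<le> q \<and> q < a}. \<exists>J\<in>{J::nat set. finite J \<and> card J \<le> k}.
           \<forall>i. i \<notin> J \<longrightarrow> stick_breaking v i \<le> q} \<in> sets M"
    proof (intro sets.sets_Collect_countable_Ex' countable_finite_nat sets.sets_Collect_countable_All)
      show "countable {q\<in>\<rat>. 0 \<le> q \<and> q < a}"
        by (rule countable_subset[OF _ countable_rat]) auto
      show "{v \<in> space M. i \<notin> J \<longrightarrow> stick_breaking v i \<le> q} \<in> sets M" for q i and J :: "nat set"
        using sb[of i] by (intro sets.sets_Collect) measurable
    qed
    then show "{v \<in> space M. decr_rearr (stick_breaking v) k < a} \<in> sets M"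
      using iff by (simp cong: conj_cong)
  qed
  have "(\<lambda>v. decr_rearr (stick_breaking v)) \<in> M \<rightarrow>\<^sub>M borel"
    by (intro measurable_coordinatewise_then_product comp)
  moreover have "decr_rearr (stick_breaking v) \<in> seq_space" if "v \<in> space M" for v
    using that sp by (intro decr_rearr_in_seq_space stick_breaking_props) auto
  ultimately show ?thesis unfolding M_def[symmetric] by (intro measurable_restrict_space2) auto
qed

lemma prob_space_poisson_dirichlet1: "prob_space poisson_dirichlet1"
proof -
  have e: "emeasure lborel {0..1::real} = 1" by simp
  have "prob_space unif01" unfolding unif01_def by (rule prob_space_uniform_measure) (simp_all add: e)
  then have "prob_space (restrict_space unif01 {0..1})"
    by (intro prob_spaceI)
       (simp add: space_restrict_space emeasure_restrict_space unif01_def emeasure_uniform_measure)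
  then have "prob_space (Pi\<^sub>M UNIV (\<lambda>_::nat. restrict_space unif01 {0..1}))"
    by (intro prob_space_PiM)
  then show ?thesis unfolding poisson_dirichlet1_def
    by (rule prob_space.prob_space_distr) (rule measurable_poisson_dirichlet1)
qed

lemma measurable_cycle_len:
  "(\<lambda>\<sigma> k. real (cycle_len n \<sigma> k) / real n) \<in> mallows n \<beta> \<rightarrow>\<^sub>M restrict_space borel seq_space"
proof -
  have "(\<lambda>k. real (cycle_len n \<sigma> k) / real n) \<in> seq_space" for \<sigma>
  proof -
    let ?l = "sorted_list_of_multiset (image_mset card (mset_set (cycle_sets n \<sigma>)))"
    have "sorted_wrt (\<ge>) (rev ?l)" by (simp add: sorted_wrt_rev)
    then have mono: "cycle_len n \<sigma> j \<le> cycle_len n \<sigma> i" if "i \<le> j" for i j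
      using that sorted_wrt_iff_nth_less[of "(\<ge>)" "rev ?l"]
      unfolding cycle_len_def cycle_lens_def by (cases "i = j") auto
    have "summable (\<lambda>k. real (cycle_len n \<sigma> k) / real n)"
      by (rule summable_finite[of "{..<length (cycle_lens n \<sigma>)}"]) (auto simp: cycle_len_def)
    with mono show ?thesis by (auto simp: seq_space_def decseq_def intro!: divide_right_mono)
  qed
  then show ?thesis
    by (auto simp: mallows_def measurable_def space_point_measure sets_point_measure space_restrict_space)
qed

end

theory Submission
  imports Defs
begin

text \<open>
  The displacements \<open>\<sigma> i - i\<close> of a permutation sum to \<open>0\<close>, so its distance from the identity is
  twice the sum of the positive parts, and the weight of \<open>\<sigma>\<close> is the product of the factors
  \<open>exp (- 2 * \<beta>) ^ (\<sigma> i - i)\<close> with truncated subtraction. Each factor is the probability that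
  a geometric variable started at \<open>i\<close> is at least \<open>\<sigma> i\<close>. Hence the Mallows measure is a mixture, over
  random bounds \<open>b i \<ge> i\<close>, of uniform distributions on the permutations with \<open>\<sigma> i \<le> b i\<close>
  (\<open>mallows_sum_mixture\<close>).

  For fixed bounds the uniform distribution is built by inserting \<open>v = 1, 2, \<dots>\<close> into the cycle
  notation, right after a uniformly chosen element of \<open>pool b v = {i \<le> v. v \<le> b i}\<close>, where choosing
  \<open>v\<close> itself opens a new cycle (\<open>bounded_perms_Suc\<close>). This is a Chinese restaurant process
  with restricted choices. Read backwards, it follows finitely many points down: the largest point \<open>v\<close> is
  replaced by a uniform element of its pool. Typically the pool has at least half of
  \<open>min v (1 / (32 * \<beta>))\<close> elements, so one step goes down by an amount of that order, and it hits another
  followed point or closes a cycle with probability of the inverse order. A potential function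
  (\<open>potential_drift\<close>) adds these probabilities up: until all points are below a
  threshold \<open>k\<close>, a hit or a closed cycle occurs with probability \<open>O(1 / k + n * \<beta>\<^sup>2)\<close>, and \<open>n * \<beta>\<^sup>2 \<rightarrow> 0\<close> is
  the hypothesis. Below a fixed \<open>k\<close> all pools are full with high probability, the process is the ordinary Chinese
  restaurant process, and the partition of the followed points into cycles has exactly the Ewens
  probabilities. So the cycle partition of any fixed number of distinct points converges to the
  Ewens partition, uniformly in the points (\<open>mallows_pattern_limit\<close>).

  Both claims then follow by the method of moments. The \<open>m\<close>-th moment of \<open>card (orbit \<sigma> s) / n\<close> is the
  probability that \<open>m\<close> random points lie in the cycle of \<open>s\<close>, with limit \<open>1 / (m + 1)\<close>, the
  moment of the uniform distribution. The joint moments of the power sums of the normalised cycle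
  lengths converge to sums of Ewens probabilities over set partitions
  (\<open>cycle_moment_limit\<close>). Splitting off the first stick shows that the power sums of the
  stick-breaking sequence have moments obeying the same recursion
  (\<open>stick_moment_eq\<close>). Power sums of order at least two are continuous on the compact set of
  nonincreasing sequences with sum at most one and separate its points, so the Stone-Weierstrass
  theorem turns convergence of these moments into weak convergence
  (\<open>weak_conv_by_power_sums\<close>).
\<close>


section \<open>Cycles under insertion of a largest element\<close>

abbreviation same_cycle :: "(nat \<Rightarrow> nat) \<Rightarrow> nat \<Rightarrow> nat \<Rightarrow> bool" where
  "same_cycle \<sigma> a b \<equiv> b \<in> orbit \<sigma> a"

lemma permutes_atLeastAtMost_permutation: "\<sigma> permutes {1..n::nat} \<Longrightarrow> permutation \<sigma>"
  by (auto simp: permutation_permutes)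

lemma same_cycle_refl: "\<sigma> permutes {1..n::nat} \<Longrightarrow> same_cycle \<sigma> a a"
  by (simp add: permutation_self_in_orbit permutes_atLeastAtMost_permutation)

lemma same_cycle_trans: "same_cycle \<sigma> a b \<Longrightarrow> same_cycle \<sigma> b c \<Longrightarrow> same_cycle \<sigma> a c"
  by (rule orbit_trans)

lemma same_cycle_sym: "\<sigma> permutes {1..n::nat} \<Longrightarrow> same_cycle \<sigma> a b \<Longrightarrow> same_cycle \<sigma> b a"
  using orbit_swap same_cycle_refl by metis

lemma same_cycle_iff_orbit_eq:
  "\<sigma> permutes {1..n::nat} \<Longrightarrow> same_cycle \<sigma> a b \<longleftrightarrow> orbit \<sigma> a = orbit \<sigma> b"
  using same_cycle_sym same_cycle_trans same_cycle_refl by blast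

text \<open>In cycle notation \<open>v\<close> is written directly after \<open>i\<close>, provided \<open>\<sigma>\<close> fixes \<open>v\<close>; the case
  \<open>i = v\<close> leaves \<open>v\<close> as a cycle of its own.\<close>

definition insert_after :: "nat \<Rightarrow> nat \<Rightarrow> (nat \<Rightarrow> nat) \<Rightarrow> nat \<Rightarrow> nat" where
  "insert_after i v \<sigma> = \<sigma> \<circ> Transposition.transpose i v"

text \<open>Collapsing \<open>v\<close> to \<open>i\<close> maps every step of the enlarged permutation to a step, or to no move, of
  \<open>\<sigma>\<close>; conversely a step of \<open>\<sigma>\<close> is one or two steps of the enlarged permutation. So cycles are
  compared by replacing \<open>v\<close> with \<open>i\<close>.\<close>

lemma same_cycle_insert_after:
  assumes \<sigma>: "\<sigma> permutes {1..n}" and v: "v = Suc n" and i: "i \<in> {1..v}"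
    and ab: "a \<in> {1..v}" "b \<in> {1..v}"
  shows "same_cycle (insert_after i v \<sigma>) a b \<longleftrightarrow>
    same_cycle \<sigma> ((id(v := i)) a) ((id(v := i)) b)"
proof -
  define \<tau> where "\<tau> = insert_after i v \<sigma>"
  define \<kappa> where "\<kappa> = (id(v := i))"
  have sv: "\<sigma> v = v" using \<sigma> v by (simp add: permutes_def)
  have "Transposition.transpose i v permutes {1..v}" using i by (intro permutes_swap_id) auto
  moreover have "\<sigma> permutes {1..v}" using permutes_subset[OF \<sigma>] v by auto
  ultimately have \<tau>: "\<tau> permutes {1..v}"
    unfolding \<tau>_def insert_after_def by (rule permutes_compose)
  have \<tau>i: "\<tau> i = v" "\<tau> v = \<sigma> i" "\<And>b. b \<noteq> i \<Longrightarrow> b \<noteq> v \<Longrightarrow> \<tau> b = \<sigma> b"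
    using sv by (auto simp: \<tau>_def insert_after_def Transposition.transpose_def)
  have n\<sigma>: "\<sigma> b \<noteq> v" if "b \<noteq> v" for b
    using sv permutes_inj[OF \<sigma>] that by (metis injD)
  have collapse_step: "same_cycle \<sigma> (\<kappa> b) (\<kappa> (\<tau> b))" for b
  proof -
    consider "i = v" | "i \<noteq> v" "b = v" | "i \<noteq> v" "b = i" | "b \<noteq> i" "b \<noteq> v" by blast
    then show ?thesis
    proof cases
      case 1 then have "\<tau> = \<sigma>" by (simp add: \<tau>_def insert_after_def)
      then show ?thesis using 1 by (cases "b = v") (simp_all add: \<kappa>_def orbit.base sv n\<sigma> same_cycle_refl[OF \<sigma>])
    next
      case 2 then show ?thesis using \<tau>i n\<sigma>[of i] by (auto simp: \<kappa>_def intro: orbit.base)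
    next
      case 3 then show ?thesis using \<tau>i same_cycle_refl[OF \<sigma>] by (auto simp: \<kappa>_def)
    next
      case 4 then show ?thesis using \<tau>i n\<sigma>[of b] by (auto simp: \<kappa>_def intro: orbit.base)
    qed
  qed
  have collapse: "same_cycle \<sigma> (\<kappa> a) (\<kappa> b)" if "same_cycle \<tau> a b" for a b
    using that
  proof induction
    case base show ?case by (rule collapse_step)
  next
    case (step y) then show ?case using collapse_step same_cycle_trans by blast
  qed
  have expand_step: "same_cycle \<tau> b (\<sigma> b)" for b
  proof -
    have "same_cycle \<tau> i (\<sigma> i)" using \<tau>i orbit.base[of \<tau> i] orbit.step[of v \<tau> i] by auto
    moreover have "same_cycle \<tau> v v" by (rule same_cycle_refl[OF \<tau>])
    ultimately show ?thesis using \<tau>i(3)[of b] orbit.base[of \<tau> b] sv by metis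
  qed
  have expand: "same_cycle \<tau> a b" if "same_cycle \<sigma> a b" for a b
    using that
  proof induction
    case base show ?case by (rule expand_step)
  next
    case (step y) then show ?case using expand_step same_cycle_trans by blast
  qed
  have to_\<kappa>: "same_cycle \<tau> a (\<kappa> a)" for a
  proof (cases "a = v")
    case True
    have "same_cycle \<tau> i v" using \<tau>i orbit.base[of \<tau> i] by simp
    then show ?thesis using True same_cycle_sym[OF \<tau>] by (simp add: \<kappa>_def)
  qed (simp add: \<kappa>_def same_cycle_refl[OF \<tau>])
  show ?thesis unfolding \<tau>_def[symmetric] \<kappa>_def[symmetric]
  proof
    assume "same_cycle \<tau> a b"
    then show "same_cycle \<sigma> (\<kappa> a) (\<kappa> b)" by (rule collapse)
  next
    assume "same_cycle \<sigma> (\<kappa> a) (\<kappa> b)"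
    from expand[OF this] to_\<kappa>[of a] same_cycle_sym[OF \<tau> to_\<kappa>[of b]]
    show "same_cycle \<tau> a b" using same_cycle_trans by blast
  qed
qed

section \<open>Permutations with bounded values\<close>

text \<open>Rook placements on a Ferrers board: the shape is a staircase above the diagonal once \<open>i \<le> c i\<close>.\<close>

definition bounded_perms :: "(nat \<Rightarrow> nat) \<Rightarrow> nat \<Rightarrow> (nat \<Rightarrow> nat) set" where
  "bounded_perms c n = {\<sigma>. \<sigma> permutes {1..n} \<and> (\<forall>a\<in>{1..n}. \<sigma> a \<le> c a)}"

definition pool :: "(nat \<Rightarrow> nat) \<Rightarrow> nat \<Rightarrow> nat set" where
  "pool c v = {i\<in>{1..v}. v \<le> c i}"

lemma finite_bounded_perms: "finite (bounded_perms c n)"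
  unfolding bounded_perms_def using finite_perms[of n] by (rule rev_finite_subset) auto

lemma finite_pool: "finite (pool c v)" by (simp add: pool_def)

text \<open>The inverse removes the largest element \<open>v\<close> from its cycle, and \<open>i\<close> is its predecessor there.
  The bounds survive in both directions: \<open>i\<close> is now sent to \<open>v\<close>, which is the defining
  condition of the pool, \<open>v\<close> is sent to some number that is at most \<open>v \<le> c v\<close>, and after the
  removal \<open>i\<close> is sent to a number less than \<open>v \<le> c i\<close>. Hence the number of choices for \<open>i\<close> does
  not depend on the smaller permutation.\<close>

lemma bounded_perms_Suc:
  assumes c: "\<And>i. i \<in> {1..Suc n} \<Longrightarrow> i \<le> c i"
  shows "bij_betw (\<lambda>(i, \<sigma>). insert_after i (Suc n) \<sigma>)
           (pool c (Suc n) \<times> bounded_perms c n) (bounded_perms c (Suc n))"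
proof -
  define v where "v = Suc n"
  have fwd: "insert_after i v \<sigma> \<in> bounded_perms c v" if i: "i \<in> pool c v" and \<sigma>: "\<sigma> \<in> bounded_perms c n" for i \<sigma>
  proof -
    have sp: "\<sigma> permutes {1..n}" using \<sigma> by (simp add: bounded_perms_def)
    have "Transposition.transpose i v permutes {1..v}" using i by (intro permutes_swap_id) (auto simp: pool_def)
    moreover have "\<sigma> permutes {1..v}" using permutes_subset[OF sp] v_def by auto
    ultimately have p: "insert_after i v \<sigma> permutes {1..v}"
      unfolding insert_after_def by (rule permutes_compose)
    have sv: "\<sigma> v = v" using sp v_def by (simp add: permutes_def)
    have "insert_after i v \<sigma> a \<le> c a" if a: "a \<in> {1..v}" for a
    proof -
      consider "a = i" | "a = v" "a \<noteq> i" | "a \<noteq> i" "a \<in> {1..n}" using a v_def by force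
      then show ?thesis
      proof cases
        case 1 then show ?thesis using i sv by (simp add: insert_after_def pool_def)
      next
        case 2
        have "insert_after i v \<sigma> v \<le> v" using permutes_in_image[OF p, of v] a 2 by auto
        then show ?thesis using 2 c[of v] a by (simp add: v_def)
      next
        case 3 then show ?thesis using \<sigma> v_def by (auto simp: insert_after_def Transposition.transpose_def bounded_perms_def)
      qed
    qed
    with p show ?thesis by (simp add: bounded_perms_def)
  qed
  have bwd: "inv \<tau> v \<in> pool c v \<and> insert_after (inv \<tau> v) v \<tau> \<in> bounded_perms c n"
    if \<tau>: "\<tau> \<in> bounded_perms c v" for \<tau>
  proof -
    define i where "i = inv \<tau> v"
    have p: "\<tau> permutes {1..v}" using \<tau> by (simp add: bounded_perms_def)
    have \<tau>i: "\<tau> i = v" unfolding i_def using permutes_inverses[OF p] by simp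
    have i: "i \<in> {1..v}" using permutes_in_image[OF p, of i] unfolding \<tau>i by (simp add: v_def)
    have "\<tau> i \<le> c i" using i \<tau> by (simp add: bounded_perms_def)
    then have ip: "i \<in> pool c v" using i unfolding \<tau>i by (simp add: pool_def)
    have "Transposition.transpose i v permutes {1..v}" using i v_def by (intro permutes_swap_id) auto
    from permutes_compose[OF this p] have q: "insert_after i v \<tau> permutes {1..v}"
      unfolding insert_after_def .
    have qv: "insert_after i v \<tau> v = v" using \<tau>i by (simp add: insert_after_def)
    have "\<forall>x\<in>{1..v} - {1..n}. insert_after i v \<tau> x = x"
    proof
      fix x assume "x \<in> {1..v} - {1..n}"
      then have "x = v" unfolding v_def by auto
      then show "insert_after i v \<tau> x = x" using qv by simp
    qed
    then have q': "insert_after i v \<tau> permutes {1..n}" using permutes_superset[OF q] by blast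
    have "insert_after i v \<tau> a \<le> c a" if a: "a \<in> {1..n}" for a
    proof (cases "a = i")
      case True
      have "insert_after i v \<tau> a \<le> n" using permutes_in_image[OF q', of a] a by auto
      also have "n \<le> c i" using ip v_def by (simp add: pool_def)
      finally show ?thesis using True by simp
    next
      case False
      then have "insert_after i v \<tau> a = \<tau> a" using a v_def by (simp add: insert_after_def Transposition.transpose_def)
      then show ?thesis using \<tau> a v_def by (simp add: bounded_perms_def)
    qed
    with q' ip show ?thesis unfolding i_def[symmetric] by (simp add: bounded_perms_def)
  qed
  have inv_ins: "inv (insert_after i v \<sigma>) v = i" if "\<sigma> \<in> bounded_perms c n" "i \<in> pool c v" for i \<sigma>
  proof -
    have "\<sigma> v = v" using that v_def by (simp add: bounded_perms_def permutes_def)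
    then have "insert_after i v \<sigma> i = v" by (simp add: insert_after_def)
    moreover have "inj (insert_after i v \<sigma>)" using fwd[OF that(2,1)] permutes_inj
      by (auto simp: bounded_perms_def)
    ultimately show ?thesis by (metis inv_f_f)
  qed
  have ins2: "insert_after i v (insert_after i v \<sigma>) = \<sigma>" for i \<sigma>
    by (rule ext) (simp add: insert_after_def)
  show ?thesis unfolding v_def[symmetric]
  proof (rule bij_betw_byWitness[where f' = "\<lambda>\<tau>. (inv \<tau> v, insert_after (inv \<tau> v) v \<tau>)"])
    show "\<forall>p\<in>pool c v \<times> bounded_perms c n.
       (inv ((\<lambda>(i, \<sigma>). insert_after i v \<sigma>) p) v,
        insert_after (inv ((\<lambda>(i, \<sigma>). insert_after i v \<sigma>) p) v) v ((\<lambda>(i, \<sigma>). insert_after i v \<sigma>) p)) = p"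
      using inv_ins by (auto simp: ins2)
    show "\<forall>\<tau>\<in>bounded_perms c v. (\<lambda>(i, \<sigma>). insert_after i v \<sigma>) (inv \<tau> v, insert_after (inv \<tau> v) v \<tau>) = \<tau>"
      by (auto simp: ins2)
    show "(\<lambda>(i, \<sigma>). insert_after i v \<sigma>) ` (pool c v \<times> bounded_perms c n) \<subseteq> bounded_perms c v"
      using fwd by auto
    show "(\<lambda>\<tau>. (inv \<tau> v, insert_after (inv \<tau> v) v \<tau>)) ` bounded_perms c v \<subseteq> pool c v \<times> bounded_perms c n"
      using bwd by auto
  qed
qed

lemma bounded_perms_0: "bounded_perms c 0 = {id}"
  by (auto simp: bounded_perms_def permutes_empty)

definition bounded_prob :: "(nat \<Rightarrow> nat) \<Rightarrow> nat \<Rightarrow> ((nat \<Rightarrow> nat) \<Rightarrow> bool) \<Rightarrow> real" where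
  "bounded_prob c n E = card {\<sigma>\<in>bounded_perms c n. E \<sigma>} / card (bounded_perms c n)"

text \<open>Removing the largest element of a uniform bounded permutation leaves a uniform bounded
  permutation, independent of the uniformly distributed place of insertion.\<close>

lemma bounded_prob_Suc:
  assumes c: "\<And>i. i \<in> {1..Suc n} \<Longrightarrow> i \<le> c i"
  shows "bounded_prob c (Suc n) E =
    (\<Sum>i\<in>pool c (Suc n). bounded_prob c n (\<lambda>\<sigma>. E (insert_after i (Suc n) \<sigma>))) / card (pool c (Suc n))"
proof -
  let ?f = "\<lambda>(i, \<sigma>). insert_after i (Suc n) \<sigma>"
  note bij = bounded_perms_Suc[of n c, OF c]
  have c1: "card (bounded_perms c (Suc n)) = card (pool c (Suc n)) * card (bounded_perms c n)"
    using bij_betw_same_card[OF bij] by (simp add: card_cartesian_product)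
  have "bij_betw ?f (SIGMA i:pool c (Suc n). {\<sigma>\<in>bounded_perms c n. E (insert_after i (Suc n) \<sigma>)})
          {\<sigma>\<in>bounded_perms c (Suc n). E \<sigma>}"
    (is "bij_betw _ ?A ?B")
  proof (rule bij_betw_subset[OF bij])
    show "?A \<subseteq> pool c (Suc n) \<times> bounded_perms c n" by auto
    show "?f ` ?A = ?B"
    proof (intro equalityI subsetI)
      fix \<tau> assume \<tau>: "\<tau> \<in> ?B"
      then have "\<tau> \<in> ?f ` (pool c (Suc n) \<times> bounded_perms c n)"
        using bij by (simp add: bij_betw_def)
      with \<tau> show "\<tau> \<in> ?f ` ?A" by force
    next
      fix \<tau> assume "\<tau> \<in> ?f ` ?A"
      then obtain i \<sigma> where "i \<in> pool c (Suc n)" "\<sigma> \<in> bounded_perms c n" "E \<tau>" "\<tau> = ?f (i, \<sigma>)" by auto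
      then show "\<tau> \<in> ?B" using bij_betwE[OF bij] by blast
    qed
  qed
  then have c2: "card {\<sigma>\<in>bounded_perms c (Suc n). E \<sigma>} =
      (\<Sum>i\<in>pool c (Suc n). card {\<sigma>\<in>bounded_perms c n. E (insert_after i (Suc n) \<sigma>)})"
    using finite_pool finite_bounded_perms by (subst bij_betw_same_card[symmetric]) (auto intro!: card_SigmaI)
  show ?thesis unfolding bounded_prob_def c1 c2
    by (simp add: sum_divide_distrib mult.commute)
qed

lemma bounded_perms_nonempty: "(\<And>i. i \<in> {1..n} \<Longrightarrow> i \<le> c i) \<Longrightarrow> card (bounded_perms c n) > 0"
  using finite_bounded_perms[of c n] permutes_id[of "{1..n}"]
  by (auto simp: card_gt_0_iff bounded_perms_def intro!: exI[of _ id])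

lemma bounded_prob_bounds: "0 \<le> bounded_prob c n E" "bounded_prob c n E \<le> 1"
proof -
  have "card {\<sigma>\<in>bounded_perms c n. E \<sigma>} \<le> card (bounded_perms c n)"
    by (intro card_mono finite_bounded_perms) auto
  then show "0 \<le> bounded_prob c n E" "bounded_prob c n E \<le> 1"
    by (auto simp: bounded_prob_def divide_le_eq_1)
qed

lemma bounded_prob_cong:
  "(\<And>\<sigma>. \<sigma> permutes {1..n} \<Longrightarrow> E \<sigma> = E' \<sigma>) \<Longrightarrow> bounded_prob c n E = bounded_prob c n E'"
  unfolding bounded_prob_def
  by (rule arg_cong[where f = "\<lambda>A. real (card A) / _"]) (auto simp: bounded_perms_def)

lemma bounded_prob_conj_const:
  assumes "\<And>\<sigma>. \<sigma> permutes {1..n} \<Longrightarrow> E \<sigma> \<longleftrightarrow> C \<and> E' \<sigma>"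
  shows "bounded_prob c n E = (if C then bounded_prob c n E' else 0)"
proof -
  have "bounded_prob c n E = bounded_prob c n (\<lambda>\<sigma>. C \<and> E' \<sigma>)" using assms by (rule bounded_prob_cong)
  then show ?thesis by (cases C) (simp_all add: bounded_prob_def)
qed


section \<open>The Ewens partition probabilities\<close>

text \<open>The probability that the Chinese restaurant process with \<open>card X\<close> customers produces the
  partition of \<open>X\<close> into the level sets of \<open>lab\<close>. Labels are used instead of blocks because removing a
  point or moving it to another place then leaves the labelling untouched.\<close>

definition ewens :: "'x set \<Rightarrow> ('x \<Rightarrow> 'l) \<Rightarrow> real" where
  "ewens X lab = (\<Prod>l\<in>lab ` X. fact (card {x\<in>X. lab x = l} - 1)) / fact (card X)"

text \<open>The step of the Chinese restaurant process: the last of \<open>card X\<close> customers opens a table with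
  weight \<open>1\<close> or joins a table with weight its number of occupants.\<close>

lemma ewens_remove:
  assumes X: "finite X" and x: "x \<in> X"
  shows "real (card X) * ewens X lab =
    (if lab x \<in> lab ` (X - {x}) then real (card {y\<in>X - {x}. lab y = lab x}) else 1) * ewens (X - {x}) lab"
proof -
  define Y where "Y = X - {x}"
  have Y: "finite Y" "x \<notin> Y" "X = insert x Y" using X x by (auto simp: Y_def)
  define cl where "cl = (\<lambda>Z l. {z\<in>Z. lab z = l})"
  have cl: "{z\<in>Z. lab z = l} = cl Z l" for Z l by (simp add: cl_def)
  have fin: "finite (cl Y l)" for l using Y(1) by (simp add: cl_def)
  have cl_x: "cl X (lab x) = insert x (cl Y (lab x))" using Y by (auto simp: cl_def)
  have cl_other: "cl X l = cl Y l" if "l \<noteq> lab x" for l using Y that by (auto simp: cl_def)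
  have cX: "card X = Suc (card Y)" using Y by simp
  define R where "R = (\<Prod>l\<in>lab ` Y - {lab x}. fact (card (cl Y l) - 1) :: real)"
  have "lab ` X = insert (lab x) (lab ` Y - {lab x})" using Y by auto
  then have "(\<Prod>l\<in>lab ` X. fact (card (cl X l) - 1)) =
      (fact (card (cl X (lab x)) - 1) :: real) * (\<Prod>l\<in>lab ` Y - {lab x}. fact (card (cl X l) - 1))"
    using Y(1) by (simp only: prod.insert finite_Diff finite_imageI Diff_iff insert_iff not_True_eq_False simp_thms)
  also have "(\<Prod>l\<in>lab ` Y - {lab x}. fact (card (cl X l) - 1) :: real) = R"
    unfolding R_def by (intro prod.cong refl) (simp add: cl_other)
  also have "fact (card (cl X (lab x)) - 1) = (fact (card (cl Y (lab x))) :: real)"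
    unfolding cl_x using Y fin by (simp add: cl_def)
  finally have num: "(\<Prod>l\<in>lab ` X. fact (card (cl X l) - 1)) = (fact (card (cl Y (lab x))) :: real) * R" .
  have lhs: "real (card X) * ewens X lab = fact (card (cl Y (lab x))) * R / fact (card Y)"
    unfolding ewens_def cl num cX fact_Suc by (simp del: of_nat_Suc)
  show ?thesis unfolding Y_def[symmetric]
  proof (cases "lab x \<in> lab ` Y")
    case True
    have eq: "lab ` Y = insert (lab x) (lab ` Y - {lab x})" using True by auto
    have "(\<Prod>l\<in>lab ` Y. fact (card (cl Y l) - 1)) = (fact (card (cl Y (lab x)) - 1) :: real) * R"
      unfolding R_def using Y(1) by (subst eq, subst prod.insert) auto
    moreover have "card (cl Y (lab x)) > 0" using True fin by (auto simp: card_gt_0_iff cl_def)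
    then have "fact (card (cl Y (lab x))) = (real (card (cl Y (lab x))) * fact (card (cl Y (lab x)) - 1))"
      by (rule fact_reduce)
    ultimately show "real (card X) * ewens X lab =
        (if lab x \<in> lab ` Y then real (card {y\<in>Y. lab y = lab x}) else 1) * ewens Y lab"
      using True lhs unfolding ewens_def cl by simp
  next
    case False
    have "cl Y (lab x) = {}" using False unfolding cl_def by (metis (mono_tags, lifting) Collect_empty_eq image_eqI)
    moreover have "lab ` Y - {lab x} = lab ` Y" using False by simp
    ultimately show "real (card X) * ewens X lab =
        (if lab x \<in> lab ` Y then real (card {y\<in>Y. lab y = lab x}) else 1) * ewens Y lab"
      using False lhs unfolding R_def ewens_def cl by simp
  qed
qed

lemma ewens_nonneg: "0 \<le> ewens X lab"
  unfolding ewens_def by (intro divide_nonneg_nonneg prod_nonneg) auto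

lemma ewens_le_1: "finite X \<Longrightarrow> ewens X lab \<le> 1"
proof (induction X rule: finite_induct)
  case empty show ?case by (simp add: ewens_def)
next
  case (insert x X)
  have "card {y\<in>X. lab y = lab x} \<le> card X" using insert by (intro card_mono) auto
  then have "real (card (insert x X)) * ewens (insert x X) lab \<le> real (card (insert x X)) * ewens X lab"
    using insert ewens_remove[of "insert x X" x lab]
      mult_right_mono[of 1 "real (Suc (card X))" "ewens X lab"] ewens_nonneg[of X lab]
    by (auto intro!: mult_right_mono simp del: of_nat_Suc)
  then have "ewens (insert x X) lab \<le> ewens X lab" using insert by simp
  then show ?case using insert by simp
qed

section \<open>Cycle patterns for fixed bounds\<close>

text \<open>The points \<open>t x\<close> lie in common cycles exactly as the labels prescribe.\<close>

definition same_pattern :: "(nat \<Rightarrow> nat) \<Rightarrow> 'x set \<Rightarrow> ('x \<Rightarrow> nat) \<Rightarrow> ('x \<Rightarrow> 'l) \<Rightarrow> bool" where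
  "same_pattern \<sigma> X t lab \<longleftrightarrow> (\<forall>x\<in>X. \<forall>y\<in>X. same_cycle \<sigma> (t x) (t y) \<longleftrightarrow> lab x = lab y)"

lemma same_pattern_insert_after:
  assumes \<sigma>: "\<sigma> permutes {1..n}" and i: "i \<in> {1..Suc n}" and t: "t ` X \<subseteq> {1..Suc n}"
  shows "same_pattern (insert_after i (Suc n) \<sigma>) X t lab \<longleftrightarrow>
         same_pattern \<sigma> X (\<lambda>y. if t y = Suc n then i else t y) lab"
proof -
  have "same_cycle (insert_after i (Suc n) \<sigma>) (t x) (t y) \<longleftrightarrow>
      same_cycle \<sigma> (if t x = Suc n then i else t x) (if t y = Suc n then i else t y)"
    if "x \<in> X" "y \<in> X" for x y
  proof -
    have "t x \<in> {1..Suc n}" "t y \<in> {1..Suc n}" using t that by blast+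
    from same_cycle_insert_after[OF \<sigma> refl i this] show ?thesis by (simp add: fun_upd_def)
  qed
  then show ?thesis unfolding same_pattern_def by simp
qed

lemma same_pattern_cong:
  "(\<And>x. x \<in> X \<Longrightarrow> t x = t' x) \<Longrightarrow> same_pattern \<sigma> X t lab = same_pattern \<sigma> X t' lab"
  by (simp add: same_pattern_def)

lemma same_pattern_duplicate:
  assumes \<sigma>: "\<sigma> permutes {1..n}" and xy: "x \<in> X" "y \<in> X" "x \<noteq> y" and eq: "t x = t y"
  shows "same_pattern \<sigma> X t lab \<longleftrightarrow> lab y = lab x \<and> same_pattern \<sigma> (X - {x}) t lab"
proof (cases "lab y = lab x \<and> same_pattern \<sigma> (X - {x}) t lab")
  case True
  have "same_cycle \<sigma> (t u) (t w) \<longleftrightarrow> lab u = lab w" if "u \<in> X" "w \<in> X" for u w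
  proof -
    let ?r = "\<lambda>u. if u = x then y else u"
    have "?r u \<in> X - {x}" "?r w \<in> X - {x}" using that xy by auto
    then have "same_cycle \<sigma> (t (?r u)) (t (?r w)) \<longleftrightarrow> lab (?r u) = lab (?r w)"
      using True unfolding same_pattern_def by blast
    then show ?thesis using True eq by (auto split: if_splits)
  qed
  then show ?thesis using True by (simp add: same_pattern_def)
next
  case False
  have "same_cycle \<sigma> (t y) (t x)" using same_cycle_refl[OF \<sigma>] eq by simp
  then show ?thesis using False xy unfolding same_pattern_def by blast
qed

lemma same_pattern_fixpoint:
  assumes \<sigma>: "\<sigma> permutes {1..n}" and x: "x \<in> X" and fp: "\<sigma> (t x) = t x"
    and inj: "\<And>y. y \<in> X \<Longrightarrow> t y = t x \<Longrightarrow> y = x"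
  shows "same_pattern \<sigma> X t lab \<longleftrightarrow> lab x \<notin> lab ` (X - {x}) \<and> same_pattern \<sigma> (X - {x}) t lab"
proof -
  have 1: "same_cycle \<sigma> (t x) b \<longleftrightarrow> b = t x" for b
    using fp orbit_eq_singleton_iff[of \<sigma> "t x"] by auto
  have 2: "same_cycle \<sigma> b (t x) \<longleftrightarrow> b = t x" for b
    using 1 same_cycle_sym[OF \<sigma>] by metis
  have "X = insert x (X - {x})" using x by auto
  then have "same_pattern \<sigma> X t lab \<longleftrightarrow>
     (\<forall>y\<in>X - {x}. lab x \<noteq> lab y) \<and> same_pattern \<sigma> (X - {x}) t lab"
    unfolding same_pattern_def using 1 2 inj x by (metis Diff_iff insert_iff)
  then show ?thesis by auto
qed

text \<open>The process is read backwards, by induction on the largest element \<open>v\<close>. If a point \<open>t x\<close> sits at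
  \<open>v\<close>, the insertion place is uniform in the pool. If no point sits at that place, then
  \<open>x\<close> moves there; otherwise \<open>x\<close> leaves the configuration, merging with a point or closing a cycle. As long as
  the pool is all of \<open>{1..v}\<close>, the average over the places reproduces the Ewens probability. For
  other pools a merger or a closed cycle, of probability at most \<open>m / card (pool b v)\<close>, is
  counted as an error, and the condition \<open>step\<close> says that \<open>F\<close> decreases on average by enough to pay for
  it. Thus \<open>F v\<close> bounds the expected cost of following one point down from \<open>v\<close>.\<close>

theorem bounded_prob_same_pattern:
  fixes X :: "'x set" and lab :: "'x \<Rightarrow> 'l" and F :: "nat \<Rightarrow> real"
  assumes b: "\<And>i. i \<in> {1..n} \<Longrightarrow> i \<le> b i"
    and F0: "\<And>i. 0 \<le> F i"
    and step: "\<And>v. v \<in> {1..n} \<Longrightarrow> pool b v = {1..v} \<and> (\<forall>i\<le>v. F i = 0) \<or>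
       real m + (\<Sum>i\<in>pool b v. F i) \<le> real (card (pool b v)) * F v"
    and X: "finite X" "card X \<le> m" and t: "inj_on t X" "t ` X \<subseteq> {1..n}"
  shows "\<bar>bounded_prob b n (\<lambda>\<sigma>. same_pattern \<sigma> X t lab) - ewens X lab\<bar> \<le> (\<Sum>x\<in>X. F (t x))"
  using b step X t
proof (induction n arbitrary: X t)
  case 0
  then have "X = {}" by auto
  then show ?case by (simp add: same_pattern_def ewens_def bounded_prob_def bounded_perms_0)
next
  case (Suc n)
  define v where "v = Suc n"
  define P where "P = pool b v"
  define N where "N = real (card P)"
  define q where "q = ewens X lab"
  define G where "G i = bounded_prob b n (\<lambda>\<sigma>. same_pattern \<sigma> X (\<lambda>y. if t y = v then i else t y) lab)" for i
  have v: "v \<in> {1..Suc n}" by (simp add: v_def)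
  have Pfin: "finite P" by (simp add: P_def finite_pool)
  have vP: "v \<in> P" using Suc.prems(1)[of v] by (simp add: P_def pool_def v_def)
  have N: "N > 0" using vP Pfin by (auto simp: N_def card_gt_0_iff)
  have Psub: "P \<subseteq> {1..v}" by (auto simp: P_def pool_def)
  have prob: "bounded_prob b v (\<lambda>\<sigma>. same_pattern \<sigma> X t lab) = (\<Sum>i\<in>P. G i) / N"
  proof -
    have "bounded_prob b n (\<lambda>\<sigma>. same_pattern (insert_after i v \<sigma>) X t lab) = G i" if "i \<in> P" for i
    proof -
      have "i \<in> {1..Suc n}" using that Psub v_def by blast
      then show ?thesis unfolding G_def v_def
        by (intro bounded_prob_cong same_pattern_insert_after Suc.prems(6))
    qed
    then show ?thesis
      using bounded_prob_Suc[OF Suc.prems(1), where E = "\<lambda>\<sigma>. same_pattern \<sigma> X t lab"]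
      by (simp add: P_def N_def v_def)
  qed
  have IH: "\<bar>bounded_prob b n (\<lambda>\<sigma>. same_pattern \<sigma> X t' lab) - q\<bar> \<le> (\<Sum>x\<in>X. F (t' x))"
    if "inj_on t' X" "t' ` X \<subseteq> {1..n}" for t'
    unfolding q_def by (rule Suc.IH) (use Suc.prems(1-4) that in simp_all)
  have G1: "\<bar>G i - q\<bar> \<le> 1" for i
    using bounded_prob_bounds[of b n] ewens_nonneg[of X lab] ewens_le_1[OF Suc.prems(3), of lab]
    by (auto simp: G_def q_def abs_le_iff) (smt (verit))+
  show ?case unfolding v_def[symmetric] prob q_def[symmetric]
  proof (cases "v \<in> t ` X")
    case False
    have tn: "t ` X \<subseteq> {1..n}"
    proof
      fix w assume w: "w \<in> t ` X"
      have "w \<in> {1..v}" using subsetD[OF Suc.prems(6) w] by (simp add: v_def)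
      moreover have "w \<noteq> v" using w False by metis
      ultimately show "w \<in> {1..n}" by (auto simp: v_def)
    qed
    have "G i = bounded_prob b n (\<lambda>\<sigma>. same_pattern \<sigma> X t lab)" for i
      unfolding G_def using False by (intro bounded_prob_cong same_pattern_cong) auto
    then have "(\<Sum>i\<in>P. G i) / N = bounded_prob b n (\<lambda>\<sigma>. same_pattern \<sigma> X t lab)"
      using N by (simp add: N_def)
    then show "\<bar>(\<Sum>i\<in>P. G i) / N - q\<bar> \<le> (\<Sum>x\<in>X. F (t x))" using IH[OF Suc.prems(5) tn] by simp
  next
    case True
    then obtain x where x: "x \<in> X" "t x = v" by auto
    have x_unique: "y = x" if "y \<in> X" "t y = v" for y
      using inj_onD[OF Suc.prems(5), of y x] that x by simp
    have t_le: "t y \<le> v" if "y \<in> X" for y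
      using subsetD[OF Suc.prems(6) imageI[OF that]] by (simp add: v_def)
    define E where "E = (\<Sum>y\<in>X - {x}. F (t y))"
    have E0: "0 \<le> E" unfolding E_def by (intro sum_nonneg F0)
    have FE: "(\<Sum>y\<in>X. F (t y)) = F v + E" unfolding E_def using x Suc.prems(3) by (simp add: sum.remove)
    \<comment> \<open>the point moves to the free place \<open>i\<close>\<close>
    have move: "\<bar>G i - q\<bar> \<le> F i + E" if i: "i \<in> P - t ` X" for i
    proof -
      let ?t = "\<lambda>y. if t y = v then i else t y"
      have "?t ` X \<subseteq> {1..n}"
      proof
        fix w assume "w \<in> ?t ` X"
        then have "w \<in> {1..v}" "w \<noteq> v" using i Psub Suc.prems(6) True by (auto simp: v_def split: if_splits)
        then show "w \<in> {1..n}" by (auto simp: v_def)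
      qed
      moreover have "inj_on ?t X" using Suc.prems(5) i x_unique by (auto simp: inj_on_def split: if_splits)
      moreover have "(\<Sum>y\<in>X. F (?t y)) = F i + E"
      proof -
        have "(\<Sum>y\<in>X - {x}. F (?t y)) = E" unfolding E_def
        proof (rule sum.cong[OF refl])
          fix y assume "y \<in> X - {x}"
          then have "t y \<noteq> v" using x_unique by blast
          then show "F (?t y) = F (t y)" by simp
        qed
        then show ?thesis by (subst sum.remove[OF Suc.prems(3) x(1)]) (simp add: x(2))
      qed
      ultimately show ?thesis using IH[of ?t] unfolding G_def by simp
    qed
    have ctX: "card (t ` X) = card X" by (rule card_image[OF Suc.prems(5)])
    have "\<bar>\<Sum>i\<in>P. (G i - q)\<bar> \<le> N * (F v + E)"
      using Suc.prems(2)[OF v]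
    proof (elim disjE conjE)
      assume pool: "pool b v = {1..v}" and Fv: "\<forall>i\<le>v. F i = 0"
      have tP: "t ` X \<subseteq> P" using Suc.prems(6) pool by (simp add: P_def v_def)
      have E: "E = 0" unfolding E_def using Fv t_le by (intro sum.neutral) simp
      have moved: "G i - q = 0" if "i \<in> P - t ` X" for i
      proof -
        have "i \<le> v" using that Psub by auto
        then have "F i = 0" using Fv by simp
        then show ?thesis using move[OF that] E by simp
      qed
      define q' where "q' = bounded_prob b n (\<lambda>\<sigma>. same_pattern \<sigma> (X - {x}) t lab)"
      have tX': "t ` (X - {x}) \<subseteq> {1..n}"
      proof
        fix w assume "w \<in> t ` (X - {x})"
        then obtain y where y: "w = t y" "y \<in> X" "y \<noteq> x" by auto
        have "w \<in> {1..v}" using subsetD[OF Suc.prems(6) imageI[OF y(2)]] y(1) by (simp add: v_def)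
        moreover have "w \<noteq> v" using x_unique[OF y(2)] y(1,3) by auto
        ultimately show "w \<in> {1..n}" by (auto simp: v_def)
      qed
      have "\<bar>q' - ewens (X - {x}) lab\<bar> \<le> (\<Sum>y\<in>X - {x}. F (t y))"
        unfolding q'_def
      proof (rule Suc.IH)
        show "card (X - {x}) \<le> m" using card_mono[of X "X - {x}"] Suc.prems(3,4) by simp
        show "inj_on t (X - {x})" by (rule inj_on_subset[OF Suc.prems(5)]) simp
      qed (use Suc.prems(1,2,3) tX' in simp_all)
      then have q': "q' = ewens (X - {x}) lab" using E by (simp add: E_def)
      have upd: "(\<lambda>y. if t y = v then i else t y) y = (t(x := i)) y" if "y \<in> X" for i y
        using x(2) x_unique[OF that] by (cases "y = x") auto
      have Gi: "G i = bounded_prob b n (\<lambda>\<sigma>. same_pattern \<sigma> X (t(x := i)) lab)" for i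
        unfolding G_def by (intro bounded_prob_cong same_pattern_cong upd)
      have sub_cong: "same_pattern \<sigma> (X - {x}) (t(x := i)) lab = same_pattern \<sigma> (X - {x}) t lab" for \<sigma> i
        by (rule same_pattern_cong) auto
      \<comment> \<open>the point merges with \<open>y\<close>\<close>
      have Gy: "G (t y) = (if lab y = lab x then q' else 0)" if y: "y \<in> X - {x}" for y
      proof -
        have "same_pattern \<sigma> X (t(x := t y)) lab \<longleftrightarrow> lab y = lab x \<and> same_pattern \<sigma> (X - {x}) t lab"
          if "\<sigma> permutes {1..n}" for \<sigma>
          using same_pattern_duplicate[OF that, of x X y "t(x := t y)" lab] x(1) y by (auto simp add: sub_cong)
        then show ?thesis unfolding Gi q'_def by (rule bounded_prob_conj_const)
      qed
      \<comment> \<open>the point closes a cycle\<close>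
      have Gv: "G v = (if lab x \<in> lab ` (X - {x}) then 0 else q')"
      proof -
        have "same_pattern \<sigma> X (t(x := v)) lab \<longleftrightarrow> lab x \<notin> lab ` (X - {x}) \<and> same_pattern \<sigma> (X - {x}) t lab"
          if "\<sigma> permutes {1..n}" for \<sigma>
        proof -
          have "\<sigma> v = v" using that by (simp add: v_def permutes_def)
          then show ?thesis
            using same_pattern_fixpoint[OF that x(1), of "t(x := v)" lab] x_unique
            unfolding sub_cong by (metis fun_upd_apply)
        qed
        then have "G v = (if lab x \<notin> lab ` (X - {x}) then q' else 0)"
          unfolding Gi q'_def by (rule bounded_prob_conj_const)
        then show ?thesis by simp
      qed
      have "(\<Sum>i\<in>t ` X. G i) = (\<Sum>y\<in>X. G (t y))" by (rule sum.reindex_cong[OF Suc.prems(5)]) auto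
      also have "\<dots> = G v + (\<Sum>y\<in>X - {x}. G (t y))" using x Suc.prems(3) by (simp add: sum.remove)
      also have "(\<Sum>y\<in>X - {x}. G (t y)) = (\<Sum>y\<in>X - {x}. if lab y = lab x then q' else 0)"
        by (intro sum.cong Gy) auto
      also have "\<dots> = real (card {y\<in>X - {x}. lab y = lab x}) * q'"
        using Suc.prems(3) by (simp add: sum.If_cases Collect_conj_eq[symmetric] Int_def)
      also have "G v + \<dots> = real (card X) * q"
      proof (cases "lab x \<in> lab ` (X - {x})")
        case True
        then show ?thesis unfolding q_def ewens_remove[OF Suc.prems(3) x(1)] q'[symmetric] Gv by simp
      next
        case False
        have "lab y \<noteq> lab x" if "y \<in> X - {x}" for y using False imageI[OF that, of lab] by metis
        then have "card {y\<in>X - {x}. lab y = lab x} = 0" by (simp only: card_eq_0_iff) blast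
        then show ?thesis unfolding q_def ewens_remove[OF Suc.prems(3) x(1)] q'[symmetric] Gv
          using False by (simp only: if_False if_True of_nat_0 mult_zero_left add_0_right mult_1 not_False_eq_True)
      qed
      finally have "(\<Sum>i\<in>t ` X. G i - q) = 0" by (simp add: sum_subtractf ctX)
      moreover have "(\<Sum>i\<in>P - t ` X. G i - q) = 0" using moved by (intro sum.neutral) auto
      ultimately have "(\<Sum>i\<in>P. G i - q) = 0" using sum.subset_diff[OF tP Pfin, of "\<lambda>i. G i - q"] by simp
      then show ?thesis using N F0[of v] E0 by simp
    next
      assume drift: "real m + (\<Sum>i\<in>pool b v. F i) \<le> real (card (pool b v)) * F v"
      have "\<bar>\<Sum>i\<in>P. (G i - q)\<bar> \<le> (\<Sum>i\<in>P. \<bar>G i - q\<bar>)" by (rule sum_abs)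
      also have "\<dots> \<le> (\<Sum>i\<in>P. (F i + E) + indicator (t ` X) i)"
      proof (rule sum_mono)
        fix i assume "i \<in> P"
        then show "\<bar>G i - q\<bar> \<le> F i + E + indicator (t ` X) i"
          using move[of i] G1[of i] F0[of i] E0 by (cases "i \<in> t ` X") (auto simp: indicator_def)
      qed
      also have "\<dots> = (\<Sum>i\<in>P. F i) + N * E + real (card (P \<inter> t ` X))"
        using Pfin by (simp add: sum.distrib N_def indicator_def of_bool_def sum.If_cases)
      also have "card (P \<inter> t ` X) \<le> m"
        using card_mono[of "t ` X" "P \<inter> t ` X"] ctX Suc.prems(3,4) by simp
      finally show ?thesis using drift by (simp add: P_def[symmetric] N_def[symmetric] algebra_simps)
    qed
    then have "\<bar>(\<Sum>i\<in>P. G i) - N * q\<bar> \<le> N * (F v + E)" by (simp add: sum_subtractf N_def)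
    moreover have "(\<Sum>i\<in>P. G i) / N - q = ((\<Sum>i\<in>P. G i) - N * q) / N" using N by (simp add: field_simps)
    ultimately show "\<bar>(\<Sum>i\<in>P. G i) / N - q\<bar> \<le> (\<Sum>x\<in>X. F (t x))"
      using N by (simp add: FE abs_divide divide_le_eq mult.commute)
  qed
qed


section \<open>The cost of following points down\<close>

text \<open>With pools of size at least \<open>l / 2\<close>, \<open>l = min v L\<close>, a step from \<open>v\<close> costs at most \<open>2 * m / l\<close> and goes down by
  at least \<open>l div 4\<close> in at least half of the cases. While \<open>v \<le> L\<close> the visited points shrink geometrically and the
  costs \<open>1 / v\<close> add up to \<open>O(1 / k)\<close>, which the term \<open>- 32 / v\<close> pays for; above \<open>L\<close> there are
  \<open>O(n / L)\<close> steps of cost \<open>O(1 / L)\<close>, which the linear term pays for. The constant \<open>64 / k\<close> is twice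
  \<open>32 / k\<close>, so that the last step, across \<open>k\<close>, is paid for as well.\<close>

definition potential :: "nat \<Rightarrow> nat \<Rightarrow> nat \<Rightarrow> nat \<Rightarrow> real" where
  "potential m k L v = (if v \<le> k then 0 else real m * (64 / k - 32 / v + 32 * v / (real L)\<^sup>2))"

lemma potential_nonneg:
  assumes "k > 0" shows "0 \<le> potential m k L v"
proof (cases "v \<le> k")
  case False
  have "32 / real v \<le> 32 / real k" using False assms by (intro divide_left_mono) auto
  moreover have "(0::real) \<le> 32 / real k" "32 / real k + 32 / real k = 64 / real k" by (simp_all add: field_simps)
  moreover have "0 \<le> 32 * real v / (real L)\<^sup>2" by simp
  ultimately have "0 \<le> 64 / real k - 32 / v + 32 * v / (real L)\<^sup>2" by linarith
  then show ?thesis using False by (simp add: potential_def)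
qed (simp add: potential_def)

lemma potential_mono:
  assumes "k > 0" "u \<le> v" shows "potential m k L u \<le> potential m k L v"
proof (cases "u \<le> k")
  case True then show ?thesis using potential_nonneg[OF assms(1), of m L v] by (simp add: potential_def)
next
  case False
  have "32 / real v \<le> 32 / real u" using False assms by (intro divide_left_mono) auto
  moreover have "32 * real u / (real L)\<^sup>2 \<le> 32 * real v / (real L)\<^sup>2"
    using assms by (intro divide_right_mono) auto
  ultimately show ?thesis using False assms by (auto simp: potential_def intro!: mult_left_mono)
qed

lemma potential_le:
  fixes n :: nat
  assumes "k > 0" "v \<le> n" shows "potential m k L v \<le> real m * (64 / k + 32 * n / (real L)\<^sup>2)"
proof -
  have 1: "32 * real v / (real L)\<^sup>2 \<le> 32 * real n / (real L)\<^sup>2" using assms by (intro divide_right_mono) auto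
  have "0 \<le> 32 / real v" by simp
  with 1 have "64 / real k - 32 / v + 32 * v / (real L)\<^sup>2 \<le> 64 / k + 32 * n / (real L)\<^sup>2" by linarith
  then show ?thesis unfolding potential_def by (auto intro: mult_left_mono)
qed

lemma potential_drop:
  assumes k: "k \<ge> 8" and L: "L \<ge> 8" and v: "v > k" and l: "l = min v L"
  shows "4 * real m / l \<le> potential m k L v - potential m k L (v - l div 4)"
proof -
  define h where "h = l div 4"
  define g where "g u = 64 / real k - 32 / real u + 32 * real u / (real L)\<^sup>2" for u :: nat
  have pot: "potential m k L u = (if u \<le> k then 0 else real m * g u)" for u
    by (simp add: potential_def g_def)
  have l8: "l \<ge> 8" using k L v l by simp
  have "8 * h \<ge> l" using l8 unfolding h_def by presburger
  then have hl: "real h \<ge> real l / 8" by linarith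
  have hv: "h < v" using l l8 k v unfolding h_def by linarith
  have L0: "real L > 0" "real k > 0" "real v > 0" using L k v by auto
  have key: "4 / real l \<le> (if v - h \<le> k then g v else g v - g (v - h))"
  proof (cases "v - h \<le> k")
    case True
    have a: "32 / real v \<le> 32 / real k" using v L0 by (intro divide_left_mono) auto
    have d: "64 / real k = 32 / real k + 32 / real k" by (simp add: field_simps)
    have g_ge: "32 / real k + 32 * real v / (real L)\<^sup>2 \<le> g v" unfolding g_def using a d by linarith
    have "4 / real l \<le> 32 / real k + 32 * real v / (real L)\<^sup>2"
    proof (cases "v \<le> L")
      case True
      have "4 / real v \<le> 32 / real k" using v L0 by (intro frac_le) auto
      moreover have "0 \<le> 32 * real v / (real L)\<^sup>2" by simp
      moreover have lv: "l = v" using True l by simp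
      ultimately show ?thesis unfolding lv by linarith
    next
      case False
      have "4 / real L = 4 * real L / (real L)\<^sup>2" using L0 by (simp add: power2_eq_square)
      also have "\<dots> \<le> 32 * real v / (real L)\<^sup>2" using False by (intro divide_right_mono) auto
      finally have "4 / real L \<le> 32 * real v / (real L)\<^sup>2" .
      moreover have "0 \<le> 32 / real k" by simp
      moreover have lL: "l = L" using False l by simp
      ultimately show ?thesis unfolding lL by linarith
    qed
    with g_ge True show ?thesis by simp
  next
    case False
    have e: "real (v - h) = real v - real h" using hv by simp
    have vh: "real v - real h > 0" using hv by simp
    have gd: "g v - g (v - h) = 32 * (1 / (real v - real h) - 1 / real v) + 32 * real h / (real L)\<^sup>2"
      unfolding g_def e by (simp add: algebra_simps diff_divide_distrib)
    have "4 / real l \<le> g v - g (v - h)"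
    proof (cases "v \<le> L")
      case True
      then have lv: "l = v" using l by simp
      have "1 / (8 * real v) = (real v / 8) / (real v)\<^sup>2" using L0 by (simp add: power2_eq_square)
      also have "\<dots> \<le> real h / (real v)\<^sup>2" using hl lv by (intro divide_right_mono) auto
      also have "\<dots> \<le> real h / (real v * (real v - real h))"
        using vh L0 by (intro divide_left_mono) (auto simp: power2_eq_square)
      also have "\<dots> = 1 / (real v - real h) - 1 / real v" using vh L0 by (simp add: field_simps)
      finally have "32 * (1 / (8 * real v)) \<le> 32 * (1 / (real v - real h) - 1 / real v)" by (intro mult_left_mono) auto
      moreover have "32 * (1 / (8 * real v)) = 4 / real l" using lv by simp
      moreover have "0 \<le> 32 * real h / (real L)\<^sup>2" by simp
      ultimately show ?thesis unfolding gd by linarith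
    next
      case False
      then have lL: "l = L" using l by simp
      have "4 / real l = 32 * (real l / 8) / (real L)\<^sup>2" using L0 lL by (simp add: power2_eq_square)
      also have "\<dots> \<le> 32 * real h / (real L)\<^sup>2" using hl by (intro divide_right_mono mult_left_mono) auto
      finally have "4 / real l \<le> 32 * real h / (real L)\<^sup>2" .
      moreover have "1 / real v \<le> 1 / (real v - real h)" using vh by (intro divide_left_mono) auto
      then have "0 \<le> 32 * (1 / (real v - real h) - 1 / real v)" by simp
      ultimately show ?thesis unfolding gd by (rule add_increasing[rotated])
    qed
    with False show ?thesis by simp
  qed
  have "4 * real m / l = real m * (4 / real l)" by simp
  also have "\<dots> \<le> real m * (if v - h \<le> k then g v else g v - g (v - h))" using key by (intro mult_left_mono) auto
  also have "\<dots> = potential m k L v - potential m k L (v - h)"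
    using v unfolding pot by (simp add: right_diff_distrib)
  finally show ?thesis by (simp add: h_def)
qed

text \<open>At most \<open>l div 4\<close> elements of the pool lie within \<open>l div 4\<close> of \<open>v\<close>, so at least half of the pool, hence
  at least \<open>l / 4\<close> elements, gains the drop of \<open>potential_drop\<close>.\<close>

lemma potential_drift:
  assumes k: "k \<ge> 8" and L: "L \<ge> 8" and v: "v > k"
    and P: "P \<subseteq> {1..v}" and N: "real (card P) \<ge> real (min v L) / 2"
  shows "real m + (\<Sum>i\<in>P. potential m k L i) \<le> real (card P) * potential m k L v"
proof -
  define l where "l = min v L"
  define h where "h = l div 4"
  define D where "D = potential m k L v - potential m k L (v - h)"
  have l0: "l > 0" using k L v by (simp add: l_def)
  have Pfin: "finite P" using P finite_subset by blast
  have D: "4 * real m / l \<le> D" unfolding D_def h_def by (rule potential_drop[OF k L v l_def])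
  have "P \<inter> {v - h<..v} \<subseteq> {v - h<..v}" by auto
  then have "card (P \<inter> {v - h<..v}) \<le> h" using card_mono[of "{v - h<..v}" "P \<inter> {v - h<..v}"] by simp
  moreover have "4 * h \<le> l" by (simp add: h_def)
  ultimately have near: "real (card (P \<inter> {v - h<..v})) \<le> real l / 4" by linarith
  have "card P = card (P \<inter> {v - h<..v}) + card (P - {v - h<..v})"
    using card_Un_disjoint[of "P \<inter> {v - h<..v}" "P - {v - h<..v}"] Pfin by (simp add: Int_Diff_Un Int_Diff_disjoint)
  then have far: "real l / 4 \<le> real (card (P - {v - h<..v}))" using near N by (simp add: l_def)
  have D0: "0 \<le> D" using D l0 by (smt (verit) divide_nonneg_nonneg of_nat_0_le_iff)
  have "real m = real l / 4 * (4 * real m / l)" using l0 by simp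
  also have "\<dots> \<le> real (card (P - {v - h<..v})) * D" using far D by (intro mult_mono) auto
  also have "\<dots> = (\<Sum>i\<in>P - {v - h<..v}. D)" by simp
  also have "\<dots> \<le> (\<Sum>i\<in>P - {v - h<..v}. potential m k L v - potential m k L i)"
  proof (rule sum_mono)
    fix i assume "i \<in> P - {v - h<..v}"
    then have "i \<le> v - h" using P by auto
    then have "potential m k L i \<le> potential m k L (v - h)" using k by (intro potential_mono) auto
    then show "D \<le> potential m k L v - potential m k L i" by (simp add: D_def)
  qed
  also have "\<dots> \<le> (\<Sum>i\<in>P. potential m k L v - potential m k L i)"
  proof (rule sum_mono2[OF Pfin])
    fix i assume "i \<in> P - (P - {v - h<..v})"
    then have "i \<le> v" by auto
    then have "potential m k L i \<le> potential m k L v" using k by (intro potential_mono) auto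
    then show "0 \<le> potential m k L v - potential m k L i" by simp
  qed auto
  finally show ?thesis by (simp add: sum_subtractf)
qed

text \<open>The bounds for which following points down works: full pools up to \<open>k\<close>, and large pools above.\<close>

definition good_bounds :: "nat \<Rightarrow> nat \<Rightarrow> nat \<Rightarrow> (nat \<Rightarrow> nat) \<Rightarrow> bool" where
  "good_bounds n k L b \<longleftrightarrow> (\<forall>i\<in>{1..min k n}. k \<le> b i) \<and>
     (\<forall>v\<in>{k<..n}. real (min v L) / 2 \<le> real (card (pool b v)))"

theorem bounded_prob_good:
  fixes X :: "'x set" and lab :: "'x \<Rightarrow> 'l"
  assumes b: "\<And>i. i \<in> {1..n} \<Longrightarrow> i \<le> b i" and k: "k \<ge> 8" and L: "L \<ge> 8"
    and good: "good_bounds n k L b"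
    and X: "finite X" and t: "inj_on t X" "t ` X \<subseteq> {1..n}"
  shows "\<bar>bounded_prob b n (\<lambda>\<sigma>. same_pattern \<sigma> X t lab) - ewens X lab\<bar>
    \<le> (real (card X))\<^sup>2 * (64 / k + 32 * n / (real L)\<^sup>2)"
proof -
  let ?F = "potential (card X) k L"
  have "\<bar>bounded_prob b n (\<lambda>\<sigma>. same_pattern \<sigma> X t lab) - ewens X lab\<bar> \<le> (\<Sum>x\<in>X. ?F (t x))"
  proof (rule bounded_prob_same_pattern[OF b])
    show "0 \<le> ?F i" for i using k by (intro potential_nonneg) auto
    fix v assume v: "v \<in> {1..n}"
    show "pool b v = {1..v} \<and> (\<forall>i\<le>v. ?F i = 0) \<or>
       real (card X) + (\<Sum>i\<in>pool b v. ?F i) \<le> real (card (pool b v)) * ?F v"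
    proof (cases "v \<le> k")
      case True
      have "v \<le> b i" if "i \<in> {1..v}" for i
      proof -
        have "i \<in> {1..min k n}" using that v True by auto
        then have "k \<le> b i" using good by (simp add: good_bounds_def)
        then show ?thesis using True by simp
      qed
      then show ?thesis using True by (auto simp: pool_def potential_def)
    next
      case False
      then have "real (min v L) / 2 \<le> real (card (pool b v))" using good v by (simp add: good_bounds_def)
      then show ?thesis using False k L by (intro disjI2 potential_drift) (auto simp: pool_def)
    qed
  qed (use X t in auto)
  also have "\<dots> \<le> (\<Sum>x\<in>X. real (card X) * (64 / k + 32 * n / (real L)\<^sup>2))"
    using t(2) k by (intro sum_mono potential_le) auto
  finally show ?thesis by (simp add: power2_eq_square)
qed

section \<open>The Mallows measure as a mixture\<close>

text \<open>The law of a geometric variable with ratio \<open>r\<close> started at \<open>i\<close> and truncated at \<open>n\<close>, so that all mixtures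
  are finite sums.\<close>

definition geom_weight :: "nat \<Rightarrow> real \<Rightarrow> nat \<Rightarrow> nat \<Rightarrow> real" where
  "geom_weight n r i c = (if c < n then r ^ (c - i) * (1 - r) else r ^ (n - i))"

lemma sum_geom_weight:
  assumes "i \<le> x" "x \<le> n"
  shows "(\<Sum>c\<in>{x..n}. geom_weight n r i c) = r ^ (x - i)"
  using assms(2,1)
proof (induction x rule: inc_induct)
  case base then show ?case by (simp add: geom_weight_def)
next
  case (step x)
  have "{x..n} = insert x {Suc x..n}" using step by auto
  then have "(\<Sum>c\<in>{x..n}. geom_weight n r i c) = geom_weight n r i x + r ^ (Suc x - i)"
    using step by simp
  also have "\<dots> = r ^ (x - i)" using step by (simp add: geom_weight_def Suc_diff_le algebra_simps)
  finally show ?case .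
qed

lemma geom_weight_nonneg: "0 \<le> r \<Longrightarrow> r \<le> 1 \<Longrightarrow> 0 \<le> geom_weight n r i c"
  by (simp add: geom_weight_def)

text \<open>Since \<open>\<sigma>\<close> permutes the summands, \<open>\<sigma> i - i\<close> sums to \<open>0\<close> over the integers and may be added to the
  absolute values. On the right the subtraction is truncated.\<close>

lemma footrule_id:
  assumes \<sigma>: "\<sigma> permutes {1..n}"
  shows "footrule n \<sigma> id = 2 * (\<Sum>i\<in>{1..n}. real (\<sigma> i - i))"
proof -
  have "(\<Sum>i\<in>{1..n}. real (\<sigma> i)) = (\<Sum>i\<in>{1..n}. real i)"
    using sum.permute[OF \<sigma>, of real] by (simp add: o_def)
  then have "footrule n \<sigma> id = (\<Sum>i\<in>{1..n}. \<bar>real (\<sigma> i) - real i\<bar> + (real (\<sigma> i) - real i))"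
    by (simp add: footrule_def sum.distrib sum_subtractf)
  also have "\<dots> = (\<Sum>i\<in>{1..n}. 2 * real (\<sigma> i - i))" by (intro sum.cong) (auto simp: of_nat_diff_if)
  finally show ?thesis by (simp add: sum_distrib_left)
qed

lemma mallows_weight:
  assumes "\<sigma> permutes {1..n}"
  shows "exp (- \<beta> * footrule n \<sigma> id) = (\<Prod>i\<in>{1..n}. exp (- 2 * \<beta>) ^ (\<sigma> i - i))"
proof -
  have "- \<beta> * footrule n \<sigma> id = (\<Sum>i\<in>{1..n}. real (\<sigma> i - i) * (- 2 * \<beta>))"
    unfolding footrule_id[OF assms] sum_distrib_left by (intro sum.cong) auto
  then show ?thesis by (simp only: exp_sum finite_atLeastAtMost exp_of_nat_mult)
qed

definition bound_family :: "nat \<Rightarrow> (nat \<Rightarrow> nat) set" where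
  "bound_family n = PiE {1..n} (\<lambda>i. {i..n})"

lemma finite_bound_family: "finite (bound_family n)"
  unfolding bound_family_def by (intro finite_PiE) auto

text \<open>Given \<open>\<sigma>\<close>, the bounds are independent; the factors \<open>f\<close> serve to compute exponential moments.\<close>

lemma sum_above_permutation:
  fixes f :: "nat \<Rightarrow> nat \<Rightarrow> real"
  shows "(\<Sum>b | b \<in> bound_family n \<and> (\<forall>i\<in>{1..n}. \<sigma> i \<le> b i). \<Prod>i\<in>{1..n}. geom_weight n r i (b i) * f i (b i)) =
    (\<Prod>i\<in>{1..n}. \<Sum>c\<in>{max i (\<sigma> i)..n}. geom_weight n r i c * f i c)"
proof -
  have "{b. b \<in> bound_family n \<and> (\<forall>i\<in>{1..n}. \<sigma> i \<le> b i)} = PiE {1..n} (\<lambda>i. {max i (\<sigma> i)..n})"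
    unfolding bound_family_def by (auto simp: PiE_def Pi_def)
  then show ?thesis by (subst prod_sum_PiE) auto
qed

lemma mallows_weight_mixture:
  assumes \<sigma>: "\<sigma> permutes {1..n}"
  shows "exp (- \<beta> * footrule n \<sigma> id) =
    (\<Sum>b | b \<in> bound_family n \<and> (\<forall>i\<in>{1..n}. \<sigma> i \<le> b i). \<Prod>i\<in>{1..n}. geom_weight n (exp (- 2 * \<beta>)) i (b i))"
proof -
  have "(\<Sum>c\<in>{max i (\<sigma> i)..n}. geom_weight n (exp (- 2 * \<beta>)) i c) = exp (- 2 * \<beta>) ^ (\<sigma> i - i)"
    if "i \<in> {1..n}" for i
  proof -
    have "\<sigma> i \<in> {1..n}" using permutes_in_image[OF \<sigma>] that by blast
    then have "max i (\<sigma> i) \<le> n" using that by auto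
    then show ?thesis by (subst sum_geom_weight) (auto simp: max_def)
  qed
  then show ?thesis
    using sum_above_permutation[where n = n and \<sigma> = \<sigma> and r = "exp (- 2 * \<beta>)" and f = "\<lambda>_ _. 1"] mallows_weight[OF \<sigma>, of \<beta>] by simp
qed

text \<open>By lack of memory, conditioning the bound of \<open>i\<close> to be at least \<open>x\<close> only makes it larger, so that it stays
  below \<open>y\<close> with probability at most \<open>1 - r ^ (y - i)\<close>. The factor \<open>r ^ (x - i)\<close> is the
  probability of the condition.\<close>

lemma geom_weight_tail:
  assumes r: "0 \<le> r" "r \<le> 1" and ix: "i \<le> n" "x \<le> n" and y: "y \<le> n"
  shows "(\<Sum>c | c \<in> {max i x..n} \<and> c < y. geom_weight n r i c) \<le> (1 - r ^ (y - i)) * r ^ (x - i)"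
proof (cases "y \<le> max i x")
  case True
  then have "{c. c \<in> {max i x..n} \<and> c < y} = {}" by auto
  moreover have "0 \<le> (1 - r ^ (y - i)) * r ^ (x - i)" using r by (intro mult_nonneg_nonneg) (auto simp: power_le_one)
  ultimately show ?thesis by (simp only: sum.empty)
next
  case False
  have split: "{max i x..n} = {c. c \<in> {max i x..n} \<and> c < y} \<union> {y..n}"
    "{c. c \<in> {max i x..n} \<and> c < y} \<inter> {y..n} = {}" using False by auto
  have "r ^ (x - i) = (\<Sum>c\<in>{max i x..n}. geom_weight n r i c)"
    using ix by (subst sum_geom_weight) (auto simp: max_def)
  also have "\<dots> = (\<Sum>c | c \<in> {max i x..n} \<and> c < y. geom_weight n r i c) + (\<Sum>c\<in>{y..n}. geom_weight n r i c)"
    by (subst split(1), subst sum.union_disjoint[OF _ _ split(2)]) auto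
  also have "(\<Sum>c\<in>{y..n}. geom_weight n r i c) = r ^ (y - i)"
    using False y by (intro sum_geom_weight) auto
  finally have "(\<Sum>c | c \<in> {max i x..n} \<and> c < y. geom_weight n r i c) = r ^ (x - i) - r ^ (y - i)" by simp
  moreover have "r ^ (y - i) * r ^ (x - i) \<le> r ^ (y - i)" using r by (intro mult_left_le) (auto simp: power_le_one)
  ultimately show ?thesis by (simp add: algebra_simps)
qed


section \<open>Bad bounds are unlikely\<close>

definition bounds_above :: "nat \<Rightarrow> (nat \<Rightarrow> nat) \<Rightarrow> (nat \<Rightarrow> nat) set" where
  "bounds_above n \<sigma> = {b. b \<in> bound_family n \<and> (\<forall>i\<in>{1..n}. \<sigma> i \<le> b i)}"

definition bounds_weight :: "nat \<Rightarrow> real \<Rightarrow> (nat \<Rightarrow> nat) \<Rightarrow> real" where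
  "bounds_weight n \<beta> b = (\<Prod>i\<in>{1..n}. geom_weight n (exp (- 2 * \<beta>)) i (b i))"

lemma bounds_weight_nonneg: "\<beta> \<ge> 0 \<Longrightarrow> 0 \<le> bounds_weight n \<beta> b"
  unfolding bounds_weight_def by (intro prod_nonneg ballI geom_weight_nonneg) auto

lemma sum_bounds_weight:
  "\<sigma> permutes {1..n} \<Longrightarrow> (\<Sum>b\<in>bounds_above n \<sigma>. bounds_weight n \<beta> b) = exp (- \<beta> * footrule n \<sigma> id)"
  unfolding bounds_above_def bounds_weight_def by (rule mallows_weight_mixture[symmetric])

text \<open>The form in which independence is used: a product of functions of the single bounds has at most the
  product of the conditional expectations as its expectation, relative to the total weight of
  \<open>\<sigma>\<close>.\<close>

lemma sum_bounds_weight_prod_le: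
  assumes \<beta>: "\<beta> \<ge> 0" and \<sigma>: "\<sigma> permutes {1..n}"
    and f: "\<And>i c. 0 \<le> f i c"
    and A: "\<And>i. i \<in> {1..n} \<Longrightarrow>
      (\<Sum>c\<in>{max i (\<sigma> i)..n}. geom_weight n (exp (- 2 * \<beta>)) i c * f i c) \<le> A i * exp (- 2 * \<beta>) ^ (\<sigma> i - i)"
  shows "(\<Sum>b\<in>bounds_above n \<sigma>. bounds_weight n \<beta> b * (\<Prod>i\<in>{1..n}. f i (b i)))
    \<le> (\<Prod>i\<in>{1..n}. A i) * exp (- \<beta> * footrule n \<sigma> id)"
proof -
  have "(\<Sum>b\<in>bounds_above n \<sigma>. bounds_weight n \<beta> b * (\<Prod>i\<in>{1..n}. f i (b i))) =
     (\<Prod>i\<in>{1..n}. \<Sum>c\<in>{max i (\<sigma> i)..n}. geom_weight n (exp (- 2 * \<beta>)) i c * f i c)"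
    unfolding bounds_above_def bounds_weight_def prod.distrib[symmetric] by (rule sum_above_permutation)
  also have "\<dots> \<le> (\<Prod>i\<in>{1..n}. A i * exp (- 2 * \<beta>) ^ (\<sigma> i - i))"
    using \<beta> f A by (intro prod_mono conjI sum_nonneg mult_nonneg_nonneg geom_weight_nonneg) auto
  also have "\<dots> = (\<Prod>i\<in>{1..n}. A i) * exp (- \<beta> * footrule n \<sigma> id)"
    unfolding mallows_weight[OF \<sigma>] by (rule prod.distrib)
  finally show ?thesis .
qed

lemma one_minus_exp_power_le: "1 - exp (- 2 * \<beta>) ^ j \<le> 2 * \<beta> * real j"
proof -
  have "exp (- 2 * \<beta>) ^ j = exp (real j * (- 2 * \<beta>))" by (rule exp_of_nat_mult[symmetric])
  then show ?thesis using exp_ge_add_one_self[of "real j * (- 2 * \<beta>)"] by (simp add: algebra_simps)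
qed

lemma geom_weight_above:
  assumes \<beta>: "\<beta> \<ge> 0" and \<sigma>: "\<sigma> permutes {1..n}" and i: "i \<in> {1..n}"
  shows "(\<Sum>c\<in>{max i (\<sigma> i)..n}. geom_weight n (exp (- 2 * \<beta>)) i c) = exp (- 2 * \<beta>) ^ (\<sigma> i - i)"
    and "y \<le> n \<Longrightarrow> (\<Sum>c\<in>{max i (\<sigma> i)..n}. geom_weight n (exp (- 2 * \<beta>)) i c * of_bool (c < y))
      \<le> (2 * \<beta> * real (y - i)) * exp (- 2 * \<beta>) ^ (\<sigma> i - i)"
proof -
  have \<sigma>i: "\<sigma> i \<le> n" using permutes_in_image[OF \<sigma>, of i] i by auto
  show "(\<Sum>c\<in>{max i (\<sigma> i)..n}. geom_weight n (exp (- 2 * \<beta>)) i c) = exp (- 2 * \<beta>) ^ (\<sigma> i - i)"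
    using \<sigma>i i by (subst sum_geom_weight) (auto simp: max_def)
  assume y: "y \<le> n"
  have "(\<Sum>c\<in>{max i (\<sigma> i)..n}. geom_weight n (exp (- 2 * \<beta>)) i c * of_bool (c < y)) =
     (\<Sum>c | c \<in> {max i (\<sigma> i)..n} \<and> c < y. geom_weight n (exp (- 2 * \<beta>)) i c)"
    unfolding sum.inter_filter[OF finite_atLeastAtMost] by (intro sum.cong) auto
  also have "\<dots> \<le> (1 - exp (- 2 * \<beta>) ^ (y - i)) * exp (- 2 * \<beta>) ^ (\<sigma> i - i)"
    using \<beta> i \<sigma>i y by (intro geom_weight_tail) auto
  also have "\<dots> \<le> (2 * \<beta> * real (y - i)) * exp (- 2 * \<beta>) ^ (\<sigma> i - i)"
    by (intro mult_right_mono one_minus_exp_power_le) auto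
  finally show "(\<Sum>c\<in>{max i (\<sigma> i)..n}. geom_weight n (exp (- 2 * \<beta>)) i c * of_bool (c < y))
      \<le> (2 * \<beta> * real (y - i)) * exp (- 2 * \<beta>) ^ (\<sigma> i - i)" .
qed

lemma small_bound_unlikely:
  assumes \<beta>: "\<beta> \<ge> 0" and \<sigma>: "\<sigma> permutes {1..n}" and i: "i \<in> {1..n}" and k: "k \<le> n"
  shows "(\<Sum>b\<in>bounds_above n \<sigma>. bounds_weight n \<beta> b * of_bool (b i < k))
    \<le> 2 * \<beta> * real k * exp (- \<beta> * footrule n \<sigma> id)"
proof -
  let ?f = "\<lambda>j c. if j = i then of_bool (c < k) else (1::real)"
  let ?A = "\<lambda>j. if j = i then 2 * \<beta> * real (k - i) else 1"
  have "(\<Sum>b\<in>bounds_above n \<sigma>. bounds_weight n \<beta> b * (\<Prod>j\<in>{1..n}. ?f j (b j)))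
    \<le> (\<Prod>j\<in>{1..n}. ?A j) * exp (- \<beta> * footrule n \<sigma> id)"
    using geom_weight_above[OF \<beta> \<sigma>] k by (intro sum_bounds_weight_prod_le[OF \<beta> \<sigma>]) auto
  also have "(\<Prod>j\<in>{1..n}. ?A j) = 2 * \<beta> * real (k - i)" using i by (simp add: prod.delta)
  also have "(\<lambda>b. \<Prod>j\<in>{1..n}. ?f j (b j)) = (\<lambda>b. of_bool (b i < k))"
    using i by (intro ext) (simp add: prod.delta)
  also have "2 * \<beta> * real (k - i) * exp (- \<beta> * footrule n \<sigma> id) \<le> 2 * \<beta> * real k * exp (- \<beta> * footrule n \<sigma> id)"
    using \<beta> by (intro mult_right_mono mult_left_mono) auto
  finally show ?thesis .
qed

text \<open>A Chernoff bound. Of the \<open>l = min v L\<close> indices just below \<open>v\<close>, each has a bound smaller than \<open>v\<close> with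
  probability at most \<open>2 * \<beta> * L \<le> 1 / 16\<close>, independently. If the pool is too small, more than half
  of them do. Weighting each of them by \<open>16\<close> multiplies the total weight by at most
  \<open>(1 + 15 / 16) ^ l \<le> 2 ^ l\<close>, while it multiplies the exceptional configurations by at least \<open>16 powr (l / 2) = 4 ^ l\<close>.\<close>

lemma small_pool_unlikely:
  assumes \<beta>: "\<beta> \<ge> 0" and \<sigma>: "\<sigma> permutes {1..n}" and v: "v \<in> {1..n}" and L: "32 * \<beta> * real L \<le> 1"
  shows "(\<Sum>b\<in>bounds_above n \<sigma>. bounds_weight n \<beta> b * of_bool (real (card (pool b v)) < real (min v L) / 2))
    \<le> (1 / 2) ^ min v L * exp (- \<beta> * footrule n \<sigma> id)"
proof -
  define l where "l = min v L"
  define I where "I = {v - l<..v}"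
  have lv: "l \<le> v" "l \<le> L" by (auto simp: l_def)
  have I: "I \<subseteq> {1..n}" "card I = l" "finite I" using lv v by (auto simp: I_def)
  let ?f = "\<lambda>j c. if j \<in> I then 1 + 15 * of_bool (c < v) else (1::real)"
  let ?A = "\<lambda>j. if j \<in> I then 2 else (1::real)"
  let ?r = "exp (- 2 * \<beta>)"
  have "(\<Sum>b\<in>bounds_above n \<sigma>. bounds_weight n \<beta> b * (\<Prod>j\<in>{1..n}. ?f j (b j)))
    \<le> (\<Prod>j\<in>{1..n}. ?A j) * exp (- \<beta> * footrule n \<sigma> id)"
  proof (rule sum_bounds_weight_prod_le[OF \<beta> \<sigma>])
    fix j assume j: "j \<in> {1..n}"
    show "(\<Sum>c\<in>{max j (\<sigma> j)..n}. geom_weight n ?r j c * ?f j c) \<le> ?A j * ?r ^ (\<sigma> j - j)"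
    proof (cases "j \<in> I")
      case True
      then have "v - j \<le> L" using lv by (auto simp: I_def)
      then have "2 * \<beta> * real (v - j) \<le> 2 * \<beta> * real L" using \<beta> by (intro mult_left_mono) auto
      then have small: "15 * (2 * \<beta> * real (v - j)) \<le> 1" using L by linarith
      have "(\<Sum>c\<in>{max j (\<sigma> j)..n}. geom_weight n ?r j c * ?f j c) =
         (\<Sum>c\<in>{max j (\<sigma> j)..n}. geom_weight n ?r j c) +
         15 * (\<Sum>c\<in>{max j (\<sigma> j)..n}. geom_weight n ?r j c * of_bool (c < v))"
        unfolding sum_distrib_left sum.distrib[symmetric] using True
        by (intro sum.cong) (auto simp: algebra_simps)
      also have "\<dots> \<le> ?r ^ (\<sigma> j - j) + 15 * ((2 * \<beta> * real (v - j)) * ?r ^ (\<sigma> j - j))"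
        using geom_weight_above[OF \<beta> \<sigma> j] v by (intro add_mono mult_left_mono) auto
      also have "\<dots> = (1 + 15 * (2 * \<beta> * real (v - j))) * ?r ^ (\<sigma> j - j)" by (simp add: algebra_simps)
      also have "\<dots> \<le> 2 * ?r ^ (\<sigma> j - j)" using small by (intro mult_right_mono) auto
      finally show ?thesis using True by simp
    qed (use geom_weight_above[OF \<beta> \<sigma> j] in auto)
  qed auto
  also have "(\<Prod>j\<in>{1..n}. ?A j) = 2 ^ l"
    using I by (simp add: prod.If_cases Int_absorb1)
  finally have tilt: "(\<Sum>b\<in>bounds_above n \<sigma>. bounds_weight n \<beta> b * (\<Prod>j\<in>{1..n}. ?f j (b j)))
    \<le> 2 ^ l * exp (- \<beta> * footrule n \<sigma> id)" .
  have markov: "4 ^ l * of_bool (real (card (pool b v)) < real l / 2) \<le> (\<Prod>j\<in>{1..n}. ?f j (b j))" for b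
  proof (cases "real (card (pool b v)) < real l / 2")
    case True
    define B where "B = {j\<in>I. b j < v}"
    have "I - B \<subseteq> pool b v" using v by (auto simp: B_def I_def pool_def)
    then have "card (I - B) \<le> card (pool b v)" by (intro card_mono finite_pool)
    moreover have "card (I - B) = l - card B" using I by (subst card_Diff_subset) (auto simp: B_def)
    ultimately have "l \<le> 2 * card B" using True by linarith
    have "(\<Prod>j\<in>{1..n}. ?f j (b j)) = (\<Prod>j\<in>{1..n}. if j \<in> B then 16 else 1)"
      by (intro prod.cong) (auto simp: B_def)
    also have "\<dots> = 16 ^ card B"
    proof -
      have "B \<subseteq> {1..n}" using I by (auto simp: B_def)
      then show ?thesis by (simp add: prod.If_cases Int_absorb1)
    qed
    also have "16 ^ card B = (4::real) ^ (2 * card B)" by (simp add: power_mult)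
    finally have "(\<Prod>j\<in>{1..n}. ?f j (b j)) = (4::real) ^ (2 * card B)" .
    moreover have "(4::real) ^ l \<le> 4 ^ (2 * card B)" using \<open>l \<le> 2 * card B\<close> by (intro power_increasing) auto
    ultimately show ?thesis using True by simp
  qed (auto intro!: prod_nonneg)
  have "4 ^ l * (\<Sum>b\<in>bounds_above n \<sigma>. bounds_weight n \<beta> b * of_bool (real (card (pool b v)) < real l / 2))
     = (\<Sum>b\<in>bounds_above n \<sigma>. bounds_weight n \<beta> b * (4 ^ l * of_bool (real (card (pool b v)) < real l / 2)))"
    by (simp add: sum_distrib_left algebra_simps)
  also have "\<dots> \<le> (\<Sum>b\<in>bounds_above n \<sigma>. bounds_weight n \<beta> b * (\<Prod>j\<in>{1..n}. ?f j (b j)))"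
    using \<beta> markov by (intro sum_mono mult_left_mono bounds_weight_nonneg) auto
  also note tilt
  finally have "(\<Sum>b\<in>bounds_above n \<sigma>. bounds_weight n \<beta> b * of_bool (real (card (pool b v)) < real l / 2))
     \<le> 2 ^ l / 4 ^ l * exp (- \<beta> * footrule n \<sigma> id)" by (simp add: field_simps)
  also have "(2::real) ^ l / 4 ^ l = (1 / 2) ^ l" by (simp add: power_divide[symmetric])
  finally show ?thesis by (simp only: l_def)
qed

lemma sum_half_power_le: "k \<le> n \<Longrightarrow> (\<Sum>v\<in>{k<..n}. (1 / 2) ^ min v L) \<le> (1 / 2) ^ k + real n * (1 / 2 :: real) ^ L"
proof -
  assume kn: "k \<le> n"
  have geo: "(\<Sum>v\<in>{k<..n}. (1 / 2 :: real) ^ v) = (1 / 2) ^ k - (1 / 2) ^ n"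
    using kn
  proof (induction n rule: dec_induct)
    case (step n)
    have "{k<..Suc n} = insert (Suc n) {k<..n}" using step by auto
    then show ?case using step by simp
  qed simp
  have "(\<Sum>v\<in>{k<..n}. (1 / 2 :: real) ^ min v L) \<le> (\<Sum>v\<in>{k<..n}. (1 / 2) ^ v + (1 / 2) ^ L)"
    by (intro sum_mono) (auto simp: min_def)
  also have "\<dots> = (1 / 2) ^ k - (1 / 2) ^ n + real (n - k) * (1 / 2) ^ L" by (simp add: sum.distrib geo)
  also have "\<dots> \<le> (1 / 2) ^ k + real n * (1 / 2) ^ L"
    by (intro add_mono mult_right_mono) auto
  finally show ?thesis .
qed

lemma bad_bounds_unlikely:
  assumes \<beta>: "\<beta> \<ge> 0" and \<sigma>: "\<sigma> permutes {1..n}" and k: "k \<le> n" and L: "32 * \<beta> * real L \<le> 1"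
  shows "(\<Sum>b\<in>bounds_above n \<sigma>. bounds_weight n \<beta> b * of_bool (\<not> good_bounds n k L b))
    \<le> (2 * \<beta> * (real k)\<^sup>2 + (1 / 2) ^ k + real n * (1 / 2) ^ L) * exp (- \<beta> * footrule n \<sigma> id)"
proof -
  let ?w = "exp (- \<beta> * footrule n \<sigma> id)"
  let ?small = "\<lambda>b v. real (card (pool b v)) < real (min v L) / 2"
  have union: "of_bool (\<not> good_bounds n k L b) \<le>
     (\<Sum>i\<in>{1..k}. of_bool (b i < k)) + (\<Sum>v\<in>{k<..n}. of_bool (?small b v) :: real)" for b
  proof (cases "good_bounds n k L b")
    case False
    then consider i where "i \<in> {1..k}" "b i < k" | v where "v \<in> {k<..n}" "?small b v"
      using k by (force simp: good_bounds_def not_le)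
    then show ?thesis
    proof cases
      case (1 i)
      then have "1 \<le> (\<Sum>i\<in>{1..k}. of_bool (b i < k) :: real)"
        using member_le_sum[of i "{1..k}" "\<lambda>i. of_bool (b i < k) :: real"] by simp
      moreover have "0 \<le> (\<Sum>v\<in>{k<..n}. of_bool (?small b v) :: real)" by (intro sum_nonneg) auto
      ultimately show ?thesis using False by simp
    next
      case (2 v)
      then have "1 \<le> (\<Sum>v\<in>{k<..n}. of_bool (?small b v) :: real)"
        using member_le_sum[of v "{k<..n}" "\<lambda>v. of_bool (?small b v) :: real"] by simp
      moreover have "0 \<le> (\<Sum>i\<in>{1..k}. of_bool (b i < k) :: real)" by (intro sum_nonneg) auto
      ultimately show ?thesis using False by simp
    qed
  qed (simp add: sum_nonneg)
  have "(\<Sum>b\<in>bounds_above n \<sigma>. bounds_weight n \<beta> b * of_bool (\<not> good_bounds n k L b))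
    \<le> (\<Sum>b\<in>bounds_above n \<sigma>. bounds_weight n \<beta> b *
        ((\<Sum>i\<in>{1..k}. of_bool (b i < k)) + (\<Sum>v\<in>{k<..n}. of_bool (?small b v))))"
    using union \<beta> by (intro sum_mono mult_left_mono bounds_weight_nonneg) auto
  also have "\<dots> = (\<Sum>i\<in>{1..k}. \<Sum>b\<in>bounds_above n \<sigma>. bounds_weight n \<beta> b * of_bool (b i < k)) +
     (\<Sum>v\<in>{k<..n}. \<Sum>b\<in>bounds_above n \<sigma>. bounds_weight n \<beta> b * of_bool (?small b v))"
    unfolding distrib_left sum.distrib sum_distrib_left by (intro arg_cong2[where f = "(+)"] sum.swap)
  also have "\<dots> \<le> (\<Sum>i\<in>{1..k}. 2 * \<beta> * real k * ?w) + (\<Sum>v\<in>{k<..n}. (1 / 2) ^ min v L * ?w)"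
    using k by (intro add_mono sum_mono small_bound_unlikely[OF \<beta> \<sigma>] small_pool_unlikely[OF \<beta> \<sigma> _ L]) auto
  also have "\<dots> = (2 * \<beta> * (real k)\<^sup>2 + (\<Sum>v\<in>{k<..n}. (1 / 2) ^ min v L)) * ?w"
    unfolding distrib_right sum_distrib_right by (simp add: power2_eq_square)
  also have "\<dots> \<le> (2 * \<beta> * (real k)\<^sup>2 + ((1 / 2) ^ k + real n * (1 / 2) ^ L)) * ?w"
    by (intro mult_right_mono add_left_mono sum_half_power_le[OF k]) auto
  finally show ?thesis by (simp add: add.assoc)
qed

section \<open>Cycle patterns under the Mallows measure\<close>

definition mallows_expect :: "nat \<Rightarrow> real \<Rightarrow> ((nat \<Rightarrow> nat) \<Rightarrow> real) \<Rightarrow> real" where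
  "mallows_expect n \<beta> f = (\<Sum>\<sigma> | \<sigma> permutes {1..n}. exp (- \<beta> * footrule n \<sigma> id) * f \<sigma>) / mallows_Z n \<beta>"

lemma mallows_sum_mixture:
  "(\<Sum>\<sigma> | \<sigma> permutes {1..n}. exp (- \<beta> * footrule n \<sigma> id) * f \<sigma>) =
   (\<Sum>b\<in>bound_family n. bounds_weight n \<beta> b * (\<Sum>\<sigma>\<in>bounded_perms b n. f \<sigma>))"
proof -
  have "(\<Sum>\<sigma> | \<sigma> permutes {1..n}. exp (- \<beta> * footrule n \<sigma> id) * f \<sigma>) =
     (\<Sum>\<sigma>\<in>{\<sigma>. \<sigma> permutes {1..n}}. \<Sum>b | b \<in> bound_family n \<and> (\<forall>i\<in>{1..n}. \<sigma> i \<le> b i). bounds_weight n \<beta> b * f \<sigma>)"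
    unfolding sum_distrib_right[symmetric] bounds_above_def[symmetric]
    by (intro sum.cong refl) (simp only: mem_Collect_eq sum_bounds_weight)
  also have "\<dots> = (\<Sum>b\<in>bound_family n. \<Sum>\<sigma> | \<sigma> \<in> {\<sigma>. \<sigma> permutes {1..n}} \<and> (\<forall>i\<in>{1..n}. \<sigma> i \<le> b i). bounds_weight n \<beta> b * f \<sigma>)"
    by (intro sum.swap_restrict finite_perms finite_bound_family)
  also have "\<dots> = (\<Sum>b\<in>bound_family n. bounds_weight n \<beta> b * (\<Sum>\<sigma>\<in>bounded_perms b n. f \<sigma>))"
    by (simp add: sum_distrib_left bounded_perms_def)
  finally show ?thesis .
qed

text \<open>The bounds are drawn first: good bounds contribute the error of following points down, and bad
  bounds contribute at most their own probability.\<close>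

lemma mallows_pattern_error:
  fixes X :: "'x set" and lab :: "'x \<Rightarrow> 'l"
  assumes \<beta>: "\<beta> \<ge> 0" and k: "8 \<le> k" "k \<le> n" and L: "8 \<le> L" "32 * \<beta> * real L \<le> 1"
    and X: "finite X" and t: "inj_on t X" "t ` X \<subseteq> {1..n}"
  shows "\<bar>mallows_expect n \<beta> (\<lambda>\<sigma>. of_bool (same_pattern \<sigma> X t lab)) - ewens X lab\<bar>
    \<le> (real (card X))\<^sup>2 * (64 / k + 32 * n / (real L)\<^sup>2) +
       (2 * \<beta> * (real k)\<^sup>2 + (1 / 2) ^ k + real n * (1 / 2) ^ L)"
proof -
  define Z where "Z = mallows_Z n \<beta>"
  define q where "q = ewens X lab"
  define \<delta> where "\<delta> = (real (card X))\<^sup>2 * (64 / k + 32 * n / (real L)\<^sup>2)"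
  define \<eta> where "\<eta> = 2 * \<beta> * (real k)\<^sup>2 + (1 / 2) ^ k + real n * (1 / 2) ^ L"
  let ?E = "\<lambda>\<sigma>. same_pattern \<sigma> X t lab"
  let ?w = "\<lambda>\<sigma>. exp (- \<beta> * footrule n \<sigma> id)"
  have Z: "Z > 0" by (simp add: Z_def mallows_Z_pos)
  have Z_sum: "Z = (\<Sum>\<sigma> | \<sigma> permutes {1..n}. ?w \<sigma> * 1)" by (simp add: Z_def mallows_Z_def)
  have \<delta>0: "0 \<le> \<delta>" by (simp add: \<delta>_def)
  have pointwise: "\<bar>\<Sum>\<sigma>\<in>bounded_perms b n. of_bool (?E \<sigma>) - q\<bar>
      \<le> (\<Sum>\<sigma>\<in>bounded_perms b n. \<delta> + of_bool (\<not> good_bounds n k L b))" if b: "b \<in> bound_family n" for b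
  proof -
    define C where "C = real (card (bounded_perms b n))"
    have bi: "i \<le> b i" if "i \<in> {1..n}" for i using b that by (auto simp: bound_family_def PiE_iff)
    have C: "C > 0" using bounded_perms_nonempty[OF bi] by (simp add: C_def)
    have "(\<Sum>\<sigma>\<in>bounded_perms b n. of_bool (?E \<sigma>)) = C * bounded_prob b n ?E"
      using C finite_bounded_perms[of b n] by (simp add: bounded_prob_def C_def Int_def)
    then have eq: "(\<Sum>\<sigma>\<in>bounded_perms b n. of_bool (?E \<sigma>) - q) = C * (bounded_prob b n ?E - q)"
      by (simp add: sum_subtractf C_def algebra_simps)
    have "\<bar>bounded_prob b n ?E - q\<bar> \<le> \<delta> + of_bool (\<not> good_bounds n k L b)"
    proof (cases "good_bounds n k L b")
      case True
      then show ?thesis using bounded_prob_good[OF bi k(1) L(1) True X t, of lab] by (simp add: q_def \<delta>_def)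
    next
      case False
      have "\<bar>bounded_prob b n ?E - q\<bar> \<le> 1"
        using bounded_prob_bounds[of b n ?E] ewens_nonneg[of X lab] ewens_le_1[OF X, of lab]
        by (simp add: q_def abs_le_iff)
      then show ?thesis using False \<delta>0 by simp
    qed
    then show ?thesis unfolding eq using C by (simp add: abs_mult C_def[symmetric])
  qed
  have "mallows_expect n \<beta> (\<lambda>\<sigma>. of_bool (?E \<sigma>)) * Z = (\<Sum>\<sigma> | \<sigma> permutes {1..n}. ?w \<sigma> * of_bool (?E \<sigma>))"
    using Z unfolding mallows_expect_def Z_def[symmetric] by simp
  moreover have "q * Z = (\<Sum>\<sigma> | \<sigma> permutes {1..n}. ?w \<sigma> * q)"
    unfolding Z_sum sum_distrib_left by (intro sum.cong) auto
  ultimately have "(mallows_expect n \<beta> (\<lambda>\<sigma>. of_bool (?E \<sigma>)) - q) * Z =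
     (\<Sum>\<sigma> | \<sigma> permutes {1..n}. ?w \<sigma> * (of_bool (?E \<sigma>) - q))"
    unfolding left_diff_distrib right_diff_distrib sum_subtractf by (simp only:)
  also have "\<dots> = (\<Sum>b\<in>bound_family n. bounds_weight n \<beta> b * (\<Sum>\<sigma>\<in>bounded_perms b n. of_bool (?E \<sigma>) - q))"
    by (rule mallows_sum_mixture)
  finally have "\<bar>(mallows_expect n \<beta> (\<lambda>\<sigma>. of_bool (?E \<sigma>)) - q) * Z\<bar> =
     \<bar>\<Sum>b\<in>bound_family n. bounds_weight n \<beta> b * (\<Sum>\<sigma>\<in>bounded_perms b n. of_bool (?E \<sigma>) - q)\<bar>"
    by (simp only:)
  then have "\<bar>mallows_expect n \<beta> (\<lambda>\<sigma>. of_bool (?E \<sigma>)) - q\<bar> * Z =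
     \<bar>\<Sum>b\<in>bound_family n. bounds_weight n \<beta> b * (\<Sum>\<sigma>\<in>bounded_perms b n. of_bool (?E \<sigma>) - q)\<bar>"
    unfolding abs_mult using Z by (simp only: abs_of_pos)
  also have "\<dots> \<le> (\<Sum>b\<in>bound_family n. bounds_weight n \<beta> b * (\<Sum>\<sigma>\<in>bounded_perms b n. \<delta> + of_bool (\<not> good_bounds n k L b)))"
  proof (rule order_trans[OF sum_abs], rule sum_mono)
    fix b assume b: "b \<in> bound_family n"
    show "\<bar>bounds_weight n \<beta> b * (\<Sum>\<sigma>\<in>bounded_perms b n. of_bool (?E \<sigma>) - q)\<bar> \<le>
      bounds_weight n \<beta> b * (\<Sum>\<sigma>\<in>bounded_perms b n. \<delta> + of_bool (\<not> good_bounds n k L b))"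
      unfolding abs_mult abs_of_nonneg[OF bounds_weight_nonneg[OF \<beta>]]
      by (rule mult_left_mono[OF pointwise[OF b] bounds_weight_nonneg[OF \<beta>]])
  qed
  also have "\<dots> = (\<Sum>b\<in>bound_family n. bounds_weight n \<beta> b * (\<Sum>\<sigma>\<in>bounded_perms b n. \<delta>)) +
      (\<Sum>b\<in>bound_family n. \<Sum>\<sigma> | \<sigma> \<in> {\<sigma>. \<sigma> permutes {1..n}} \<and> (\<forall>i\<in>{1..n}. \<sigma> i \<le> b i). bounds_weight n \<beta> b * of_bool (\<not> good_bounds n k L b))"
    unfolding sum.distrib[symmetric] by (intro sum.cong refl) (simp add: bounded_perms_def algebra_simps)
  also have "(\<Sum>b\<in>bound_family n. bounds_weight n \<beta> b * (\<Sum>\<sigma>\<in>bounded_perms b n. \<delta>)) = \<delta> * Z"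
  proof -
    have "(\<Sum>\<sigma> | \<sigma> permutes {1..n}. ?w \<sigma> * \<delta>) = \<delta> * Z"
      unfolding Z_sum sum_distrib_left by (intro sum.cong) auto
    then show ?thesis unfolding mallows_sum_mixture .
  qed
  also have "(\<Sum>b\<in>bound_family n. \<Sum>\<sigma> | \<sigma> \<in> {\<sigma>. \<sigma> permutes {1..n}} \<and> (\<forall>i\<in>{1..n}. \<sigma> i \<le> b i). bounds_weight n \<beta> b * of_bool (\<not> good_bounds n k L b)) =
      (\<Sum>\<sigma>\<in>{\<sigma>. \<sigma> permutes {1..n}}. \<Sum>b | b \<in> bound_family n \<and> (\<forall>i\<in>{1..n}. \<sigma> i \<le> b i). bounds_weight n \<beta> b * of_bool (\<not> good_bounds n k L b))"
    by (intro sum.swap_restrict[symmetric] finite_perms finite_bound_family)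
  also have "\<dots> \<le> (\<Sum>\<sigma>\<in>{\<sigma>. \<sigma> permutes {1..n}}. \<eta> * ?w \<sigma>)"
    unfolding \<eta>_def using bad_bounds_unlikely[OF \<beta> _ k(2) L(2), unfolded bounds_above_def]
    by (intro sum_mono) auto
  also have "\<dots> = \<eta> * Z" unfolding Z_sum sum_distrib_left by simp
  finally have "\<bar>mallows_expect n \<beta> (\<lambda>\<sigma>. of_bool (?E \<sigma>)) - q\<bar> * Z \<le> (\<delta> + \<eta>) * Z" by (simp add: distrib_right)
  then show ?thesis using Z by (simp add: q_def \<delta>_def \<eta>_def)
qed

lemma square_le_two_power: "4 \<le> L \<Longrightarrow> L\<^sup>2 \<le> (2::nat) ^ L"
proof (induction L rule: nat_induct_at_least)
  case (Suc L)
  have "2 * L + 1 \<le> L * L" using Suc(1) mult_le_mono1[of 4 L L] by linarith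
  then show ?case using Suc by (simp add: power2_eq_square)
qed simp

text \<open>Here \<open>L\<close> is chosen of order \<open>1 / \<beta>\<close>, and the error is \<open>O(1 / k + 1 / 2 ^ k)\<close> plus terms
  that vanish for fixed \<open>k\<close> when \<open>n * \<beta>\<^sup>2 \<rightarrow> 0\<close>. The exponentially small term \<open>n / 2 ^ L\<close> is crudely bounded by
  \<open>n / L\<^sup>2\<close>, which is present anyway.\<close>

theorem mallows_pattern_limit:
  fixes X :: "'x set" and lab :: "'x \<Rightarrow> 'l" and \<beta> :: "nat \<Rightarrow> real"
  assumes pos: "\<And>n. n \<ge> 1 \<Longrightarrow> \<beta> n > 0"
    and lim: "(\<lambda>n. sqrt (real n) * \<beta> n) \<longlonglongrightarrow> 0"
    and X: "finite X" and \<epsilon>: "\<epsilon> > 0"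
  shows "\<forall>\<^sub>F n in sequentially. \<forall>t. inj_on t X \<and> t ` X \<subseteq> {1..n} \<longrightarrow>
    \<bar>mallows_expect n (\<beta> n) (\<lambda>\<sigma>. of_bool (same_pattern \<sigma> X t lab)) - ewens X lab\<bar> \<le> \<epsilon>"
proof -
  define M where "M = (real (card X))\<^sup>2"
  have "(\<lambda>k. M * 64 / real k + (1 / 2) ^ k) \<longlonglongrightarrow> 0 + 0"
    by (intro tendsto_add LIMSEQ_power_zero lim_const_over_n) simp
  then have "\<forall>\<^sub>F k in sequentially. M * 64 / real k + (1 / 2) ^ k < \<epsilon> / 2"
    using \<epsilon> by (intro order_tendstoD(2)[of _ "0::real"]) auto
  then have "\<forall>\<^sub>F k in sequentially. M * 64 / real k + (1 / 2) ^ k < \<epsilon> / 2 \<and> 8 \<le> k"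
    using eventually_ge_at_top by (rule eventually_conj)
  then obtain k where k: "M * 64 / real k + (1 / 2) ^ k < \<epsilon> / 2" "8 \<le> k"
    using eventually_happens'[OF sequentially_bot] by blast
  define a where "a n = sqrt (real n) * \<beta> n" for n
  have a: "a \<longlonglongrightarrow> 0" using lim by (simp add: a_def[abs_def])
  have "(\<lambda>n. (32 * M + 1) * 4096 * (a n)\<^sup>2 + 2 * (real k)\<^sup>2 * a n) \<longlonglongrightarrow> (32 * M + 1) * 4096 * 0\<^sup>2 + 2 * (real k)\<^sup>2 * 0"
    by (intro tendsto_intros a)
  then have ev1: "\<forall>\<^sub>F n in sequentially. (32 * M + 1) * 4096 * (a n)\<^sup>2 + 2 * (real k)\<^sup>2 * a n < \<epsilon> / 2"
    using \<epsilon> by (intro order_tendstoD(2)[of _ "0::real"]) auto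
  have ev2: "\<forall>\<^sub>F n in sequentially. a n < 1 / 512" using order_tendstoD(2)[OF a, of "1 / 512"] by simp
  show ?thesis
    using ev1 ev2 eventually_ge_at_top[of k]
  proof eventually_elim
    case (elim n)
    have n1: "n \<ge> 1" using elim k by simp
    have \<beta>: "\<beta> n > 0" using pos[OF n1] .
    have "1 \<le> sqrt (real n)" using n1 by simp
    then have \<beta>a: "\<beta> n \<le> a n" using \<beta> by (simp add: a_def)
    define L where "L = nat \<lfloor>1 / (32 * \<beta> n)\<rfloor>"
    have Lle: "real L \<le> 1 / (32 * \<beta> n)" using \<beta> by (simp add: L_def)
    \<comment> \<open>rounding \<open>1 / (32 * \<beta> n)\<close> down loses at most a factor of two\<close>
    have big: "1 / (64 * \<beta> n) \<ge> 8" using elim \<beta>a \<beta> by (simp add: field_simps)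
    have "1 / (32 * \<beta> n) = 1 / (64 * \<beta> n) + 1 / (64 * \<beta> n)" using \<beta> by (simp add: field_simps)
    then have Lge: "real L \<ge> 1 / (64 * \<beta> n)" using big unfolding L_def by linarith
    have L8: "8 \<le> L" using big Lge by linarith
    have L32: "32 * \<beta> n * real L \<le> 1" using Lle \<beta> by (simp add: field_simps)
    have "(1 / (64 * \<beta> n))\<^sup>2 \<le> (real L)\<^sup>2" using Lge \<beta> by (intro power_mono) auto
    then have "real n / (real L)\<^sup>2 \<le> real n / (1 / (64 * \<beta> n))\<^sup>2" using \<beta> L8 by (intro divide_left_mono) auto
    also have "\<dots> = 4096 * (a n)\<^sup>2" using \<beta> by (simp add: a_def power_mult_distrib power_divide)
    finally have nL: "real n / (real L)\<^sup>2 \<le> 4096 * (a n)\<^sup>2" .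
    have "real (L\<^sup>2) \<le> real (2 ^ L)" using square_le_two_power[of L] L8 by (intro of_nat_mono) simp
    then have "real n * (1 / 2) ^ L \<le> real n / (real L)\<^sup>2"
      using L8 by (simp add: power_one_over field_simps mult_left_mono)
    then have n2: "real n * (1 / 2) ^ L \<le> 4096 * (a n)\<^sup>2" using nL by linarith
    have "M * (32 * n / (real L)\<^sup>2) \<le> M * (32 * (4096 * (a n)\<^sup>2))"
      using mult_left_mono[OF nL, of 32] by (intro mult_left_mono) (auto simp: M_def)
    moreover have "2 * \<beta> n * (real k)\<^sup>2 \<le> 2 * a n * (real k)\<^sup>2" using \<beta>a by (intro mult_right_mono) auto
    moreover have "M * (64 / k + 32 * n / (real L)\<^sup>2) +
       (2 * \<beta> n * (real k)\<^sup>2 + (1 / 2) ^ k + real n * (1 / 2) ^ L) \<le> \<epsilon>"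
      if "M * (32 * n / (real L)\<^sup>2) \<le> M * (32 * (4096 * (a n)\<^sup>2))"
        "2 * \<beta> n * (real k)\<^sup>2 \<le> 2 * a n * (real k)\<^sup>2"
    proof -
      have e1: "M * (64 / k + 32 * n / (real L)\<^sup>2) = M * 64 / real k + M * (32 * n / (real L)\<^sup>2)"
        by (simp add: distrib_left)
      have e2: "(32 * M + 1) * 4096 * (a n)\<^sup>2 = M * (32 * (4096 * (a n)\<^sup>2)) + 4096 * (a n)\<^sup>2"
        by (simp add: distrib_right)
      have e3: "2 * (real k)\<^sup>2 * a n = 2 * a n * (real k)\<^sup>2" by simp
      show ?thesis using k(1) elim(1) n2 that unfolding e1 e2 e3 by linarith
    qed
    ultimately have error: "M * (64 / k + 32 * n / (real L)\<^sup>2) +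
       (2 * \<beta> n * (real k)\<^sup>2 + (1 / 2) ^ k + real n * (1 / 2) ^ L) \<le> \<epsilon>" by simp
    show ?case
    proof (intro allI impI)
      fix t assume t: "inj_on t X \<and> t ` X \<subseteq> {1..n}"
      show "\<bar>mallows_expect n (\<beta> n) (\<lambda>\<sigma>. of_bool (same_pattern \<sigma> X t lab)) - ewens X lab\<bar> \<le> \<epsilon>"
        using mallows_pattern_error[OF less_imp_le[OF \<beta>] k(2) elim(3) L8 L32 X conjunct1[OF t] conjunct2[OF t], of lab]
        by (rule order_trans) (use error in \<open>simp add: M_def\<close>)
    qed
  qed
qed


section \<open>Sampling points\<close>

lemma card_PiE_coincidence_le:
  assumes Y: "finite Y" "y \<in> Y" and B: "finite B" and g: "\<And>t a. g (t(y := a)) = g t"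
  shows "card {t \<in> PiE Y (\<lambda>_. B). t y = g t} \<le> card B ^ (card Y - 1)"
proof -
  let ?A = "{t \<in> PiE Y (\<lambda>_. B). t y = g t}"
  have "inj_on (\<lambda>t. restrict t (Y - {y})) ?A"
  proof (rule inj_onI)
    fix t u assume "t \<in> ?A" "u \<in> ?A" and eq: "restrict t (Y - {y}) = restrict u (Y - {y})"
    then have t: "t \<in> PiE Y (\<lambda>_. B)" "t y = g t" and u: "u \<in> PiE Y (\<lambda>_. B)" "u y = g u" by auto
    have other: "t x = u x" if "x \<noteq> y" for x
    proof (cases "x \<in> Y")
      case True then show ?thesis using fun_cong[OF eq, of x] that by simp
    next
      case False then show ?thesis using PiE_arb[OF t(1)] PiE_arb[OF u(1)] by simp
    qed
    have "t(y := u y) = u"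
    proof
      fix x show "(t(y := u y)) x = u x" using other[of x] by (cases "x = y") simp_all
    qed
    then have "g t = g u" using g[of t "u y"] by metis
    then have ty: "t y = u y" unfolding t(2) u(2) .
    show "t = u"
    proof
      fix x show "t x = u x" using other[of x] ty by (cases "x = y") simp_all
    qed
  qed
  moreover have "(\<lambda>t. restrict t (Y - {y})) ` ?A \<subseteq> PiE (Y - {y}) (\<lambda>_. B)"
  proof
    fix u assume "u \<in> (\<lambda>t. restrict t (Y - {y})) ` ?A"
    then obtain t where "t \<in> PiE Y (\<lambda>_. B)" "u = restrict t (Y - {y})" by auto
    then show "u \<in> PiE (Y - {y}) (\<lambda>_. B)" by (simp add: PiE_iff)
  qed
  ultimately have "card ?A \<le> card (PiE (Y - {y}) (\<lambda>_. B))"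
    using Y B by (intro card_inj_on_le finite_PiE) auto
  then show ?thesis using Y by (simp add: card_PiE)
qed

text \<open>Averages over all choices of points see only the injective choices: a coincidence among the points, or
  with \<open>s n\<close>, has probability \<open>O(1 / n)\<close>.\<close>

lemma sample_average_limit:
  fixes h :: "nat \<Rightarrow> ('y \<Rightarrow> nat) \<Rightarrow> real"
  assumes Y: "finite Y" and q: "\<bar>q\<bar> \<le> 1" and h: "\<And>n t. \<bar>h n t\<bar> \<le> 1"
    and conv: "\<And>\<epsilon>. \<epsilon> > 0 \<Longrightarrow> \<forall>\<^sub>F n in sequentially. \<forall>t\<in>PiE Y (\<lambda>_. {1..n}).
      inj_on t Y \<and> s n \<notin> t ` Y \<longrightarrow> \<bar>h n t - q\<bar> \<le> \<epsilon>"
  shows "(\<lambda>n. (\<Sum>t\<in>PiE Y (\<lambda>_. {1..n}). h n t) / real n ^ card Y) \<longlonglongrightarrow> q"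
proof -
  define m where "m = card Y"
  define K where "K = real m + real m * real m"
  define bad where "bad n t \<longleftrightarrow> \<not> (inj_on t Y \<and> s n \<notin> t ` Y)" for n and t :: "'y \<Rightarrow> nat"
  let ?P = "\<lambda>n. PiE Y (\<lambda>_. {1..n::nat})"
  have fin: "finite (?P n)" for n by (rule finite_PiE[OF Y]) simp
  have cardP: "real (card (?P n)) = real n ^ m" for n using Y by (simp add: card_PiE m_def)
  have coincide: "real (card {t \<in> ?P n. t y = g t}) \<le> real n ^ m / real n"
    if "y \<in> Y" "n \<ge> 1" "\<And>t a. g (t(y := a)) = g t" for g y n
  proof -
    have m1: "m \<ge> 1" using that(1) Y by (auto simp: m_def Suc_le_eq card_gt_0_iff)
    have "card {t \<in> ?P n. t y = g t} \<le> n ^ (m - 1)"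
      using card_PiE_coincidence_le[OF Y that(1) _ that(3), of "{1..n}"] by (simp add: m_def)
    then have "real (card {t \<in> ?P n. t y = g t}) \<le> real n ^ (m - 1)" by (simp only: of_nat_power[symmetric] of_nat_le_iff)
    also have "\<dots> = real n ^ m / real n" using that(2) m1 by (simp add: power_diff)
    finally show ?thesis .
  qed
  have bad_card: "real (card {t \<in> ?P n. bad n t}) \<le> K * (real n ^ m / real n)" if n: "n \<ge> 1" for n
  proof -
    let ?A = "\<lambda>y. {t \<in> ?P n. t y = s n}" and ?B = "\<lambda>y y'. {t \<in> ?P n. t y = t y'}"
    have "{t \<in> ?P n. bad n t} \<subseteq> (\<Union>y\<in>Y. ?A y) \<union> (\<Union>y\<in>Y. \<Union>y'\<in>Y - {y}. ?B y y')"
    proof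
      fix t assume "t \<in> {t \<in> ?P n. bad n t}"
      then have t: "t \<in> ?P n" and b: "bad n t" by auto
      have "(\<exists>y\<in>Y. t y = s n) \<or> (\<exists>y\<in>Y. \<exists>y'\<in>Y. y' \<noteq> y \<and> t y = t y')"
      proof (cases "inj_on t Y")
        case True
        then have "s n \<in> t ` Y" using b by (simp add: bad_def)
        then show ?thesis by (auto simp: image_iff)
      next
        case False
        then show ?thesis unfolding inj_on_def by metis
      qed
      then show "t \<in> (\<Union>y\<in>Y. ?A y) \<union> (\<Union>y\<in>Y. \<Union>y'\<in>Y - {y}. ?B y y')" using t by blast
    qed
    then have "card {t \<in> ?P n. bad n t} \<le> card ((\<Union>y\<in>Y. ?A y) \<union> (\<Union>y\<in>Y. \<Union>y'\<in>Y - {y}. ?B y y'))"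
      using Y fin[of n] by (intro card_mono) auto
    also have "\<dots> \<le> card (\<Union>y\<in>Y. ?A y) + card (\<Union>y\<in>Y. \<Union>y'\<in>Y - {y}. ?B y y')" by (rule card_Un_le)
    also have "\<dots> \<le> (\<Sum>y\<in>Y. card (?A y)) + (\<Sum>y\<in>Y. \<Sum>y'\<in>Y - {y}. card (?B y y'))"
    proof (rule add_mono[OF card_UN_le[OF Y]])
      have "card (\<Union>y\<in>Y. \<Union>y'\<in>Y - {y}. ?B y y') \<le> (\<Sum>y\<in>Y. card (\<Union>y'\<in>Y - {y}. ?B y y'))"
        by (rule card_UN_le[OF Y])
      also have "\<dots> \<le> (\<Sum>y\<in>Y. \<Sum>y'\<in>Y - {y}. card (?B y y'))"
        using Y by (intro sum_mono card_UN_le) simp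
      finally show "card (\<Union>y\<in>Y. \<Union>y'\<in>Y - {y}. ?B y y') \<le> (\<Sum>y\<in>Y. \<Sum>y'\<in>Y - {y}. card (?B y y'))" .
    qed
    finally have "real (card {t \<in> ?P n. bad n t}) \<le>
        real ((\<Sum>y\<in>Y. card (?A y)) + (\<Sum>y\<in>Y. \<Sum>y'\<in>Y - {y}. card (?B y y')))" by (rule of_nat_mono)
    also have "\<dots> = (\<Sum>y\<in>Y. real (card (?A y))) + (\<Sum>y\<in>Y. \<Sum>y'\<in>Y - {y}. real (card (?B y y')))" by simp
    also have "\<dots> \<le> (\<Sum>y\<in>Y. real n ^ m / real n) + (\<Sum>y\<in>Y. \<Sum>y'\<in>Y - {y}. real n ^ m / real n)"
      using n by (intro add_mono sum_mono coincide) auto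
    also have "(\<Sum>y\<in>Y. \<Sum>y'\<in>Y - {y}. real n ^ m / real n) \<le> (\<Sum>y\<in>Y. \<Sum>y'\<in>Y. real n ^ m / real n)"
      using Y by (intro sum_mono sum_mono2) auto
    finally show ?thesis by (simp add: K_def m_def algebra_simps)
  qed
  show ?thesis
  proof (rule tendstoI)
    fix e :: real assume e: "e > 0"
    have "(\<lambda>n. 2 * K / real n) \<longlonglongrightarrow> 0" by (rule lim_const_over_n)
    then have "\<forall>\<^sub>F n in sequentially. 2 * K / real n < e / 2"
      using e by (intro order_tendstoD(2)[of _ "0::real"]) auto
    moreover have "\<forall>\<^sub>F n in sequentially. \<forall>t\<in>?P n. inj_on t Y \<and> s n \<notin> t ` Y \<longrightarrow> \<bar>h n t - q\<bar> \<le> e / 4"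
      using e by (intro conv) auto
    ultimately show "\<forall>\<^sub>F n in sequentially. dist ((\<Sum>t\<in>?P n. h n t) / real n ^ card Y) q < e"
      using eventually_ge_at_top[of 1]
    proof eventually_elim
      case (elim n)
      have nm: "real n ^ m > 0" using elim by simp
      have "\<bar>(\<Sum>t\<in>?P n. h n t) - real n ^ m * q\<bar> = \<bar>\<Sum>t\<in>?P n. h n t - q\<bar>"
        unfolding sum_subtractf by (simp only: sum_constant cardP)
      also have "\<dots> \<le> (\<Sum>t\<in>?P n. \<bar>h n t - q\<bar>)" by (rule sum_abs)
      also have "\<dots> \<le> (\<Sum>t\<in>?P n. e / 4 + 2 * of_bool (bad n t))"
      proof (rule sum_mono)
        fix t assume t: "t \<in> ?P n"
        have "\<bar>h n t - q\<bar> \<le> 2" using h[of n t] q by linarith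
        then show "\<bar>h n t - q\<bar> \<le> e / 4 + 2 * of_bool (bad n t)"
          using elim(2) t e by (cases "bad n t") (auto simp: bad_def)
      qed
      also have "\<dots> = real n ^ m * (e / 4) + 2 * real (card {t \<in> ?P n. bad n t})"
      proof -
        have "(\<Sum>t\<in>?P n. of_bool (bad n t)) = real (card {t \<in> ?P n. bad n t})"
          using fin[of n] by (simp add: Int_def)
        then show ?thesis unfolding sum.distrib sum_distrib_left[symmetric] sum_constant cardP by simp
      qed
      also have "\<dots> \<le> real n ^ m * (e / 4) + 2 * (K * (real n ^ m / real n))"
        using bad_card[OF elim(3)] by simp
      also have "\<dots> = real n ^ m * (e / 4 + 2 * K / real n)" by (simp add: algebra_simps)
      also have "\<dots> < real n ^ m * e" using nm elim(1) e by (intro mult_strict_left_mono) auto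
      finally have "\<bar>(\<Sum>t\<in>?P n. h n t) - real n ^ m * q\<bar> < real n ^ m * e" .
      moreover have "(\<Sum>t\<in>?P n. h n t) / real n ^ card Y - q = ((\<Sum>t\<in>?P n. h n t) - real n ^ m * q) / real n ^ m"
        using nm by (simp add: m_def field_simps)
      ultimately show ?case using nm by (simp add: dist_real_def abs_divide divide_less_eq mult.commute)
    qed
  qed
qed

lemma mallows_expect_abs_le:
  assumes "\<And>\<sigma>. \<sigma> permutes {1..n} \<Longrightarrow> \<bar>f \<sigma>\<bar> \<le> 1"
  shows "\<bar>mallows_expect n \<beta> f\<bar> \<le> 1"
proof -
  have "\<bar>\<Sum>\<sigma> | \<sigma> permutes {1..n}. exp (- \<beta> * footrule n \<sigma> id) * f \<sigma>\<bar> \<le> mallows_Z n \<beta>"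
    unfolding mallows_Z_def using assms
    by (intro order_trans[OF sum_abs] sum_mono) (auto simp: abs_mult)
  then show ?thesis using mallows_Z_pos[of n \<beta>] by (simp add: mallows_expect_def abs_divide)
qed

lemma mallows_expect_cong:
  "(\<And>\<sigma>. \<sigma> permutes {1..n} \<Longrightarrow> f \<sigma> = g \<sigma>) \<Longrightarrow> mallows_expect n \<beta> f = mallows_expect n \<beta> g"
  unfolding mallows_expect_def by (intro arg_cong2[where f = "(/)"] sum.cong) auto

lemma mallows_expect_sum: "mallows_expect n \<beta> (\<lambda>\<sigma>. \<Sum>i\<in>I. f i \<sigma>) = (\<Sum>i\<in>I. mallows_expect n \<beta> (f i))"
proof -
  have "(\<Sum>\<sigma> | \<sigma> permutes {1..n}. exp (- \<beta> * footrule n \<sigma> id) * (\<Sum>i\<in>I. f i \<sigma>)) =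
      (\<Sum>i\<in>I. \<Sum>\<sigma> | \<sigma> permutes {1..n}. exp (- \<beta> * footrule n \<sigma> id) * f i \<sigma>)"
    unfolding sum_distrib_left by (rule sum.swap)
  then show ?thesis by (simp add: mallows_expect_def sum_divide_distrib)
qed

lemma mallows_expect_divide: "mallows_expect n \<beta> (\<lambda>\<sigma>. f \<sigma> / c) = mallows_expect n \<beta> f / c"
  by (simp add: mallows_expect_def sum_divide_distrib[symmetric] mult.commute)

section \<open>The cycle of a given point\<close>

lemma prod_of_bool: "finite A \<Longrightarrow> (\<Prod>x\<in>A. of_bool (P x)) = (of_bool (\<forall>x\<in>A. P x) :: real)"
  by (induction A rule: finite_induct) auto

text \<open>A power of the cardinality counts tuples of points. The base point \<open>s\<close> joins the tuple as the entry with
  index \<open>m\<close>, and the constant labelling asks for a single cycle.\<close>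

lemma orbit_power_sample:
  assumes \<sigma>: "\<sigma> permutes {1..n}" and s: "s \<in> {1..n}"
  shows "real (card (orbit \<sigma> s)) ^ m =
    (\<Sum>t\<in>PiE {..<m} (\<lambda>_. {1..n}). of_bool (same_pattern \<sigma> {..m} (t(m := s)) (\<lambda>_. 0::nat)))"
proof -
  have sub: "orbit \<sigma> s \<subseteq> {1..n}" by (rule permutes_orbit_subset[OF \<sigma> s])
  have "same_pattern \<sigma> {..m} (t(m := s)) (\<lambda>_. 0::nat) \<longleftrightarrow> (\<forall>j\<in>{..<m}. t j \<in> orbit \<sigma> s)" for t
  proof
    assume l: "same_pattern \<sigma> {..m} (t(m := s)) (\<lambda>_. 0::nat)"
    show "\<forall>j\<in>{..<m}. t j \<in> orbit \<sigma> s"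
    proof
      fix j assume "j \<in> {..<m}"
      then show "t j \<in> orbit \<sigma> s" using l[unfolded same_pattern_def, rule_format, of m j] by simp
    qed
  next
    assume r: "\<forall>j\<in>{..<m}. t j \<in> orbit \<sigma> s"
    then have "orbit \<sigma> ((t(m := s)) j) = orbit \<sigma> s" if "j \<in> {..m}" for j
    proof (cases "j = m")
      case False
      then have "same_cycle \<sigma> s (t j)" using r that by simp
      then have "orbit \<sigma> s = orbit \<sigma> (t j)" using same_cycle_iff_orbit_eq[OF \<sigma>] by blast
      then show ?thesis using False by simp
    qed simp
    then show "same_pattern \<sigma> {..m} (t(m := s)) (\<lambda>_. 0::nat)"
      unfolding same_pattern_def same_cycle_iff_orbit_eq[OF \<sigma>] by simp
  qed
  then have "(\<Sum>t\<in>PiE {..<m} (\<lambda>_. {1..n}). of_bool (same_pattern \<sigma> {..m} (t(m := s)) (\<lambda>_. 0::nat))) =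
      (\<Sum>t\<in>PiE {..<m} (\<lambda>_. {1..n}). \<Prod>j\<in>{..<m}. of_bool (t j \<in> orbit \<sigma> s) :: real)"
    by (simp only: prod_of_bool finite_lessThan)
  also have "\<dots> = (\<Prod>j\<in>{..<m}. \<Sum>a\<in>{1..n}. of_bool (a \<in> orbit \<sigma> s))"
    by (rule prod_sum_PiE[symmetric]) auto
  also have "(\<Sum>a\<in>{1..n}. of_bool (a \<in> orbit \<sigma> s)) = real (card (orbit \<sigma> s))"
    using sub by (simp add: Int_absorb1)
  finally show ?thesis unfolding prod_constant card_lessThan by (rule sym)
qed

lemma ewens_unit: "ewens {..m::nat} (\<lambda>_. 0::nat) = 1 / real (m + 1)"
proof -
  have "(\<lambda>_. 0::nat) ` {..m} = {0}" by auto
  then show ?thesis by (simp add: ewens_def del: of_nat_Suc)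
qed

theorem orbit_moment_limit:
  assumes pos: "\<And>n. n \<ge> 1 \<Longrightarrow> \<beta> n > 0"
    and lim: "(\<lambda>n. sqrt (real n) * \<beta> n) \<longlonglongrightarrow> 0" and s: "\<And>n. n \<ge> 1 \<Longrightarrow> s n \<in> {1..n}"
  shows "(\<lambda>n. mallows_expect n (\<beta> n) (\<lambda>\<sigma>. (real (card (orbit \<sigma> (s n))) / real n) ^ m)) \<longlonglongrightarrow> 1 / real (m + 1)"
proof -
  define h where "h n t = mallows_expect n (\<beta> n)
    (\<lambda>\<sigma>. of_bool (same_pattern \<sigma> {..m} (t(m := s n)) (\<lambda>_. 0::nat)))" for n t
  have "(\<lambda>n. (\<Sum>t\<in>PiE {..<m} (\<lambda>_. {1..n}). h n t) / real n ^ card {..<m}) \<longlonglongrightarrow> ewens {..m} (\<lambda>_. 0::nat)"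
  proof (rule sample_average_limit[where s = s])
    show "\<bar>ewens {..m} (\<lambda>_. 0::nat)\<bar> \<le> 1" using ewens_nonneg[of "{..m}" "\<lambda>_. 0::nat"] ewens_le_1[of "{..m}" "\<lambda>_. 0::nat"] by simp
    show "\<bar>h n t\<bar> \<le> 1" for n t unfolding h_def by (rule mallows_expect_abs_le) auto
    fix \<epsilon> :: real assume "\<epsilon> > 0"
    then have "\<forall>\<^sub>F n in sequentially. \<forall>t. inj_on t {..m} \<and> t ` {..m} \<subseteq> {1..n} \<longrightarrow>
        \<bar>mallows_expect n (\<beta> n) (\<lambda>\<sigma>. of_bool (same_pattern \<sigma> {..m} t (\<lambda>_. 0::nat))) - ewens {..m} (\<lambda>_. 0::nat)\<bar> \<le> \<epsilon>"
      by (intro mallows_pattern_limit pos lim finite_atMost)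
    from this eventually_ge_at_top[of 1]
    show "\<forall>\<^sub>F n in sequentially. \<forall>t\<in>PiE {..<m} (\<lambda>_. {1..n}). inj_on t {..<m} \<and> s n \<notin> t ` {..<m} \<longrightarrow>
      \<bar>h n t - ewens {..m} (\<lambda>_. 0::nat)\<bar> \<le> \<epsilon>"
    proof eventually_elim
      case (elim n)
      show ?case
      proof (intro ballI impI)
        fix t assume t: "t \<in> PiE {..<m} (\<lambda>_. {1..n})" and g: "inj_on t {..<m} \<and> s n \<notin> t ` {..<m}"
        have eq: "{..m} = insert m {..<m}" by auto
        have ne: "t j \<noteq> s n" if "j < m" for j using g that by (metis imageI lessThan_iff)
        have "inj_on (t(m := s n)) {..m}" unfolding eq using g ne ne[symmetric] by (auto simp: inj_on_def)
        moreover have "(t(m := s n)) ` {..m} \<subseteq> {1..n}" unfolding eq using t s[OF elim(2)] by (auto simp: PiE_iff)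
        ultimately show "\<bar>h n t - ewens {..m} (\<lambda>_. 0::nat)\<bar> \<le> \<epsilon>" using elim(1) by (simp add: h_def)
      qed
    qed
  qed auto
  moreover have "\<forall>\<^sub>F n in sequentially. (\<Sum>t\<in>PiE {..<m} (\<lambda>_. {1..n}). h n t) / real n ^ card {..<m} =
     mallows_expect n (\<beta> n) (\<lambda>\<sigma>. (real (card (orbit \<sigma> (s n))) / real n) ^ m)"
    using eventually_ge_at_top[of 1]
  proof eventually_elim
    case (elim n)
    have "mallows_expect n (\<beta> n) (\<lambda>\<sigma>. (real (card (orbit \<sigma> (s n))) / real n) ^ m) =
       mallows_expect n (\<beta> n) (\<lambda>\<sigma>. (\<Sum>t\<in>PiE {..<m} (\<lambda>_. {1..n}).
          of_bool (same_pattern \<sigma> {..m} (t(m := s n)) (\<lambda>_. 0::nat))) / real n ^ m)"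
      using orbit_power_sample s[OF elim] by (intro mallows_expect_cong) (simp add: power_divide)
    then show ?case by (simp add: mallows_expect_divide mallows_expect_sum h_def)
  qed
  ultimately show ?thesis unfolding ewens_unit by (rule Lim_transform_eventually)
qed


section \<open>Set partitions\<close>

text \<open>The block that contains \<open>j\<close>, written as a union to avoid a choice operator.\<close>

definition part_label :: "'j set set \<Rightarrow> 'j \<Rightarrow> 'j set" where
  "part_label \<rho> j = \<Union>{D \<in> \<rho>. j \<in> D}"

definition kernel_partition :: "('j \<Rightarrow> 'c) \<Rightarrow> 'j set \<Rightarrow> 'j set set" where
  "kernel_partition g J = (\<lambda>j. {i \<in> J. g i = g j}) ` J"

lemma part_label_eq:
  assumes "partition_on J \<rho>" "D \<in> \<rho>" "j \<in> D"
  shows "part_label \<rho> j = D"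
proof -
  have "D' = D" if "D' \<in> \<rho>" "j \<in> D'" for D'
    using partition_onD2[OF assms(1)] that assms(2,3) unfolding disjoint_def by blast
  then have "{D' \<in> \<rho>. j \<in> D'} = {D}" using assms by blast
  then show ?thesis by (simp add: part_label_def)
qed

lemma part_ex_mem: "partition_on J \<rho> \<Longrightarrow> D \<in> \<rho> \<Longrightarrow> \<exists>j. j \<in> D"
  by (metis ex_in_conv partition_onD3)

lemma part_label_mem:
  assumes "partition_on J \<rho>" "j \<in> J"
  shows "part_label \<rho> j \<in> \<rho>" "j \<in> part_label \<rho> j"
proof -
  obtain D where "D \<in> \<rho>" "j \<in> D" using partition_onD1[OF assms(1)] assms(2) by blast
  with part_label_eq[OF assms(1) this] show "part_label \<rho> j \<in> \<rho>" "j \<in> part_label \<rho> j" by auto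
qed

lemma partition_on_kernel: "partition_on J (kernel_partition g J)"
  unfolding kernel_partition_def by (rule partition_onI) (auto simp: disjnt_def)

lemma part_label_kernel: "j \<in> J \<Longrightarrow> part_label (kernel_partition g J) j = {i \<in> J. g i = g j}"
  by (rule part_label_eq[OF partition_on_kernel]) (auto simp: kernel_partition_def)

lemma kernel_partition_label:
  assumes \<rho>: "partition_on J \<rho>" and eq: "\<And>i j. i \<in> J \<Longrightarrow> j \<in> J \<Longrightarrow> part_label \<rho> i = part_label \<rho> j \<longleftrightarrow> g i = g j"
  shows "kernel_partition g J = \<rho>"
proof -
  have cls: "{i \<in> J. g i = g j} = part_label \<rho> j" if j: "j \<in> J" for j
  proof -
    have "{i \<in> J. g i = g j} = {i \<in> J. part_label \<rho> i = part_label \<rho> j}" using eq j by blast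
    also have "\<dots> = part_label \<rho> j"
      using part_label_mem[OF \<rho>] part_label_eq[OF \<rho>] partition_onD1[OF \<rho>] j by blast
    finally show ?thesis .
  qed
  have "kernel_partition g J = part_label \<rho> ` J"
    unfolding kernel_partition_def by (rule image_cong[OF refl cls])
  also have "\<dots> = \<rho>"
  proof (intro equalityI subsetI)
    fix D assume D: "D \<in> \<rho>"
    then obtain j where "j \<in> D" using part_ex_mem[OF \<rho>] by blast
    then show "D \<in> part_label \<rho> ` J" using part_label_eq[OF \<rho> D] partition_onD1[OF \<rho>] D by blast
  qed (use part_label_mem[OF \<rho>] in blast)
  finally show ?thesis .
qed

section \<open>Joint moments of the cycle power sums\<close>

lemma cycle_set_eq_orbit:
  assumes \<sigma>: "\<sigma> permutes {1..n}" and "C \<in> cycle_sets n \<sigma>" "x \<in> C"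
  shows "C = orbit \<sigma> x"
  using assms(2,3) same_cycle_iff_orbit_eq[OF \<sigma>] unfolding cycle_sets_def by blast

lemma orbit_in_cycle_sets: "x \<in> {1..n} \<Longrightarrow> orbit \<sigma> x \<in> cycle_sets n \<sigma>"
  by (auto simp: cycle_sets_def)

lemma cycle_sets_subset: "\<sigma> permutes {1..n} \<Longrightarrow> C \<in> cycle_sets n \<sigma> \<Longrightarrow> C \<subseteq> {1..n}"
  using permutes_orbit_subset[of \<sigma> "{1..n}"] unfolding cycle_sets_def by blast

lemma finite_cycle_sets: "finite (cycle_sets n \<sigma>)"
  by (simp add: cycle_sets_def)

text \<open>The index set for \<open>\<Sum>j\<in>J. e j\<close> sample points, sorted into groups of sizes \<open>e j\<close>.\<close>

definition slots :: "('j \<Rightarrow> nat) \<Rightarrow> 'j set \<Rightarrow> ('j \<times> nat) set" where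
  "slots e J = (SIGMA j:J. {..<e j})"

text \<open>Each group lies in a single cycle; different groups may share one. Every group has an entry with index
  \<open>0\<close>, since \<open>e j \<ge> 1\<close> in all uses.\<close>

definition in_common_cycles :: "(nat \<Rightarrow> nat) \<Rightarrow> ('j \<Rightarrow> nat) \<Rightarrow> 'j set \<Rightarrow> ('j \<times> nat \<Rightarrow> nat) \<Rightarrow> bool" where
  "in_common_cycles \<sigma> e J t \<longleftrightarrow> (\<forall>y\<in>slots e J. same_cycle \<sigma> (t (fst y, 0)) (t y))"

lemma mem_slots: "y \<in> slots e J \<longleftrightarrow> fst y \<in> J \<and> snd y < e (fst y)"
  by (cases y) (simp add: slots_def)

lemma finite_slots: "finite J \<Longrightarrow> finite (slots e J)"
  by (simp add: slots_def)

lemma card_slots: "finite J \<Longrightarrow> card (slots e J) = (\<Sum>j\<in>J. e j)"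
  by (simp add: slots_def)

text \<open>Multiplying out, the left-hand side counts choices of one cycle per group together with points of the group in
  that cycle; the points determine the cycles.\<close>

lemma prod_cycle_power_sums:
  assumes \<sigma>: "\<sigma> permutes {1..n}" and J: "finite J" and e: "\<And>j. j \<in> J \<Longrightarrow> e j \<ge> 1"
  shows "(\<Prod>j\<in>J. \<Sum>C\<in>cycle_sets n \<sigma>. real (card C) ^ e j) =
     (\<Sum>t\<in>PiE (slots e J) (\<lambda>_. {1..n}). of_bool (in_common_cycles \<sigma> e J t))"
proof -
  let ?Y = "slots e J" and ?F = "PiE J (\<lambda>_. cycle_sets n \<sigma>)" and ?T = "PiE (slots e J) (\<lambda>_. {1..n})"
  have Y: "finite ?Y" using finite_slots[OF J] .
  have "(\<Prod>j\<in>J. \<Sum>C\<in>cycle_sets n \<sigma>. real (card C) ^ e j) = (\<Sum>f\<in>?F. \<Prod>j\<in>J. real (card (f j)) ^ e j)"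
    by (rule prod_sum_PiE[OF J finite_cycle_sets])
  also have "\<dots> = (\<Sum>f\<in>?F. \<Sum>t\<in>?T. of_bool (\<forall>y\<in>?Y. t y \<in> f (fst y)))"
  proof (rule sum.cong[OF refl])
    fix f assume f: "f \<in> ?F"
    have "(\<Prod>j\<in>J. real (card (f j)) ^ e j) = (\<Prod>j\<in>J. \<Prod>a\<in>{..<e j}. real (card (f j)))" by simp
    also have "\<dots> = (\<Prod>y\<in>?Y. real (card (f (fst y))))"
      unfolding slots_def using J by (subst prod.Sigma) (auto simp: case_prod_beta)
    also have "\<dots> = (\<Prod>y\<in>?Y. \<Sum>a\<in>{1..n}. of_bool (a \<in> f (fst y)))"
    proof (rule prod.cong[OF refl])
      fix y assume "y \<in> ?Y"
      then have "f (fst y) \<in> cycle_sets n \<sigma>" using f by (auto simp: slots_def PiE_iff)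
      then have "f (fst y) \<subseteq> {1..n}" by (rule cycle_sets_subset[OF \<sigma>])
      then show "real (card (f (fst y))) = (\<Sum>a\<in>{1..n}. of_bool (a \<in> f (fst y)))"
        by (simp add: Int_absorb1)
    qed
    also have "\<dots> = (\<Sum>t\<in>?T. \<Prod>y\<in>?Y. of_bool (t y \<in> f (fst y)))"
      by (rule prod_sum_PiE[OF Y]) simp
    finally show "(\<Prod>j\<in>J. real (card (f j)) ^ e j) = (\<Sum>t\<in>?T. of_bool (\<forall>y\<in>?Y. t y \<in> f (fst y)))"
      by (simp only: prod_of_bool[OF Y])
  qed
  also have "\<dots> = (\<Sum>t\<in>?T. \<Sum>f\<in>?F. of_bool (\<forall>y\<in>?Y. t y \<in> f (fst y)))" by (rule sum.swap)
  also have "\<dots> = (\<Sum>t\<in>?T. of_bool (in_common_cycles \<sigma> e J t))"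
  proof (rule sum.cong[OF refl])
    fix t assume t: "t \<in> ?T"
    define g where "g = restrict (\<lambda>j. orbit \<sigma> (t (j, 0))) J"
    have slot0: "(j, 0) \<in> ?Y" if "j \<in> J" for j using e[OF that] that by (simp add: slots_def)
    have gF: "g \<in> ?F"
    proof -
      have "t (j, 0) \<in> {1..n}" if "j \<in> J" for j using PiE_mem[OF t slot0[OF that]] .
      then show ?thesis unfolding g_def by (simp add: PiE_iff orbit_in_cycle_sets)
    qed
    have fstJ: "fst y \<in> J" if "y \<in> ?Y" for y using that by (auto simp: slots_def)
    have iff: "(\<forall>y\<in>?Y. t y \<in> f (fst y)) \<longleftrightarrow> f = g \<and> in_common_cycles \<sigma> e J t" if f: "f \<in> ?F" for f
    proof
      assume l: "\<forall>y\<in>?Y. t y \<in> f (fst y)"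
      have fj: "f j = orbit \<sigma> (t (j, 0))" if j: "j \<in> J" for j
        using cycle_set_eq_orbit[OF \<sigma> PiE_mem[OF f j]] l slot0[OF j] by force
      have "f = g"
      proof
        fix j show "f j = g j"
          using fj PiE_arb[OF f] by (cases "j \<in> J") (simp_all add: g_def)
      qed
      then show "f = g \<and> in_common_cycles \<sigma> e J t"
        using l fj fstJ by (simp add: in_common_cycles_def)
    next
      assume r: "f = g \<and> in_common_cycles \<sigma> e J t"
      then show "\<forall>y\<in>?Y. t y \<in> f (fst y)" using fstJ by (simp add: in_common_cycles_def g_def)
    qed
    have "(\<Sum>f\<in>?F. of_bool (\<forall>y\<in>?Y. t y \<in> f (fst y))) =
       (\<Sum>f\<in>?F. if f = g then of_bool (in_common_cycles \<sigma> e J t) else 0 :: real)"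
      by (rule sum.cong[OF refl]) (simp add: iff)
    also have "\<dots> = of_bool (in_common_cycles \<sigma> e J t)"
      using gF finite_PiE[OF J finite_cycle_sets] by (subst sum.delta) auto
    finally show "(\<Sum>f\<in>?F. of_bool (\<forall>y\<in>?Y. t y \<in> f (fst y))) = (of_bool (in_common_cycles \<sigma> e J t) :: real)" .
  qed
  finally show ?thesis .
qed

text \<open>If each group lies in a single cycle, the equality of these cycles partitions the set of groups,
  and exactly one partition describes the pattern.\<close>

lemma in_common_cycles_patterns:
  assumes \<sigma>: "\<sigma> permutes {1..n}" and J: "finite J" and e: "\<And>j. j \<in> J \<Longrightarrow> e j \<ge> 1"
  shows "of_bool (in_common_cycles \<sigma> e J t) =
    (\<Sum>\<rho> | partition_on J \<rho>. of_bool (same_pattern \<sigma> (slots e J) t (\<lambda>y. part_label \<rho> (fst y))) :: real)"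
proof -
  let ?Y = "slots e J"
  define g where "g = (\<lambda>j. orbit \<sigma> (t (j, 0)))"
  have slot0: "(j, 0) \<in> ?Y" if "j \<in> J" for j using e[OF that] that by (simp add: slots_def)
  have fstJ: "fst y \<in> J" if "y \<in> ?Y" for y using that by (auto simp: slots_def)
  have iff: "same_pattern \<sigma> ?Y t (\<lambda>y. part_label \<rho> (fst y)) \<longleftrightarrow>
      \<rho> = kernel_partition g J \<and> in_common_cycles \<sigma> e J t" if \<rho>: "partition_on J \<rho>" for \<rho>
  proof
    assume l: "same_pattern \<sigma> ?Y t (\<lambda>y. part_label \<rho> (fst y))"
    have "kernel_partition g J = \<rho>"
    proof (rule kernel_partition_label[OF \<rho>])
      fix i j assume "i \<in> J" "j \<in> J"
      then show "part_label \<rho> i = part_label \<rho> j \<longleftrightarrow> g i = g j"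
        using l[unfolded same_pattern_def same_cycle_iff_orbit_eq[OF \<sigma>], rule_format, OF slot0 slot0, of i j]
        by (simp add: g_def)
    qed
    moreover have "in_common_cycles \<sigma> e J t" unfolding in_common_cycles_def
    proof
      fix y assume y: "y \<in> ?Y"
      show "same_cycle \<sigma> (t (fst y, 0)) (t y)"
        using l[unfolded same_pattern_def, rule_format, OF slot0[OF fstJ[OF y]] y] by simp
    qed
    ultimately show "\<rho> = kernel_partition g J \<and> in_common_cycles \<sigma> e J t" by simp
  next
    assume r: "\<rho> = kernel_partition g J \<and> in_common_cycles \<sigma> e J t"
    have orb: "orbit \<sigma> (t y) = g (fst y)" if "y \<in> ?Y" for y
    proof -
      have "same_cycle \<sigma> (t (fst y, 0)) (t y)" using r that unfolding in_common_cycles_def by blast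
      then show ?thesis unfolding same_cycle_iff_orbit_eq[OF \<sigma>] g_def by (rule sym)
    qed
    show "same_pattern \<sigma> ?Y t (\<lambda>y. part_label \<rho> (fst y))"
      unfolding same_pattern_def
    proof (intro ballI)
      fix x y assume xy: "x \<in> ?Y" "y \<in> ?Y"
      have "part_label \<rho> (fst x) = part_label \<rho> (fst y) \<longleftrightarrow> g (fst x) = g (fst y)"
        using r part_label_kernel[OF fstJ[OF xy(1)], of g] part_label_kernel[OF fstJ[OF xy(2)], of g]
          fstJ[OF xy(1)] fstJ[OF xy(2)] by auto
      moreover have "same_cycle \<sigma> (t x) (t y) \<longleftrightarrow> orbit \<sigma> (t x) = orbit \<sigma> (t y)"
        by (rule same_cycle_iff_orbit_eq[OF \<sigma>])
      moreover have "orbit \<sigma> (t x) = orbit \<sigma> (t y) \<longleftrightarrow> g (fst x) = g (fst y)"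
        unfolding orb[OF xy(1)] orb[OF xy(2)] by (rule refl)
      ultimately show "same_cycle \<sigma> (t x) (t y) \<longleftrightarrow> part_label \<rho> (fst x) = part_label \<rho> (fst y)"
        by blast
    qed
  qed
  have "(\<Sum>\<rho> | partition_on J \<rho>. of_bool (same_pattern \<sigma> ?Y t (\<lambda>y. part_label \<rho> (fst y)))) =
    (\<Sum>\<rho> | partition_on J \<rho>. if \<rho> = kernel_partition g J then of_bool (in_common_cycles \<sigma> e J t) else (0::real))"
    by (rule sum.cong[OF refl]) (simp add: iff)
  also have "\<dots> = of_bool (in_common_cycles \<sigma> e J t)"
    using partition_on_kernel[of J g] finitely_many_partition_on[OF J] by (subst sum.delta) auto
  finally show ?thesis by (rule sym)
qed

text \<open>Up to the factor \<open>fact (\<Sum>j\<in>J. e j)\<close> this is the probability that the Ewens partition puts each group of \<open>e j\<close>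
  points into a single block.\<close>

definition ewens_sum :: "('j \<Rightarrow> nat) \<Rightarrow> 'j set \<Rightarrow> real" where
  "ewens_sum e J = (\<Sum>\<rho> | partition_on J \<rho>. \<Prod>D\<in>\<rho>. fact ((\<Sum>j\<in>D. e j) - 1))"

lemma ewens_slots:
  assumes J: "finite J" and e: "\<And>j. j \<in> J \<Longrightarrow> e j \<ge> 1" and \<rho>: "partition_on J \<rho>"
  shows "ewens (slots e J) (\<lambda>y. part_label \<rho> (fst y)) = (\<Prod>D\<in>\<rho>. fact ((\<Sum>j\<in>D. e j) - 1)) / fact (\<Sum>j\<in>J. e j)"
proof -
  let ?lab = "\<lambda>y::'a \<times> nat. part_label \<rho> (fst y)"
  have im: "?lab ` slots e J = \<rho>"
  proof (intro equalityI subsetI)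
    fix D assume "D \<in> ?lab ` slots e J"
    then show "D \<in> \<rho>" using part_label_mem(1)[OF \<rho>] by (auto simp: slots_def)
  next
    fix D assume D: "D \<in> \<rho>"
    then obtain j where j: "j \<in> D" using part_ex_mem[OF \<rho>] by blast
    then have jJ: "j \<in> J" using partition_onD1[OF \<rho>] D by blast
    have "(j, 0) \<in> slots e J" using e[OF jJ] jJ by (simp add: slots_def)
    moreover have "?lab (j, 0) = D" using part_label_eq[OF \<rho> D j] by simp
    ultimately show "D \<in> ?lab ` slots e J" by (metis imageI)
  qed
  have "card {y \<in> slots e J. ?lab y = D} = (\<Sum>j\<in>D. e j)" if D: "D \<in> \<rho>" for D
  proof -
    have DJ: "D \<subseteq> J" using partition_onD1[OF \<rho>] D by blast
    have iff: "part_label \<rho> j = D \<longleftrightarrow> j \<in> D" if "j \<in> J" for j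
      using part_label_eq[OF \<rho> D] part_label_mem(2)[OF \<rho> that] by blast
    have "{y \<in> slots e J. ?lab y = D} = slots e D"
      unfolding set_eq_iff mem_Collect_eq mem_slots using iff DJ by blast
    then show ?thesis using card_slots[OF finite_subset[OF DJ J]] by simp
  qed
  then show ?thesis unfolding ewens_def im card_slots[OF J]
    by (intro arg_cong2[where f = "(/)"] prod.cong) simp_all
qed

theorem cycle_moment_limit:
  assumes pos: "\<And>n. n \<ge> 1 \<Longrightarrow> \<beta> n > 0"
    and lim: "(\<lambda>n. sqrt (real n) * \<beta> n) \<longlonglongrightarrow> 0"
    and J: "finite J" and e: "\<And>j. j \<in> J \<Longrightarrow> e j \<ge> 1"
  shows "(\<lambda>n. mallows_expect n (\<beta> n) (\<lambda>\<sigma>. \<Prod>j\<in>J. \<Sum>C\<in>cycle_sets n \<sigma>. (real (card C) / real n) ^ e j))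
    \<longlonglongrightarrow> ewens_sum e J / fact (\<Sum>j\<in>J. e j)"
proof -
  let ?Y = "slots e J"
  define R where "R = {\<rho>. partition_on J \<rho>}"
  define lab where "lab \<rho> y = part_label \<rho> (fst y)" for \<rho> and y :: "'a \<times> nat"
  define h where "h \<rho> n t = mallows_expect n (\<beta> n) (\<lambda>\<sigma>. of_bool (same_pattern \<sigma> ?Y t (lab \<rho>)))" for \<rho> n t
  have Y: "finite ?Y" by (rule finite_slots[OF J])
  have each: "(\<lambda>n. (\<Sum>t\<in>PiE ?Y (\<lambda>_. {1..n}). h \<rho> n t) / real n ^ card ?Y) \<longlonglongrightarrow> ewens ?Y (lab \<rho>)" for \<rho>
  proof (rule sample_average_limit[OF Y, where s = "\<lambda>_. 0"])
    show "\<bar>ewens ?Y (lab \<rho>)\<bar> \<le> 1" using ewens_nonneg[of ?Y "lab \<rho>"] ewens_le_1[OF Y, of "lab \<rho>"] by simp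
    show "\<bar>h \<rho> n t\<bar> \<le> 1" for n t unfolding h_def by (rule mallows_expect_abs_le) auto
    fix \<epsilon> :: real assume "\<epsilon> > 0"
    then have "\<forall>\<^sub>F n in sequentially. \<forall>t. inj_on t ?Y \<and> t ` ?Y \<subseteq> {1..n} \<longrightarrow>
        \<bar>mallows_expect n (\<beta> n) (\<lambda>\<sigma>. of_bool (same_pattern \<sigma> ?Y t (lab \<rho>))) - ewens ?Y (lab \<rho>)\<bar> \<le> \<epsilon>"
      by (intro mallows_pattern_limit pos lim Y)
    then show "\<forall>\<^sub>F n in sequentially. \<forall>t\<in>PiE ?Y (\<lambda>_. {1..n}). inj_on t ?Y \<and> 0 \<notin> t ` ?Y \<longrightarrow>
      \<bar>h \<rho> n t - ewens ?Y (lab \<rho>)\<bar> \<le> \<epsilon>"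
    proof eventually_elim
      case (elim n)
      show ?case
      proof (intro ballI impI)
        fix t assume t: "t \<in> PiE ?Y (\<lambda>_. {1..n})" and g: "inj_on t ?Y \<and> 0 \<notin> t ` ?Y"
        have "t ` ?Y \<subseteq> {1..n}" using PiE_mem[OF t] by blast
        then show "\<bar>h \<rho> n t - ewens ?Y (lab \<rho>)\<bar> \<le> \<epsilon>" using elim g unfolding h_def by blast
      qed
    qed
  qed
  have "mallows_expect n (\<beta> n) (\<lambda>\<sigma>. \<Prod>j\<in>J. \<Sum>C\<in>cycle_sets n \<sigma>. (real (card C) / real n) ^ e j) =
     (\<Sum>\<rho>\<in>R. (\<Sum>t\<in>PiE ?Y (\<lambda>_. {1..n}). h \<rho> n t) / real n ^ card ?Y)" for n
  proof -
    have "mallows_expect n (\<beta> n) (\<lambda>\<sigma>. \<Prod>j\<in>J. \<Sum>C\<in>cycle_sets n \<sigma>. (real (card C) / real n) ^ e j) =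
      mallows_expect n (\<beta> n) (\<lambda>\<sigma>. (\<Sum>\<rho>\<in>R. \<Sum>t\<in>PiE ?Y (\<lambda>_. {1..n}). of_bool (same_pattern \<sigma> ?Y t (lab \<rho>))) / real n ^ card ?Y)"
    proof (rule mallows_expect_cong)
      fix \<sigma> assume \<sigma>: "\<sigma> permutes {1..n}"
      have "(\<Prod>j\<in>J. \<Sum>C\<in>cycle_sets n \<sigma>. (real (card C) / real n) ^ e j) =
         (\<Prod>j\<in>J. (\<Sum>C\<in>cycle_sets n \<sigma>. real (card C) ^ e j) / real n ^ e j)"
        by (simp add: power_divide sum_divide_distrib)
      also have "\<dots> = (\<Prod>j\<in>J. \<Sum>C\<in>cycle_sets n \<sigma>. real (card C) ^ e j) / real n ^ card ?Y"
        unfolding card_slots[OF J] by (simp add: prod_dividef power_sum)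
      also have "(\<Prod>j\<in>J. \<Sum>C\<in>cycle_sets n \<sigma>. real (card C) ^ e j) =
         (\<Sum>t\<in>PiE ?Y (\<lambda>_. {1..n}). \<Sum>\<rho>\<in>R. of_bool (same_pattern \<sigma> ?Y t (lab \<rho>)))"
        unfolding R_def lab_def
        using in_common_cycles_patterns[OF \<sigma> J e] prod_cycle_power_sums[OF \<sigma> J e] by (simp only:)
      also have "\<dots> = (\<Sum>\<rho>\<in>R. \<Sum>t\<in>PiE ?Y (\<lambda>_. {1..n}). of_bool (same_pattern \<sigma> ?Y t (lab \<rho>)))"
        by (rule sum.swap)
      finally show "(\<Prod>j\<in>J. \<Sum>C\<in>cycle_sets n \<sigma>. (real (card C) / real n) ^ e j) =
        (\<Sum>\<rho>\<in>R. \<Sum>t\<in>PiE ?Y (\<lambda>_. {1..n}). of_bool (same_pattern \<sigma> ?Y t (lab \<rho>))) / real n ^ card ?Y" .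
    qed
    then show ?thesis by (simp add: mallows_expect_divide mallows_expect_sum h_def sum_divide_distrib)
  qed
  moreover have "(\<lambda>n. \<Sum>\<rho>\<in>R. (\<Sum>t\<in>PiE ?Y (\<lambda>_. {1..n}). h \<rho> n t) / real n ^ card ?Y)
     \<longlonglongrightarrow> (\<Sum>\<rho>\<in>R. ewens ?Y (lab \<rho>))"
    by (intro tendsto_sum each)
  moreover have "(\<Sum>\<rho>\<in>R. ewens ?Y (lab \<rho>)) = ewens_sum e J / fact (\<Sum>j\<in>J. e j)"
    unfolding ewens_sum_def R_def[symmetric] sum_divide_distrib
    by (rule sum.cong[OF refl]) (simp add: R_def lab_def[abs_def] ewens_slots[OF J e])
  ultimately show ?thesis by simp
qed

text \<open>Writing \<open>\<Sum>j\<in>J. e j\<close> as the sum over the blocks \<open>S\<close> of a partition, a block absorbs its size into the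
  factorial; then a partition with a distinguished block is the block together with a partition
  of the rest.\<close>

lemma ewens_sum_rec:
  assumes J: "finite J" and e: "\<And>j. j \<in> J \<Longrightarrow> e j \<ge> 1"
  shows "real (\<Sum>j\<in>J. e j) * ewens_sum e J =
    (\<Sum>S\<in>Pow J - {{}}. fact (\<Sum>j\<in>S. e j) * ewens_sum e (J - S))"
proof -
  define m where "m S = (\<Sum>j\<in>S. e j)" for S
  define w where "w D = (fact (m D - 1) :: real)" for D
  have fin: "finite \<rho>" if "partition_on J \<rho>" for \<rho> using finite_elements[OF J that] .
  have m0: "m D > 0" if D: "D \<subseteq> J" "D \<noteq> {}" for D
  proof -
    obtain j where j: "j \<in> D" using D(2) by (metis ex_in_conv)
    have "e j \<le> m D" unfolding m_def using j finite_subset[OF that(1) J] by (intro member_le_sum) auto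
    then show ?thesis using e[of j] j that by fastforce
  qed
  have "real (m J) * ewens_sum e J = (\<Sum>\<rho> | partition_on J \<rho>. \<Sum>S\<in>\<rho>. fact (m S) * (\<Prod>D\<in>\<rho> - {S}. w D))"
    unfolding ewens_sum_def sum_distrib_left
  proof (rule sum.cong[OF refl])
    fix \<rho> assume "\<rho> \<in> {\<rho>. partition_on J \<rho>}"
    then have \<rho>: "partition_on J \<rho>" by simp
    have sub: "D \<subseteq> J" "D \<noteq> {}" "finite D" if "D \<in> \<rho>" for D
      using partition_onD1[OF \<rho>] partition_onD3[OF \<rho>] that finite_subset[OF _ J, of D] by auto
    have "m J = (\<Sum>S\<in>\<rho>. m S)"
      unfolding m_def using sum.Union_disjoint[of \<rho> e] partition_onD1[OF \<rho>] partition_onD2[OF \<rho>] sub(3)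
      by (simp add: disjoint_def)
    then have "real (m J) * (\<Prod>D\<in>\<rho>. w D) = (\<Sum>S\<in>\<rho>. real (m S) * (\<Prod>D\<in>\<rho>. w D))" by (simp add: sum_distrib_right)
    also have "\<dots> = (\<Sum>S\<in>\<rho>. fact (m S) * (\<Prod>D\<in>\<rho> - {S}. w D))"
    proof (rule sum.cong[OF refl])
      fix S assume S: "S \<in> \<rho>"
      have "(\<Prod>D\<in>\<rho>. w D) = w S * (\<Prod>D\<in>\<rho> - {S}. w D)" by (rule prod.remove[OF fin[OF \<rho>] S])
      moreover have "real (m S) * w S = fact (m S)"
        unfolding w_def by (rule fact_reduce[symmetric]) (rule m0[OF sub(1,2)[OF S]])
      ultimately show "real (m S) * (\<Prod>D\<in>\<rho>. w D) = fact (m S) * (\<Prod>D\<in>\<rho> - {S}. w D)"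
        by (metis mult.assoc)
    qed
    finally show "real (m J) * (\<Prod>D\<in>\<rho>. fact ((\<Sum>j\<in>D. e j) - 1)) = (\<Sum>S\<in>\<rho>. fact (m S) * (\<Prod>D\<in>\<rho> - {S}. w D))"
      by (simp only: w_def m_def)
  qed
  also have "\<dots> = (\<Sum>(\<rho>, S)\<in>(SIGMA \<rho>:{\<rho>. partition_on J \<rho>}. \<rho>). fact (m S) * (\<Prod>D\<in>\<rho> - {S}. w D))"
    using fin finitely_many_partition_on[OF J] by (intro sum.Sigma) auto
  also have "\<dots> = (\<Sum>(S, \<rho>)\<in>(SIGMA S:Pow J - {{}}. {\<rho>. partition_on (J - S) \<rho>}). fact (m S) * (\<Prod>D\<in>\<rho>. w D))"
  proof (rule sum.reindex_bij_witness[where i = "\<lambda>(S, \<rho>). (insert S \<rho>, S)" and j = "\<lambda>(\<rho>, S). (S, \<rho> - {S})"])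
    fix a assume "a \<in> (SIGMA \<rho>:{\<rho>. partition_on J \<rho>}. \<rho>)"
    then obtain \<rho> S where a: "a = (\<rho>, S)" "partition_on J \<rho>" "S \<in> \<rho>" by auto
    have SJ: "S \<subseteq> J" "S \<noteq> {}" using partition_onD1[OF a(2)] partition_onD3[OF a(2)] a(3) by auto
    have disj: "D \<inter> S = {}" if "D \<in> \<rho>" "D \<noteq> S" for D
      using partition_onD2[OF a(2)] that a(3) by (auto simp: disjoint_def)
    have "partition_on (J - S) (\<rho> - {S})"
    proof (rule partition_onI)
      show "\<Union> (\<rho> - {S}) = J - S" using partition_onD1[OF a(2)] disj a(3) by blast
      show "disjnt p q" if "p \<in> \<rho> - {S}" "q \<in> \<rho> - {S}" "p \<noteq> q" for p q
        using partition_onD2[OF a(2)] that by (auto simp: disjoint_def disjnt_def)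
      show "{} \<notin> \<rho> - {S}" using partition_onD3[OF a(2)] by simp
    qed
    then show "(case a of (\<rho>, S) \<Rightarrow> (S, \<rho> - {S})) \<in> (SIGMA S:Pow J - {{}}. {\<rho>. partition_on (J - S) \<rho>})"
      using a SJ by simp
    show "(case case a of (\<rho>, S) \<Rightarrow> (S, \<rho> - {S}) of (S, \<rho>) \<Rightarrow> (insert S \<rho>, S)) = a"
      using a by (simp add: insert_absorb)
    show "(case case a of (\<rho>, S) \<Rightarrow> (S, \<rho> - {S}) of (S, \<rho>) \<Rightarrow> fact (m S) * (\<Prod>D\<in>\<rho>. w D)) =
        (case a of (\<rho>, S) \<Rightarrow> fact (m S) * (\<Prod>D\<in>\<rho> - {S}. w D))" using a by simp
  next
    fix b assume "b \<in> (SIGMA S:Pow J - {{}}. {\<rho>. partition_on (J - S) \<rho>})"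
    then obtain S \<rho> where b: "b = (S, \<rho>)" "S \<subseteq> J" "S \<noteq> {}" "partition_on (J - S) \<rho>" by auto
    have un: "\<Union>\<rho> = J - S" using partition_onD1[OF b(4)] by simp
    have S: "S \<notin> \<rho>" using un b(3) by blast
    have "partition_on J (insert S \<rho>)"
    proof (rule partition_onI)
      show "\<Union> (insert S \<rho>) = J" using un b(2) by auto
      show "disjnt p q" if "p \<in> insert S \<rho>" "q \<in> insert S \<rho>" "p \<noteq> q" for p q
        using partition_onD2[OF b(4)] that un by (auto simp: disjoint_def disjnt_def)
      show "{} \<notin> insert S \<rho>" using partition_onD3[OF b(4)] b(3) by simp
    qed
    then show "(case b of (S, \<rho>) \<Rightarrow> (insert S \<rho>, S)) \<in> (SIGMA \<rho>:{\<rho>. partition_on J \<rho>}. \<rho>)" using b by simp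
    show "(case case b of (S, \<rho>) \<Rightarrow> (insert S \<rho>, S) of (\<rho>, S) \<Rightarrow> (S, \<rho> - {S})) = b" using b S by simp
  qed
  also have "\<dots> = (\<Sum>S\<in>Pow J - {{}}. \<Sum>\<rho> | partition_on (J - S) \<rho>. fact (m S) * (\<Prod>D\<in>\<rho>. w D))"
    using finitely_many_partition_on J by (intro sum.Sigma[symmetric]) auto
  also have "\<dots> = (\<Sum>S\<in>Pow J - {{}}. fact (m S) * ewens_sum e (J - S))"
    by (simp add: ewens_sum_def w_def m_def sum_distrib_left)
  finally show ?thesis by (simp only: m_def)
qed


section \<open>Power sums of decreasing rearrangements\<close>

definition power_sum :: "nat \<Rightarrow> (nat \<Rightarrow> real) \<Rightarrow> real" where
  "power_sum p x = (\<Sum>i. x i ^ p)"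

lemma summable_power:
  fixes x :: "nat \<Rightarrow> real"
  assumes nn: "\<And>i. 0 \<le> x i" and le: "\<And>i. x i \<le> 1" and sm: "summable x" and p: "p \<ge> 1"
  shows "summable (\<lambda>i. x i ^ p)"
proof (rule summable_comparison_test'[OF sm])
  fix i
  have "x i ^ p \<le> x i ^ 1" by (rule power_decreasing[OF p nn le])
  moreover have "0 \<le> x i ^ p" by (rule zero_le_power[OF nn])
  ultimately show "norm (x i ^ p) \<le> x i" by simp
qed

text \<open>If \<open>Suc k\<close> entries are at least \<open>a\<close>, no \<open>t < a\<close> is admissible in the infimum defining the rearrangement.\<close>

lemma min_le_decr_rearr:
  fixes x :: "nat \<Rightarrow> real"
  assumes le: "\<And>i. x i \<le> C" "0 \<le> C" and I: "finite I" "card I = Suc k" and min: "\<And>i. i \<in> I \<Longrightarrow> a \<le> x i"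
  shows "a \<le> decr_rearr x k"
  unfolding decr_rearr_def
proof (rule cInf_greatest)
  show "{t. 0 \<le> t \<and> finite {i. t < x i} \<and> card {i. t < x i} \<le> k} \<noteq> {}"
    using rearr_set_nonempty[of x C k, OF le] by blast
  fix t assume t: "t \<in> {t. 0 \<le> t \<and> finite {i. t < x i} \<and> card {i. t < x i} \<le> k}"
  show "a \<le> t"
  proof (rule ccontr)
    assume "\<not> a \<le> t"
    have "I \<subseteq> {i. t < x i}"
    proof
      fix i assume "i \<in> I"
      then have "a \<le> x i" by (rule min)
      then show "i \<in> {i. t < x i}" using \<open>\<not> a \<le> t\<close> by simp
    qed
    then have "card I \<le> card {i. t < x i}" using t by (intro card_mono) auto
    then show False using t I by simp
  qed
qed

text \<open>The first \<open>n\<close> rearranged entries are dominated by \<open>n\<close> distinct entries of \<open>x\<close>, picked greedily; and \<open>n\<close> entries of \<open>x\<close>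
  are dominated by the first \<open>n\<close> rearranged ones, by peeling off the smallest.\<close>

lemma power_sum_decr_rearr:
  fixes x :: "nat \<Rightarrow> real"
  assumes nn: "\<And>i. 0 \<le> x i" and le: "\<And>i. x i \<le> 1" and sm: "summable x" and p: "p \<ge> 1"
  shows "power_sum p (decr_rearr x) = power_sum p x"
proof -
  define y where "y = decr_rearr x"
  have y: "y \<in> seq_space" unfolding y_def by (rule decr_rearr_in_seq_space[OF nn sm])
  then have y0: "0 \<le> y k" for k by (simp add: seq_space_def)
  note smp = summable_power[OF nn le sm p]
  have ex: "\<exists>I. finite I \<and> card I = n \<and> (\<Sum>k<n. y k ^ p) \<le> (\<Sum>i\<in>I. x i ^ p)" for n
  proof (induction n)
    case 0 show ?case by (intro exI[of _ "{}"]) auto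
  next
    case (Suc n)
    then obtain I where I: "finite I" "card I = n" "(\<Sum>k<n. y k ^ p) \<le> (\<Sum>i\<in>I. x i ^ p)" by blast
    obtain i where i: "i \<notin> I" "y n \<le> x i"
      using decr_rearr_pick[OF nn summable_LIMSEQ_zero[OF sm] I(1)] I(2) unfolding y_def by blast
    have "y n ^ p \<le> x i ^ p" by (rule power_mono[OF i(2) y0])
    then have "(\<Sum>k<Suc n. y k ^ p) \<le> (\<Sum>i\<in>insert i I. x i ^ p)" using I i(1) by simp
    then show ?case using I(1,2) i(1) by (intro exI[of _ "insert i I"]) simp
  qed
  have upper: "(\<Sum>k<n. y k ^ p) \<le> (\<Sum>i. x i ^ p)" for n
  proof -
    obtain I where I: "finite I" "(\<Sum>k<n. y k ^ p) \<le> (\<Sum>i\<in>I. x i ^ p)" using ex[of n] by blast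
    have "(\<Sum>i\<in>I. x i ^ p) \<le> (\<Sum>i. x i ^ p)"
      by (rule sum_le_suminf[OF smp I(1)]) (rule zero_le_power[OF nn])
    with I(2) show ?thesis by linarith
  qed
  have smy: "summable (\<lambda>k. y k ^ p)" by (rule summableI_nonneg_bounded[OF zero_le_power[OF y0] upper])
  have lower: "(\<Sum>i\<in>I. x i ^ p) \<le> (\<Sum>k<n. y k ^ p)" if "finite I" "card I = n" for I n
    using that
  proof (induction n arbitrary: I)
    case (Suc n)
    then have ne: "I \<noteq> {}" by auto
    have "Min (x ` I) \<in> x ` I" using Suc.prems(1) ne by (intro Min_in) auto
    then obtain i where i1: "i \<in> I" and xi: "Min (x ` I) = x i" by (rule imageE)
    have i: "i \<in> I" "\<And>j. j \<in> I \<Longrightarrow> x i \<le> x j"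
      unfolding xi[symmetric] using i1 Suc.prems(1) by (auto intro: Min_le)
    have "x i \<le> y n" unfolding y_def by (rule min_le_decr_rearr[OF le zero_le_one Suc.prems(1,2) i(2)])
    then have "x i ^ p \<le> y n ^ p" by (rule power_mono[OF _ nn])
    moreover have "(\<Sum>j\<in>I - {i}. x j ^ p) \<le> (\<Sum>k<n. y k ^ p)" using Suc.prems(1,2) i(1) by (intro Suc.IH) simp_all
    moreover have "(\<Sum>j\<in>I. x j ^ p) = x i ^ p + (\<Sum>j\<in>I - {i}. x j ^ p)"
      by (rule sum.remove[OF Suc.prems(1) i(1)])
    ultimately show ?case by simp
  qed simp
  have "(\<Sum>i. x i ^ p) \<le> (\<Sum>k. y k ^ p)"
  proof (rule suminf_le_const[OF smp])
    fix n
    have "(\<Sum>i<n. x i ^ p) \<le> (\<Sum>k<n. y k ^ p)" by (rule lower) auto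
    also have "\<dots> \<le> (\<Sum>k. y k ^ p)" by (rule sum_le_suminf[OF smy]) (simp_all add: y0)
    finally show "(\<Sum>i<n. x i ^ p) \<le> (\<Sum>k. y k ^ p)" .
  qed
  moreover have "(\<Sum>k. y k ^ p) \<le> (\<Sum>i. x i ^ p)" by (rule suminf_le_const[OF smy upper])
  ultimately show ?thesis by (simp add: power_sum_def y_def)
qed

section \<open>Moments of the Poisson-Dirichlet law\<close>

lemma stick_breaking_case_nat:
  "stick_breaking (case_nat a w) 0 = a"
  "stick_breaking (case_nat a w) (Suc i) = (1 - a) * stick_breaking w i"
  by (simp_all add: stick_breaking_def prod.lessThan_Suc_shift del: prod.lessThan_Suc)

text \<open>Breaking off the first stick leaves a scaled copy of the stick-breaking sequence.\<close>

lemma power_sum_stick_case_nat: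
  assumes w: "\<And>i. w i \<in> {0..1}" and p: "p \<ge> 1"
  shows "power_sum p (stick_breaking (case_nat a w)) = a ^ p + (1 - a) ^ p * power_sum p (stick_breaking w)"
proof -
  have sm: "summable (\<lambda>i. stick_breaking w i ^ p)"
    using stick_breaking_props[OF w] p by (intro summable_power) auto
  have sm': "summable (\<lambda>i. stick_breaking (case_nat a w) (Suc i) ^ p)"
    unfolding stick_breaking_case_nat power_mult_distrib by (rule summable_mult[OF sm])
  have "power_sum p (stick_breaking (case_nat a w)) =
      stick_breaking (case_nat a w) 0 ^ p + (\<Sum>i. stick_breaking (case_nat a w) (Suc i) ^ p)"
    unfolding power_sum_def using suminf_split_head[OF iffD1[OF summable_Suc_iff sm']] by linarith
  also have "(\<Sum>i. stick_breaking (case_nat a w) (Suc i) ^ p) = (1 - a) ^ p * power_sum p (stick_breaking w)"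
    unfolding stick_breaking_case_nat power_mult_distrib power_sum_def by (rule suminf_mult[OF sm])
  finally show ?thesis by (simp add: stick_breaking_case_nat)
qed

lemma power_sum_stick_bounds:
  assumes v: "\<And>i. v i \<in> {0..1}" and p: "p \<ge> 1"
  shows "0 \<le> power_sum p (stick_breaking v)" "power_sum p (stick_breaking v) \<le> 1"
proof -
  note P = stick_breaking_props[OF v]
  have sm: "summable (\<lambda>i. stick_breaking v i ^ p)" using P p by (intro summable_power) auto
  show "0 \<le> power_sum p (stick_breaking v)"
    unfolding power_sum_def using P by (intro suminf_nonneg[OF sm]) auto
  show "power_sum p (stick_breaking v) \<le> 1" unfolding power_sum_def
  proof (rule suminf_le_const[OF sm])
    fix n
    have "(\<Sum>i<n. stick_breaking v i ^ p) \<le> (\<Sum>i<n. stick_breaking v i)"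
      using P p power_decreasing[of 1 p] by (intro sum_mono) force
    also have "\<dots> \<le> 1" using v by (simp add: stick_breaking_sum prod_nonneg)
    finally show "(\<Sum>i<n. stick_breaking v i ^ p) \<le> 1" .
  qed
qed

abbreviation unif_restricted :: "real measure" where
  "unif_restricted \<equiv> restrict_space unif01 {0..1}"

lemma space_unif01: "space unif01 = UNIV" and sets_unif01: "sets unif01 = sets borel"
  by (simp_all add: unif01_def)

lemma AE_unif01: "AE x in unif01. x \<in> {0..1}"
  unfolding unif01_def by (rule AE_uniform_measureI) auto

lemma prob_space_unif01: "prob_space unif01"
proof -
  have e: "emeasure lborel {0..1::real} = 1" by simp
  show ?thesis unfolding unif01_def by (rule prob_space_uniform_measure) (simp_all add: e)
qed

lemma integral_unif01:
  fixes f :: "real \<Rightarrow> real"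
  assumes [measurable]: "f \<in> borel_measurable borel"
  shows "integral\<^sup>L unif01 f = (\<integral>x. f x * indicator {0..1} x \<partial>lborel)"
proof -
  have eq: "unif01 = density lborel (\<lambda>x. ennreal (indicator {0..1} x))"
    unfolding unif01_def uniform_measure_def by (intro density_cong) (auto simp: indicator_def)
  show ?thesis unfolding eq by (subst integral_density) (auto simp: mult.commute)
qed

lemma unif01_moment: "(\<integral>x. x ^ m \<partial>unif01) = 1 / real (m + 1)"
  by (simp add: integral_unif01 integral_power)

text \<open>Expanding one factor \<open>1 - x\<close> reduces \<open>b\<close> by one.\<close>

lemma unif01_beta: "(\<integral>x. x ^ a * (1 - x) ^ b \<partial>unif01) = fact a * fact b / fact (a + b + 1)"
proof (induction b arbitrary: a)
  case 0 show ?case using unif01_moment[of a] by (simp del: of_nat_Suc)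
next
  case (Suc b)
  have int: "integrable unif01 (\<lambda>x. x ^ i * (1 - x) ^ j)" for i j
  proof -
    interpret prob_space unif01 by (rule prob_space_unif01)
    show ?thesis
    proof (rule integrable_const_bound[where B = 1])
      show "AE x in unif01. norm (x ^ i * (1 - x) ^ j) \<le> 1"
        using AE_unif01 by eventually_elim (auto simp: abs_mult power_abs intro!: mult_le_one power_le_one)
    qed (simp add: measurable_cong_sets[OF sets_unif01 refl])
  qed
  have "(\<integral>x. x ^ a * (1 - x) ^ Suc b \<partial>unif01) =
      (\<integral>x. x ^ a * (1 - x) ^ b - x ^ Suc a * (1 - x) ^ b \<partial>unif01)"
    by (intro Bochner_Integration.integral_cong) (auto simp: algebra_simps)
  also have "\<dots> = fact a * fact b / fact (a + b + 1) - fact (Suc a) * fact b / fact (Suc a + b + 1)"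
    using int by (subst Bochner_Integration.integral_diff) (simp_all only: Suc.IH)
  also have "\<dots> = fact a * fact (Suc b) / fact (a + Suc b + 1)"
  proof -
    define F where "F = (fact (a + b + 1) :: real)"
    have F: "F > 0" by (simp add: F_def)
    have s: "Suc a + b + 1 = Suc (a + b + 1)" "a + Suc b + 1 = Suc (a + b + 1)" by simp_all
    have G: "fact (Suc (a + b + 1)) = (real a + real b + 2) * F" by (simp add: F_def)
    have ne: "real a + real b + 2 > 0" by simp
    show ?thesis unfolding s G F_def[symmetric] using F ne
      by (simp add: divide_simps) (simp add: algebra_simps)
  qed
  finally show ?case .
qed

lemma integral_unif_restricted:
  "integral\<^sup>L unif_restricted f = integral\<^sup>L unif01 (f :: real \<Rightarrow> real)" if "f \<in> borel_measurable borel"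
proof -
  have "integral\<^sup>L unif_restricted f = (\<integral>x. indicator {0..1} x *\<^sub>R f x \<partial>unif01)"
    by (rule integral_restrict_space) (simp add: space_unif01 sets_unif01)
  also have "\<dots> = integral\<^sup>L unif01 f"
  proof (rule integral_cong_AE)
    from AE_unif01 show "AE x in unif01. indicator {0..1} x *\<^sub>R f x = f x" by eventually_elim simp
  qed (use that in \<open>simp_all add: measurable_cong_sets[OF sets_unif01 refl]\<close>)
  finally show ?thesis .
qed

lemma prob_space_unif_restricted: "prob_space unif_restricted"
  by (rule prob_space_restrict_space)
     (simp_all add: unif01_def emeasure_uniform_measure)

abbreviation unif_product :: "(nat \<Rightarrow> real) measure" where
  "unif_product \<equiv> Pi\<^sub>M UNIV (\<lambda>_. unif_restricted)"

lemma measurable_power_sum_stick: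
  "(\<lambda>v. power_sum p (stick_breaking v)) \<in> borel_measurable unif_product"
proof -
  have coord: "(\<lambda>v. v i) \<in> borel_measurable unif_product" for i
  proof -
    have "(\<lambda>v. v i) \<in> unif_product \<rightarrow>\<^sub>M unif_restricted"
      by (rule measurable_component_singleton) simp
    moreover have "(\<lambda>x. x) \<in> unif_restricted \<rightarrow>\<^sub>M borel"
      by (rule measurable_restrict_space1) (simp add: unif01_def)
    ultimately show ?thesis by (rule measurable_compose)
  qed
  show ?thesis unfolding power_sum_def stick_breaking_def using coord by measurable
qed

definition stick_moment :: "('j \<Rightarrow> nat) \<Rightarrow> 'j set \<Rightarrow> real" where
  "stick_moment e J = (\<integral>v. (\<Prod>j\<in>J. power_sum (e j) (stick_breaking v)) \<partial>unif_product)"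

lemma integrable_stick_prod:
  assumes e: "\<And>j. j \<in> J \<Longrightarrow> e j \<ge> 1"
  shows "integrable unif_product (\<lambda>v. \<Prod>j\<in>J. power_sum (e j) (stick_breaking v))"
proof -
  interpret prob_space unif_product by (intro prob_space_PiM prob_space_unif_restricted)
  show ?thesis
  proof (rule integrable_const_bound[where B = 1])
    show "AE v in unif_product. norm (\<Prod>j\<in>J. power_sum (e j) (stick_breaking v)) \<le> 1"
    proof (rule AE_I2)
      fix v assume "v \<in> space unif_product"
      then have v: "\<And>i. v i \<in> {0..1}" by (simp add: space_unif_product)
      show "norm (\<Prod>j\<in>J. power_sum (e j) (stick_breaking v)) \<le> 1"
        unfolding real_norm_def abs_prod
        using power_sum_stick_bounds[OF v] e by (intro prod_le_1) auto
    qed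
  qed (intro borel_measurable_prod measurable_power_sum_stick)
qed

text \<open>The product measure is invariant under adding an independent first coordinate \<open>a\<close>. Each factor becomes
  \<open>a ^ e j\<close> plus \<open>(1 - a) ^ e j\<close> times a power sum of the remaining sticks; multiplying out, \<open>S\<close> is the
  set of factors that take the first stick, and integrating \<open>a\<close> gives a beta integral.\<close>

lemma stick_moment_rec:
  assumes J: "finite J" and e: "\<And>j. j \<in> J \<Longrightarrow> e j \<ge> 1"
  shows "stick_moment e J = (\<Sum>S\<in>Pow J. fact (\<Sum>j\<in>S. e j) * fact (\<Sum>j\<in>J - S. e j) / fact ((\<Sum>j\<in>J. e j) + 1) * stick_moment e (J - S))"
proof -
  interpret S: sequence_space unif_restricted
    by (intro sequence_space.intro product_prob_space.intro product_sigma_finite.intro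
        product_prob_space_axioms.intro prob_space_imp_sigma_finite prob_space_unif_restricted)
  interpret P: prob_space unif_product by (intro prob_space_PiM prob_space_unif_restricted)
  interpret UP: pair_prob_space unif_restricted unif_product ..
  define m where "m S = (\<Sum>j\<in>S. e j)" for S
  define F where "F v = (\<Prod>j\<in>J. power_sum (e j) (stick_breaking v))" for v
  define G where "G S w = (\<Prod>j\<in>J - S. power_sum (e j) (stick_breaking w))" for S w
  define A where "A S a = a ^ m S * (1 - a) ^ m (J - S)" for S and a :: real
  let ?case = "\<lambda>(a, w). case_nat a w"
  have meas: "?case \<in> unif_restricted \<Otimes>\<^sub>M unif_product \<rightarrow>\<^sub>M unif_product"
    unfolding case_prod_beta by (intro measurable_case_nat' measurable_fst measurable_snd)
  have Fm: "F \<in> borel_measurable unif_product"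
    unfolding F_def by (intro borel_measurable_prod measurable_power_sum_stick)
  have expand: "F (case_nat a w) = (\<Sum>S\<in>Pow J. A S a * G S w)" if w: "\<And>i. w i \<in> {0..1}" for a w
  proof -
    have "F (case_nat a w) = (\<Prod>j\<in>J. a ^ e j + (1 - a) ^ e j * power_sum (e j) (stick_breaking w))"
      unfolding F_def using power_sum_stick_case_nat[OF w] e by (intro prod.cong) auto
    also have "\<dots> = (\<Sum>S\<in>Pow J. (\<Prod>j\<in>S. a ^ e j) * (\<Prod>j\<in>J - S. (1 - a) ^ e j * power_sum (e j) (stick_breaking w)))"
      by (rule prod_add[OF J])
    also have "\<dots> = (\<Sum>S\<in>Pow J. A S a * G S w)"
      by (simp add: A_def G_def m_def power_sum prod.distrib mult.assoc)
    finally show ?thesis .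
  qed
  have Gint: "integrable unif_product (G S)" for S
    unfolding G_def using e by (intro integrable_stick_prod) auto
  have Am: "A S \<in> borel_measurable borel" for S unfolding A_def by measurable
  have "stick_moment e J = integral\<^sup>L unif_product F" by (simp add: stick_moment_def F_def[abs_def])
  also have "\<dots> = integral\<^sup>L (distr (unif_restricted \<Otimes>\<^sub>M unif_product) unif_product ?case) F"
    by (simp only: S.PiM_iter)
  also have "\<dots> = (\<integral>z. F (?case z) \<partial>(unif_restricted \<Otimes>\<^sub>M unif_product))"
    by (rule integral_distr[OF meas Fm])
  also have "\<dots> = (\<integral>a. (\<integral>w. F (case_nat a w) \<partial>unif_product) \<partial>unif_restricted)"
  proof -
    have "integrable (unif_restricted \<Otimes>\<^sub>M unif_product) (\<lambda>z. F (?case z))"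
    proof -
      have "integrable (distr (unif_restricted \<Otimes>\<^sub>M unif_product) unif_product ?case) F"
        unfolding S.PiM_iter F_def using e by (rule integrable_stick_prod)
      then show ?thesis by (rule integrable_distr[OF meas])
    qed
    from UP.integral_fst'[OF this] show ?thesis by simp
  qed
  also have "\<dots> = (\<integral>a. (\<Sum>S\<in>Pow J. A S a * integral\<^sup>L unif_product (G S)) \<partial>unif_restricted)"
  proof (rule Bochner_Integration.integral_cong[OF refl])
    fix a :: real
    have "(\<integral>w. F (case_nat a w) \<partial>unif_product) = (\<integral>w. (\<Sum>S\<in>Pow J. A S a * G S w) \<partial>unif_product)"
      by (intro Bochner_Integration.integral_cong[OF refl] expand) (simp add: space_unif_product)
    also have "\<dots> = (\<Sum>S\<in>Pow J. A S a * integral\<^sup>L unif_product (G S))"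
      using Gint by (subst Bochner_Integration.integral_sum) auto
    finally show "(\<integral>w. F (case_nat a w) \<partial>unif_product) = (\<Sum>S\<in>Pow J. A S a * integral\<^sup>L unif_product (G S))" .
  qed
  also have "\<dots> = (\<Sum>S\<in>Pow J. (\<integral>a. A S a \<partial>unif01) * integral\<^sup>L unif_product (G S))"
  proof -
    have "integrable unif_restricted (A S)" for S
    proof (rule finite_measure.integrable_const_bound[OF prob_space.finite_measure[OF prob_space_unif_restricted], where B = 1])
      show "AE a in unif_restricted. norm (A S a) \<le> 1"
        by (rule AE_I2) (auto simp: A_def space_restrict_space abs_mult power_abs intro!: mult_le_one power_le_one)
      show "A S \<in> borel_measurable unif_restricted"
        by (rule measurable_restrict_space1) (use Am in \<open>simp add: measurable_cong_sets[OF sets_unif01 refl]\<close>)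
    qed
    then show ?thesis
      by (subst Bochner_Integration.integral_sum) (auto simp: integral_unif_restricted[OF Am])
  qed
  also have "\<dots> = (\<Sum>S\<in>Pow J. fact (m S) * fact (m (J - S)) / fact (m J + 1) * stick_moment e (J - S))"
  proof (rule sum.cong[OF refl])
    fix S assume "S \<in> Pow J"
    then have "m S + m (J - S) = m J"
      unfolding m_def using J by (metis Pow_iff add.commute sum.subset_diff)
    then have "(\<integral>a. A S a \<partial>unif01) = fact (m S) * fact (m (J - S)) / fact (m J + 1)"
      unfolding A_def unif01_beta by simp
    then show "(\<integral>a. A S a \<partial>unif01) * integral\<^sup>L unif_product (G S) =
        fact (m S) * fact (m (J - S)) / fact (m J + 1) * stick_moment e (J - S)"
      by (simp add: stick_moment_def G_def[abs_def])
  qed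
  finally show ?thesis by (simp only: m_def)
qed

text \<open>The recursion has \<open>stick_moment e J\<close> itself on the right, for \<open>S = {}\<close>, with the factor \<open>1 / (m J + 1)\<close>. Moving it
  to the left turns the recursion into the one of \<open>ewens_sum_rec\<close>.\<close>

theorem stick_moment_eq:
  assumes J: "finite J" and e: "\<And>j. j \<in> J \<Longrightarrow> e j \<ge> 1"
  shows "stick_moment e J = ewens_sum e J / fact (\<Sum>j\<in>J. e j)"
  using J e
proof (induction "card J" arbitrary: J rule: less_induct)
  case less
  define m where "m S = (\<Sum>j\<in>S. e j)" for S
  show ?case
  proof (cases "J = {}")
    case True
    interpret P: prob_space unif_product by (intro prob_space_PiM prob_space_unif_restricted)
    show ?thesis using True by (simp add: stick_moment_def ewens_sum_def partition_on_empty P.prob_space)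
  next
    case False
    then obtain j where j: "j \<in> J" by blast
    have "e j \<le> m J" unfolding m_def using j less.prems(1) by (intro member_le_sum) auto
    then have m0: "real (m J) > 0" using less.prems(2)[OF j] by simp
    define W where "W = stick_moment e J"
    have F: "fact (m J + 1) = (real (m J) + 1) * fact (m J)" by (simp add: algebra_simps)
    have m_empty: "m {} = 0" by (simp add: m_def)
    have "W = (\<Sum>S\<in>Pow J. fact (m S) * fact (m (J - S)) / fact (m J + 1) * stick_moment e (J - S))"
      unfolding W_def m_def by (rule stick_moment_rec[OF less.prems])
    also have "\<dots> = fact (m {}) * fact (m J) / fact (m J + 1) * W +
       (\<Sum>S\<in>Pow J - {{}}. fact (m S) * fact (m (J - S)) / fact (m J + 1) * stick_moment e (J - S))"
      using less.prems(1) by (subst sum.remove[of _ "{}"]) (auto simp: W_def)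
    also have "(\<Sum>S\<in>Pow J - {{}}. fact (m S) * fact (m (J - S)) / fact (m J + 1) * stick_moment e (J - S)) =
       (\<Sum>S\<in>Pow J - {{}}. fact (m S) * ewens_sum e (J - S) / fact (m J + 1))"
    proof (rule sum.cong[OF refl])
      fix S assume S: "S \<in> Pow J - {{}}"
      have "card (J - S) < card J" using S less.prems(1) by (intro psubset_card_mono) auto
      then have "stick_moment e (J - S) = ewens_sum e (J - S) / fact (m (J - S))"
        unfolding m_def using less.prems by (intro less.hyps) auto
      then show "fact (m S) * fact (m (J - S)) / fact (m J + 1) * stick_moment e (J - S) =
         fact (m S) * ewens_sum e (J - S) / fact (m J + 1)" by simp
    qed
    also have "\<dots> = real (m J) * ewens_sum e J / fact (m J + 1)"
      using ewens_sum_rec[OF less.prems] by (simp add: m_def sum_divide_distrib)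
    also have "fact (m {}) * fact (m J) / fact (m J + 1) * W = W / (real (m J) + 1)"
      unfolding F m_empty by simp
    also have "real (m J) * ewens_sum e J / fact (m J + 1) = real (m J) * (ewens_sum e J / fact (m J)) / (real (m J) + 1)"
      unfolding F by simp
    finally have W_eq: "W = (W + real (m J) * (ewens_sum e J / fact (m J))) / (real (m J) + 1)"
      by (simp only: add_divide_distrib)
    have ne: "real (m J) + 1 \<noteq> 0" using m0 by linarith
    have "W * (real (m J) + 1) = W + real (m J) * (ewens_sum e J / fact (m J))"
      by (rule iffD1[OF nonzero_eq_divide_eq[OF ne] W_eq])
    then have "real (m J) * W = real (m J) * (ewens_sum e J / fact (m J))" by (simp add: algebra_simps)
    then have "W = ewens_sum e J / fact (m J)" by (rule mult_left_cancel[THEN iffD1, rotated]) (use m0 in simp)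
    then show ?thesis by (simp add: W_def m_def)
  qed
qed


section \<open>Weak convergence from approximation\<close>

lemma integral_diff_le:
  fixes f g :: "'a \<Rightarrow> real"
  assumes M: "prob_space M" and K: "AE x in M. x \<in> K"
    and f: "f \<in> borel_measurable M" "\<And>x. x \<in> K \<Longrightarrow> \<bar>f x\<bar> \<le> B"
    and g: "g \<in> borel_measurable M" and fg: "\<And>x. x \<in> K \<Longrightarrow> \<bar>f x - g x\<bar> \<le> d"
  shows "\<bar>integral\<^sup>L M f - integral\<^sup>L M g\<bar> \<le> d"
proof -
  interpret prob_space M by (rule M)
  have fi: "integrable M f"
  proof (rule integrable_const_bound[where B = B])
    show "AE x in M. norm (f x) \<le> B" using K by eventually_elim (simp add: f(2))
  qed (rule f(1))
  have gB: "\<bar>g x\<bar> \<le> B + d" if "x \<in> K" for x using f(2)[OF that] fg[OF that] by linarith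
  have gi: "integrable M g"
  proof (rule integrable_const_bound[where B = "B + d"])
    show "AE x in M. norm (g x) \<le> B + d" using K by eventually_elim (simp add: gB)
  qed (rule g)
  have "\<bar>\<integral>x. f x - g x \<partial>M\<bar> \<le> (\<integral>x. \<bar>f x - g x\<bar> \<partial>M)" by (rule integral_abs_bound)
  also have "\<dots> \<le> d"
  proof (rule integral_le_const)
    show "integrable M (\<lambda>x. \<bar>f x - g x\<bar>)" using fi gi by auto
    show "AE x in M. \<bar>f x - g x\<bar> \<le> d" using K by eventually_elim (rule fg)
  qed
  finally show ?thesis using fi gi by simp
qed

lemma integral_limit_by_approximation:
  fixes f :: "'a \<Rightarrow> real"
  assumes M: "\<And>n. prob_space (M n)" "\<And>n. AE x in M n. x \<in> K" "\<And>n. f \<in> borel_measurable (M n)"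
    and N: "prob_space N" "AE x in N. x \<in> K" "f \<in> borel_measurable N"
    and bound: "\<And>x. x \<in> K \<Longrightarrow> \<bar>f x\<bar> \<le> B"
    and approx: "\<And>e. e > 0 \<Longrightarrow> \<exists>g. (\<forall>n. g \<in> borel_measurable (M n)) \<and> g \<in> borel_measurable N \<and>
      (\<forall>x\<in>K. \<bar>f x - g x\<bar> < e) \<and> (\<lambda>n. integral\<^sup>L (M n) g) \<longlonglongrightarrow> integral\<^sup>L N g"
  shows "(\<lambda>n. integral\<^sup>L (M n) f) \<longlonglongrightarrow> integral\<^sup>L N f"
proof (rule tendstoI)
  fix e :: real assume e: "e > 0"
  obtain g where g: "\<And>n. g \<in> borel_measurable (M n)" "g \<in> borel_measurable N"
    "\<And>x. x \<in> K \<Longrightarrow> \<bar>f x - g x\<bar> < e / 3" "(\<lambda>n. integral\<^sup>L (M n) g) \<longlonglongrightarrow> integral\<^sup>L N g"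
    using approx[of "e / 3"] e by auto
  have a: "\<bar>integral\<^sup>L (M n) f - integral\<^sup>L (M n) g\<bar> \<le> e / 3" for n
    by (rule integral_diff_le[OF M(1,2,3) bound g(1) less_imp_le[OF g(3)]])
  have b: "\<bar>integral\<^sup>L N f - integral\<^sup>L N g\<bar> \<le> e / 3"
    by (rule integral_diff_le[OF N bound g(2) less_imp_le[OF g(3)]])
  have "\<forall>\<^sub>F n in sequentially. dist (integral\<^sup>L (M n) g) (integral\<^sup>L N g) < e / 3"
    using g(4) e by (intro tendstoD) auto
  then show "\<forall>\<^sub>F n in sequentially. dist (integral\<^sup>L (M n) f) (integral\<^sup>L N f) < e"
  proof eventually_elim
    case (elim n)
    then show ?case using a[of n] b unfolding dist_real_def by linarith
  qed
qed

lemma integral_mallows: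
  "integral\<^sup>L (mallows n \<beta>) f = mallows_expect n \<beta> f" for f :: "(nat \<Rightarrow> nat) \<Rightarrow> real"
  unfolding mallows_def mallows_expect_def using mallows_Z_pos[of n \<beta>]
  by (subst lebesgue_integral_point_measure_finite[OF finite_perms])
     (auto simp: sum_divide_distrib)

section \<open>The cycle of a given point is asymptotically uniform\<close>

theorem orbit_weak_conv:
  assumes pos: "\<And>n. n \<ge> 1 \<Longrightarrow> \<beta> n > 0"
    and lim: "(\<lambda>n. sqrt (real n) * \<beta> n) \<longlonglongrightarrow> 0" and s: "\<And>n. n \<ge> 1 \<Longrightarrow> s n \<in> {1..n}"
  shows "weak_conv_m (\<lambda>n. distr (mallows n (\<beta> n)) borel (\<lambda>\<sigma>. real (card (orbit \<sigma> (s n))) / real n)) unif01"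
proof -
  define X where "X n \<sigma> = real (card (orbit \<sigma> (s n))) / real n" for n \<sigma>
  define \<mu> where "\<mu> n = distr (mallows n (\<beta> n)) borel (X n)" for n
  have meas: "h \<in> borel_measurable (mallows n (\<beta> n))" for h :: "(nat \<Rightarrow> nat) \<Rightarrow> real" and n
    by (simp add: mallows_def measurable_def space_point_measure sets_point_measure)
  have prob: "prob_space (\<mu> n)" for n
    unfolding \<mu>_def by (rule prob_space.prob_space_distr[OF prob_space_mallows meas])
  have expect: "integral\<^sup>L (\<mu> n) g = mallows_expect n (\<beta> n) (\<lambda>\<sigma>. g (X n \<sigma>))"
    if "g \<in> borel_measurable borel" for g :: "real \<Rightarrow> real" and n
    unfolding \<mu>_def using that by (simp add: integral_distr[OF meas] integral_mallows)
  have X01: "X n \<sigma> \<in> {0..1}" if \<sigma>: "\<sigma> permutes {1..n}" for n \<sigma>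
  proof (cases "n = 0")
    case False
    then have "orbit \<sigma> (s n) \<subseteq> {1..n}" using s[of n] by (intro permutes_orbit_subset[OF \<sigma>]) auto
    then have "card (orbit \<sigma> (s n)) \<le> n" using card_mono[of "{1..n}" "orbit \<sigma> (s n)"] by simp
    then show ?thesis using False by (simp add: X_def)
  qed (simp add: X_def)
  have AE_\<mu>: "AE x in \<mu> n. x \<in> {0..1}" for n
    unfolding \<mu>_def
  proof (subst AE_distr_iff[OF meas])
    show "AE \<sigma> in mallows n (\<beta> n). X n \<sigma> \<in> {0..1}"
      by (rule AE_I2) (simp add: mallows_def space_point_measure X01[unfolded atLeastAtMost_iff])
  qed simp
  interpret U: real_distribution unif01
    using prob_space_unif01 by (simp add: real_distribution_def real_distribution_axioms_def sets_unif01)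
  have rd: "real_distribution (\<mu> n)" for n
    using prob by (simp add: real_distribution_def real_distribution_axioms_def \<mu>_def)
  have "weak_conv_m \<mu> unif01"
  proof (rule integral_bdd_continuous_conv_imp_weak_conv[OF rd U.real_distribution_axioms])
    fix f :: "real \<Rightarrow> real" assume cont: "\<And>x. isCont f x" and bd: "\<And>x. \<bar>f x\<bar> \<le> 1"
    have cf: "continuous_on A f" for A using cont by (auto intro: continuous_at_imp_continuous_on)
    have fm: "f \<in> borel_measurable borel" using cf by (rule borel_measurable_continuous_onI)
    show "(\<lambda>n. integral\<^sup>L (\<mu> n) f) \<longlonglongrightarrow> integral\<^sup>L unif01 f"
    proof (rule integral_limit_by_approximation[OF prob AE_\<mu> _ prob_space_unif01 AE_unif01 _ bd])
      show "f \<in> borel_measurable (\<mu> n)" for n using fm by (simp add: \<mu>_def)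
      show "f \<in> borel_measurable unif01" using fm by (simp add: measurable_cong_sets[OF sets_unif01 refl])
      fix e :: real assume "e > 0"
      then obtain g where g: "real_polynomial_function g" "\<And>x. x \<in> {0..1} \<Longrightarrow> \<bar>f x - g x\<bar> < e"
        using Stone_Weierstrass_real_polynomial_function[OF compact_Icc cf] by blast
      from g(1) obtain a N where ga: "g = (\<lambda>x. \<Sum>i\<le>N. a i * x ^ i)"
        unfolding real_polynomial_function_iff_sum by blast
      have gm: "g \<in> borel_measurable borel" unfolding ga by measurable
      have "integral\<^sup>L (\<mu> n) g = (\<Sum>i\<le>N. a i * mallows_expect n (\<beta> n) (\<lambda>\<sigma>. X n \<sigma> ^ i))" for n
        unfolding expect[OF gm] unfolding ga mallows_expect_sum
        by (intro sum.cong refl) (simp add: mallows_expect_def sum_distrib_left mult_ac)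
      moreover have "(\<lambda>n. \<Sum>i\<le>N. a i * mallows_expect n (\<beta> n) (\<lambda>\<sigma>. X n \<sigma> ^ i)) \<longlonglongrightarrow> (\<Sum>i\<le>N. a i * (1 / real (i + 1)))"
        unfolding X_def by (intro tendsto_sum tendsto_mult tendsto_const orbit_moment_limit pos lim s)
      moreover have "integral\<^sup>L unif01 g = (\<Sum>i\<le>N. a i * (1 / real (i + 1)))"
      proof -
        have "integrable unif01 (\<lambda>x. x ^ i)" for i
        proof (rule U.integrable_const_bound[where B = 1])
          show "AE x in unif01. norm (x ^ i) \<le> 1"
            using AE_unif01 by eventually_elim (auto simp: power_abs intro!: power_le_one)
        qed (simp add: measurable_cong_sets[OF sets_unif01 refl])
        then show ?thesis unfolding ga by (subst Bochner_Integration.integral_sum) (auto simp: unif01_moment)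
      qed
      ultimately have "(\<lambda>n. integral\<^sup>L (\<mu> n) g) \<longlonglongrightarrow> integral\<^sup>L unif01 g" by simp
      then show "\<exists>g. (\<forall>n. g \<in> borel_measurable (\<mu> n)) \<and> g \<in> borel_measurable unif01 \<and>
        (\<forall>x\<in>{0..1}. \<bar>f x - g x\<bar> < e) \<and> (\<lambda>n. integral\<^sup>L (\<mu> n) g) \<longlonglongrightarrow> integral\<^sup>L unif01 g"
        using g(2) gm by (intro exI[of _ g]) (auto simp: \<mu>_def measurable_cong_sets[OF sets_unif01 refl])
    qed
  qed
  then show ?thesis by (simp add: \<mu>_def[abs_def] X_def[abs_def])
qed

section \<open>Power sums determine weak convergence on the simplex\<close>

text \<open>The compact set that carries all laws in question. The bound on the partial sums, instead of on the
  sum, makes it closed in the product topology.\<close>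

definition ordered_simplex :: "(nat \<Rightarrow> real) set" where
  "ordered_simplex = {x. (\<forall>i. x (Suc i) \<le> x i) \<and> (\<forall>i. 0 \<le> x i) \<and> (\<forall>n. (\<Sum>i<n. x i) \<le> 1)}"

lemma ordered_simplexD:
  assumes "x \<in> ordered_simplex"
  shows "decseq x" "0 \<le> x i" "(\<Sum>i<n. x i) \<le> 1" "x i \<le> 1 / real (Suc i)" "x i \<le> 1" "summable x"
proof -
  show dec: "decseq x" and nn: "0 \<le> x i" and s1: "(\<Sum>i<n. x i) \<le> 1" for i n
    using assms by (auto simp: ordered_simplex_def intro: decseq_SucI)
  have "real (Suc i) * x i = (\<Sum>j<Suc i. x i)" by simp
  also have "\<dots> \<le> (\<Sum>j<Suc i. x j)" using dec by (intro sum_mono) (auto simp: decseq_def)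
  also have "\<dots> \<le> 1" by (rule s1)
  finally show le: "x i \<le> 1 / real (Suc i)" by (simp add: pos_le_divide_eq mult.commute del: of_nat_Suc)
  also have "\<dots> \<le> 1" by simp
  finally show "x i \<le> 1" .
  show "summable x" using nn s1 by (rule summableI_nonneg_bounded)
qed

lemma ordered_simplex_subset: "ordered_simplex \<subseteq> seq_space"
  using ordered_simplexD by (auto simp: seq_space_def)

lemma compact_ordered_simplex: "compact ordered_simplex"
proof -
  have "compactin (product_topology (\<lambda>i::nat. euclidean) UNIV) (PiE UNIV (\<lambda>_. {0..1::real}))"
    unfolding compactin_PiE by simp
  then have c: "compact (PiE (UNIV::nat set) (\<lambda>_. {0..1::real}))"
    by (simp add: euclidean_product_topology)
  have coord: "continuous_on UNIV (\<lambda>x::nat \<Rightarrow> real. x i)" for i by simp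
  have "closed ({x. \<forall>i. x (Suc i) \<le> x i} \<inter> {x. \<forall>i. 0 \<le> x i} \<inter> {x. \<forall>n. (\<Sum>i<n. x i) \<le> (1::real)})"
    by (intro closed_Int closed_Collect_all closed_Collect_le continuous_on_sum continuous_on_const coord)
  then have "closed ordered_simplex" by (simp add: ordered_simplex_def Collect_conj_eq Int_assoc)
  moreover have "ordered_simplex \<subseteq> PiE UNIV (\<lambda>_. {0..1})" using ordered_simplexD by auto
  ultimately show ?thesis using compact_Int_closed[OF c] by (metis inf.absorb2)
qed

lemma summable_power_ordered: "x \<in> ordered_simplex \<Longrightarrow> p \<ge> 1 \<Longrightarrow> summable (\<lambda>i. x i ^ p)"
  using ordered_simplexD by (intro summable_power) auto

text \<open>On the simplex \<open>x i \<le> 1 / (i + 1)\<close>, so that the series is dominated by a convergent one. For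
  \<open>p = 1\<close> continuity fails, because mass can escape into small entries.\<close>

lemma continuous_on_power_sum:
  assumes p: "p \<ge> 2" shows "continuous_on ordered_simplex (power_sum p)"
proof -
  have "uniform_limit ordered_simplex (\<lambda>n x. \<Sum>i<n. x i ^ p) (\<lambda>x. \<Sum>i. x i ^ p) sequentially"
  proof (rule Weierstrass_m_test)
    fix i and x :: "nat \<Rightarrow> real" assume x: "x \<in> ordered_simplex"
    have "x i ^ p \<le> x i ^ 2" using ordered_simplexD[OF x] p by (intro power_decreasing) auto
    also have "\<dots> \<le> (1 / real (Suc i)) ^ 2" using ordered_simplexD[OF x] by (intro power_mono) auto
    finally show "norm (x i ^ p) \<le> (1 / real (Suc i)) ^ 2"
      using ordered_simplexD(2)[OF x, of i] by simp
  next
    have "summable (\<lambda>i. inverse (real (Suc i) ^ 2))"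
      using inverse_power_summable[of 2, where 'a = real] by (subst summable_Suc_iff) auto
    then show "summable (\<lambda>i. (1 / real (Suc i)) ^ 2)" by (simp add: divide_inverse power_inverse)
  qed
  moreover have "continuous_on ordered_simplex (\<lambda>x. \<Sum>i<n. x i ^ p)" for n
    by (intro continuous_on_sum continuous_on_power continuous_on_subset[OF continuous_on_product_coordinates]) auto
  ultimately have "continuous_on ordered_simplex (\<lambda>x. \<Sum>i. x i ^ p)"
    by (intro uniform_limit_theorem[OF always_eventually]) auto
  then show ?thesis by (simp add: power_sum_def[abs_def])
qed

text \<open>Otherwise \<open>y j < x j\<close>. The tails from \<open>j\<close> on have equal power sums; that of \<open>x\<close> is at least \<open>x j ^ p\<close>, whereas
  that of \<open>y\<close> is at most a constant times \<open>y j ^ (p - 2)\<close>, which is impossible for large \<open>p\<close>.\<close>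

lemma power_sums_dominate:
  assumes x: "x \<in> ordered_simplex" and y: "y \<in> ordered_simplex"
    and eq: "\<And>p. p \<ge> 2 \<Longrightarrow> power_sum p x = power_sum p y" and agree: "\<And>i. i < j \<Longrightarrow> x i = y i"
  shows "x j \<le> y j"
proof (rule ccontr)
  assume "\<not> x j \<le> y j"
  then have lt: "y j < x j" by simp
  note X = ordered_simplexD[OF x] and Y = ordered_simplexD[OF y]
  have xj: "x j > 0" using lt Y(2)[of j] by linarith
  define C where "C = (\<Sum>i. y (i + j) ^ 2)"
  have tail: "(\<Sum>i. x (i + j) ^ p) = (\<Sum>i. y (i + j) ^ p)" if p: "p \<ge> 2" for p
  proof -
    have "(\<Sum>i. x i ^ p) = (\<Sum>i. x (i + j) ^ p) + (\<Sum>i<j. x i ^ p)"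
      using p by (intro suminf_split_initial_segment summable_power_ordered x) auto
    moreover have "(\<Sum>i. y i ^ p) = (\<Sum>i. y (i + j) ^ p) + (\<Sum>i<j. y i ^ p)"
      using p by (intro suminf_split_initial_segment summable_power_ordered y) auto
    moreover have "(\<Sum>i<j. x i ^ p) = (\<Sum>i<j. y i ^ p)" using agree by (intro sum.cong) auto
    ultimately show ?thesis using eq[OF p] by (simp add: power_sum_def)
  qed
  have sx: "summable (\<lambda>i. x (i + j) ^ p)" if "p \<ge> 1" for p
    by (rule iffD2[OF summable_iff_shift summable_power_ordered[OF x that]])
  have sy: "summable (\<lambda>i. y (i + j) ^ p)" if "p \<ge> 1" for p
    by (rule iffD2[OF summable_iff_shift summable_power_ordered[OF y that]])
  have bound: "x j ^ (q + 2) \<le> C * y j ^ q" for q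
  proof -
    have "x j ^ (q + 2) = (\<Sum>i\<in>{0}. x (i + j) ^ (q + 2))" by simp
    also have "\<dots> \<le> (\<Sum>i. x (i + j) ^ (q + 2))" using X(2) by (intro sum_le_suminf[OF sx]) auto
    also have "\<dots> = (\<Sum>i. y (i + j) ^ (q + 2))" by (rule tail) simp
    also have "\<dots> \<le> (\<Sum>i. y (i + j) ^ 2 * y j ^ q)"
    proof (rule suminf_le[OF _ sy])
      show "y (i + j) ^ (q + 2) \<le> y (i + j) ^ 2 * y j ^ q" for i
      proof -
        have "y (i + j) \<le> y j" using Y(1) by (simp add: decseq_def)
        then have "y (i + j) ^ q \<le> y j ^ q" using Y(2) by (intro power_mono) auto
        then have "y (i + j) ^ 2 * y (i + j) ^ q \<le> y (i + j) ^ 2 * y j ^ q" by (intro mult_left_mono) auto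
        then show ?thesis by (simp only: power_add mult.commute)
      qed
      show "summable (\<lambda>i. y (i + j) ^ 2 * y j ^ q)" using sy[of 2] by (intro summable_mult2) auto
    qed simp
    also have "\<dots> = C * y j ^ q" unfolding C_def using sy[of 2] by (intro suminf_mult2[symmetric]) auto
    finally show ?thesis .
  qed
  define r where "r = y j / x j"
  have r: "0 \<le> r" "r < 1" using lt xj Y(2)[of j] by (auto simp: r_def)
  have "x j ^ 2 \<le> C * r ^ q" for q
  proof -
    have "x j ^ 2 * x j ^ q \<le> C * y j ^ q" using bound[of q] by (simp only: power_add mult.commute)
    then show ?thesis using xj by (simp add: r_def power_divide field_simps)
  qed
  moreover have "(\<lambda>q. C * r ^ q) \<longlonglongrightarrow> C * 0" using r by (intro tendsto_mult tendsto_const LIMSEQ_power_zero) auto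
  ultimately have "x j ^ 2 \<le> C * 0" by (intro LIMSEQ_le_const) auto
  then show False using xj by simp
qed

lemma power_sums_separate:
  assumes x: "x \<in> ordered_simplex" and y: "y \<in> ordered_simplex" and "x \<noteq> y"
  shows "\<exists>p\<ge>2. power_sum p x \<noteq> power_sum p y"
proof (rule ccontr)
  assume "\<not> ?thesis"
  then have eq: "power_sum p x = power_sum p y" if "p \<ge> 2" for p using that by blast
  have "x j = y j" for j
  proof (induction j rule: less_induct)
    case (less j)
    show ?case
      using power_sums_dominate[OF x y eq less] power_sums_dominate[OF y x eq[symmetric] less[symmetric]]
      by (intro antisym) auto
  qed
  then show False using \<open>x \<noteq> y\<close> by auto
qed

text \<open>The subalgebra generated by the power sums, for which Stone-Weierstrass is invoked.\<close>

inductive_set power_sum_ring :: "((nat \<Rightarrow> real) \<Rightarrow> real) set" where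
  const: "(\<lambda>_. c) \<in> power_sum_ring"
| gen: "p \<ge> 2 \<Longrightarrow> power_sum p \<in> power_sum_ring"
| add: "f \<in> power_sum_ring \<Longrightarrow> g \<in> power_sum_ring \<Longrightarrow> (\<lambda>x. f x + g x) \<in> power_sum_ring"
| mult: "f \<in> power_sum_ring \<Longrightarrow> g \<in> power_sum_ring \<Longrightarrow> (\<lambda>x. f x * g x) \<in> power_sum_ring"

lemma continuous_on_power_sum_ring: "f \<in> power_sum_ring \<Longrightarrow> continuous_on ordered_simplex f"
  by (induction rule: power_sum_ring.induct) (intro continuous_intros continuous_on_power_sum | assumption)+

lemma function_ring_power_sum: "function_ring_on power_sum_ring ordered_simplex"
proof
  fix x y assume "x \<in> ordered_simplex" "y \<in> ordered_simplex" "x \<noteq> y"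
  then show "\<exists>f\<in>power_sum_ring. f x \<noteq> f y" using power_sums_separate power_sum_ring.gen by blast
qed (auto intro: power_sum_ring.intros compact_ordered_simplex continuous_on_power_sum_ring)

abbreviation seq_borel :: "(nat \<Rightarrow> real) measure" where
  "seq_borel \<equiv> restrict_space borel seq_space"

lemma measurable_power_sum: "power_sum p \<in> borel_measurable seq_borel"
proof -
  have "(\<lambda>x::nat \<Rightarrow> real. x i) \<in> borel_measurable borel" for i
    by (rule borel_measurable_continuous_onI) simp
  then have "power_sum p \<in> borel_measurable borel" unfolding power_sum_def[abs_def] by measurable
  then show ?thesis by (rule measurable_restrict_space1)
qed

lemma measurable_power_sum_ring: "f \<in> power_sum_ring \<Longrightarrow> f \<in> borel_measurable seq_borel"
proof (induction rule: power_sum_ring.induct)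
  case (gen p) show ?case by (rule measurable_power_sum)
qed auto

text \<open>Convergence for products of power sums extends to the algebra they generate. The induction shows that
  multiplication by an element of the algebra preserves the functions \<open>h\<close> for which integrals of \<open>h\<close> times any product of
  power sums converge; this formulation survives products of two elements.\<close>

theorem weak_conv_by_power_sums:
  fixes M :: "nat \<Rightarrow> (nat \<Rightarrow> real) measure"
  assumes M: "\<And>n. prob_space (M n)" "\<And>n. sets (M n) = sets seq_borel" "\<And>n. AE x in M n. x \<in> ordered_simplex"
    and N: "prob_space N" "sets N = sets seq_borel" "AE x in N. x \<in> ordered_simplex"
    and moments: "\<And>ps. (\<And>p. p \<in> set ps \<Longrightarrow> p \<ge> 2) \<Longrightarrow>
      (\<lambda>n. \<integral>x. (\<Prod>p\<leftarrow>ps. power_sum p x) \<partial>M n) \<longlonglongrightarrow> (\<integral>x. (\<Prod>p\<leftarrow>ps. power_sum p x) \<partial>N)"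
  shows "weak_conv_on seq_space M N"
proof -
  interpret R: function_ring_on power_sum_ring ordered_simplex by (rule function_ring_power_sum)
  have ring_int: "integrable P f" if f: "f \<in> power_sum_ring"
    and P: "prob_space P" "sets P = sets seq_borel" "AE x in P. x \<in> ordered_simplex" for P f
  proof -
    interpret P: prob_space P by (rule P)
    have "bounded (f ` ordered_simplex)"
      by (intro compact_imp_bounded compact_continuous_image continuous_on_power_sum_ring f compact_ordered_simplex)
    then obtain B where "\<And>x. x \<in> ordered_simplex \<Longrightarrow> norm (f x) \<le> B" by (auto simp: bounded_iff)
    then show ?thesis using P(3) measurable_power_sum_ring[OF f]
      by (intro P.integrable_const_bound[where B = B]) (auto simp: measurable_cong_sets[OF P(2) refl])
  qed
  define good where "good h \<longleftrightarrow> h \<in> power_sum_ring \<and> (\<forall>ps. (\<forall>p\<in>set ps. p \<ge> 2) \<longrightarrow>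
     (\<lambda>n. \<integral>x. h x * (\<Prod>p\<leftarrow>ps. power_sum p x) \<partial>M n) \<longlonglongrightarrow> (\<integral>x. h x * (\<Prod>p\<leftarrow>ps. power_sum p x) \<partial>N))" for h
  have prod_ring: "(\<lambda>x. \<Prod>p\<leftarrow>ps. power_sum p x) \<in> power_sum_ring" if "\<forall>p\<in>set ps. p \<ge> 2" for ps
    using that by (induction ps) (auto intro: power_sum_ring.intros)
  have good_mult: "good (\<lambda>x. f x * h x)" if "f \<in> power_sum_ring" "good h" for f h
    using that
  proof (induction f arbitrary: h rule: power_sum_ring.induct)
    case (const c)
    then show ?case unfolding good_def
      by (auto intro: power_sum_ring.intros simp: mult.assoc intro!: tendsto_mult_left)
  next
    case (gen p)
    show ?case unfolding good_def
    proof (intro conjI allI impI)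
      show "(\<lambda>x. power_sum p x * h x) \<in> power_sum_ring"
        using gen by (auto simp: good_def intro: power_sum_ring.intros)
      fix ps :: "nat list" assume ps: "\<forall>p\<in>set ps. p \<ge> 2"
      then have "\<forall>p\<in>set (p # ps). p \<ge> 2" using gen by simp
      then have "(\<lambda>n. \<integral>x. h x * (\<Prod>p\<leftarrow>p # ps. power_sum p x) \<partial>M n) \<longlonglongrightarrow> (\<integral>x. h x * (\<Prod>p\<leftarrow>p # ps. power_sum p x) \<partial>N)"
        using gen(2) unfolding good_def by blast
      then show "(\<lambda>n. \<integral>x. power_sum p x * h x * (\<Prod>p\<leftarrow>ps. power_sum p x) \<partial>M n) \<longlonglongrightarrow> (\<integral>x. power_sum p x * h x * (\<Prod>p\<leftarrow>ps. power_sum p x) \<partial>N)"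
        by (simp add: mult_ac)
    qed
  next
    case (add f g)
    have f: "good (\<lambda>x. f x * h x)" and g: "good (\<lambda>x. g x * h x)" using add by auto
    show ?case unfolding good_def
    proof (intro conjI allI impI)
      show "(\<lambda>x. (f x + g x) * h x) \<in> power_sum_ring"
        using add by (auto simp: good_def intro: power_sum_ring.intros)
      fix ps :: "nat list" assume ps: "\<forall>p\<in>set ps. p \<ge> 2"
      let ?Q = "\<lambda>x. \<Prod>p\<leftarrow>ps. power_sum p x"
      have fr: "(\<lambda>x. f x * h x * ?Q x) \<in> power_sum_ring" and gr: "(\<lambda>x. g x * h x * ?Q x) \<in> power_sum_ring"
        using f g prod_ring[OF ps] by (auto simp: good_def intro: power_sum_ring.mult)
      have split: "(\<integral>x. (f x + g x) * h x * ?Q x \<partial>P) = (\<integral>x. f x * h x * ?Q x \<partial>P) + (\<integral>x. g x * h x * ?Q x \<partial>P)"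
        if P: "prob_space P" "sets P = sets seq_borel" "AE x in P. x \<in> ordered_simplex" for P
        using Bochner_Integration.integral_add[OF ring_int[OF fr P] ring_int[OF gr P]] by (simp add: distrib_right)
      have "(\<lambda>n. (\<integral>x. f x * h x * ?Q x \<partial>M n) + (\<integral>x. g x * h x * ?Q x \<partial>M n)) \<longlonglongrightarrow>
         (\<integral>x. f x * h x * ?Q x \<partial>N) + (\<integral>x. g x * h x * ?Q x \<partial>N)"
        using f g ps by (intro tendsto_add) (auto simp: good_def)
      then show "(\<lambda>n. \<integral>x. (f x + g x) * h x * ?Q x \<partial>M n) \<longlonglongrightarrow> (\<integral>x. (f x + g x) * h x * ?Q x \<partial>N)"
        unfolding split[OF M] split[OF N] .
    qed
  next
    case (mult f g)
    then have "good (\<lambda>x. f x * (g x * h x))" by blast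
    then show ?case by (simp add: mult.assoc)
  qed
  have "good (\<lambda>_. 1)" unfolding good_def using moments by (auto intro: power_sum_ring.const)
  then have all_good: "good f" if "f \<in> power_sum_ring" for f using good_mult[OF that, of "\<lambda>_. 1"] by simp
  have ring_conv: "(\<lambda>n. integral\<^sup>L (M n) f) \<longlonglongrightarrow> integral\<^sup>L N f" if "f \<in> power_sum_ring" for f
  proof -
    have "\<forall>ps. (\<forall>p\<in>set ps. p \<ge> 2) \<longrightarrow>
      (\<lambda>n. \<integral>x. f x * (\<Prod>p\<leftarrow>ps. power_sum p x) \<partial>M n) \<longlonglongrightarrow> (\<integral>x. f x * (\<Prod>p\<leftarrow>ps. power_sum p x) \<partial>N)"
      using all_good[OF that] unfolding good_def by blast
    from this[THEN spec, of "[]"] show ?thesis by simp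
  qed
  show ?thesis unfolding weak_conv_on_def
  proof (intro allI impI)
    fix f :: "(nat \<Rightarrow> real) \<Rightarrow> real" assume f: "continuous_on seq_space f \<and> bounded (f ` seq_space)"
    have fm: "f \<in> borel_measurable seq_borel" using f by (intro borel_measurable_continuous_on_restrict) simp
    have fc: "continuous_on ordered_simplex f" using f ordered_simplex_subset continuous_on_subset by blast
    from f obtain B where B: "\<And>x. x \<in> seq_space \<Longrightarrow> \<bar>f x\<bar> \<le> B" by (auto simp: bounded_iff)
    show "(\<lambda>n. integral\<^sup>L (M n) f) \<longlonglongrightarrow> integral\<^sup>L N f"
    proof (rule integral_limit_by_approximation[OF M(1,3) _ N(1,3)])
      show "f \<in> borel_measurable (M n)" for n using fm by (simp add: measurable_cong_sets[OF M(2) refl])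
      show "f \<in> borel_measurable N" using fm by (simp add: measurable_cong_sets[OF N(2) refl])
      show "\<bar>f x\<bar> \<le> B" if "x \<in> ordered_simplex" for x using B ordered_simplex_subset that by blast
      fix e :: real assume "e > 0"
      then obtain g where g: "g \<in> power_sum_ring" "\<forall>x\<in>ordered_simplex. \<bar>f x - g x\<bar> < e"
        using R.Stone_Weierstrass_basic[OF fc] by blast
      then show "\<exists>g. (\<forall>n. g \<in> borel_measurable (M n)) \<and> g \<in> borel_measurable N \<and>
        (\<forall>x\<in>ordered_simplex. \<bar>f x - g x\<bar> < e) \<and> (\<lambda>n. integral\<^sup>L (M n) g) \<longlonglongrightarrow> integral\<^sup>L N g"
        using ring_conv[OF g(1)] measurable_power_sum_ring[OF g(1)]
        by (intro exI[of _ g]) (auto simp: measurable_cong_sets[OF M(2) refl] measurable_cong_sets[OF N(2) refl])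
    qed
  qed
qed

section \<open>Sorted cycle lengths\<close>

lemma power_sum_cycle_len:
  assumes p: "p \<ge> 1"
  shows "power_sum p (\<lambda>k. real (cycle_len n \<sigma> k) / real n) = (\<Sum>C\<in>cycle_sets n \<sigma>. (real (card C) / real n) ^ p)"
proof -
  define l where "l = cycle_lens n \<sigma>"
  define h where "h c = (real c / real n) ^ p" for c :: nat
  have mset: "mset l = image_mset card (mset_set (cycle_sets n \<sigma>))" by (simp add: l_def cycle_lens_def)
  have "power_sum p (\<lambda>k. real (cycle_len n \<sigma> k) / real n) = (\<Sum>k\<in>{..<length l}. (real (cycle_len n \<sigma> k) / real n) ^ p)"
    unfolding power_sum_def using p by (intro suminf_finite) (auto simp: cycle_len_def l_def)
  also have "\<dots> = (\<Sum>k\<in>{..<length l}. h (l ! k))"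
    by (intro sum.cong) (auto simp: cycle_len_def l_def h_def)
  also have "\<dots> = sum_list (map h l)" by (simp add: sum_list_sum_nth atLeast0LessThan)
  also have "\<dots> = (\<Sum>c\<in>#mset l. h c)" by (simp add: sum_mset_sum_list[symmetric])
  also have "\<dots> = (\<Sum>C\<in>cycle_sets n \<sigma>. h (card C))"
    unfolding mset by (simp add: sum_unfold_sum_mset image_mset.compositionality comp_def)
  finally show ?thesis by (simp add: h_def)
qed

lemma sum_card_cycle_sets:
  assumes \<sigma>: "\<sigma> permutes {1..n}" shows "(\<Sum>C\<in>cycle_sets n \<sigma>. card C) \<le> n"
proof -
  have "(\<Sum>C\<in>cycle_sets n \<sigma>. card C) = card (\<Union> (cycle_sets n \<sigma>))"
  proof (rule card_Union_disjoint[symmetric])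
    show "pairwise disjnt (cycle_sets n \<sigma>)"
      unfolding pairwise_def disjnt_def using cycle_set_eq_orbit[OF \<sigma>] by blast
    show "finite C" if "C \<in> cycle_sets n \<sigma>" for C
      using cycle_sets_subset[OF \<sigma> that] finite_subset by blast
  qed
  also have "\<dots> \<le> card {1..n}" using cycle_sets_subset[OF \<sigma>] by (intro card_mono) auto
  finally show ?thesis by simp
qed

lemma prod_list_map_nth:
  fixes f :: "'a \<Rightarrow> real"
  shows "(\<Prod>x\<leftarrow>xs. f x) = (\<Prod>j<length xs. f (xs ! j))"
  by (induction xs) (simp_all add: prod.lessThan_Suc_shift del: prod.lessThan_Suc)

lemma in_ordered_simplexI:
  assumes "x \<in> seq_space" "power_sum 1 x \<le> 1" shows "x \<in> ordered_simplex"
proof -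
  have "(\<Sum>i<n. x i) \<le> 1" for n
  proof -
    have "(\<Sum>i<n. x i) \<le> suminf x" using assms(1) by (intro sum_le_suminf) (auto simp: seq_space_def)
    then show ?thesis using assms(2) by (simp add: power_sum_def)
  qed
  then show ?thesis using assms(1) by (auto simp: seq_space_def ordered_simplex_def decseq_Suc_iff)
qed

lemma cycle_len_in_ordered_simplex:
  assumes \<sigma>: "\<sigma> permutes {1..n}"
  shows "(\<lambda>k. real (cycle_len n \<sigma> k) / real n) \<in> ordered_simplex"
proof (rule in_ordered_simplexI)
  show "(\<lambda>k. real (cycle_len n \<sigma> k) / real n) \<in> seq_space"
    using measurable_space[OF measurable_cycle_len[of n 1], of \<sigma>] \<sigma>
    by (simp add: mallows_def space_point_measure space_restrict_space)
  have "power_sum 1 (\<lambda>k. real (cycle_len n \<sigma> k) / real n) = real (\<Sum>C\<in>cycle_sets n \<sigma>. card C) / real n"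
    by (subst power_sum_cycle_len) (simp_all add: sum_divide_distrib)
  also have "\<dots> \<le> 1" using sum_card_cycle_sets[OF \<sigma>] by (cases "n = 0") (simp_all add: divide_le_eq_1 del: of_nat_sum)
  finally show "power_sum 1 (\<lambda>k. real (cycle_len n \<sigma> k) / real n) \<le> 1" .
qed

theorem cycle_lengths_weak_conv:
  assumes pos: "\<And>n. n \<ge> 1 \<Longrightarrow> \<beta> n > 0"
    and lim: "(\<lambda>n. sqrt (real n) * \<beta> n) \<longlonglongrightarrow> 0"
  shows "weak_conv_on seq_space
    (\<lambda>n. distr (mallows n (\<beta> n)) seq_borel (\<lambda>\<sigma> k. real (cycle_len n \<sigma> k) / real n)) poisson_dirichlet1"
proof (rule weak_conv_by_power_sums)
  let ?X = "\<lambda>n \<sigma> k. real (cycle_len n \<sigma> k) / real n"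
  let ?D = "\<lambda>v. decr_rearr (stick_breaking v)"
  have simplex_sets: "{x \<in> space seq_borel. x \<in> ordered_simplex} \<in> sets seq_borel"
  proof -
    have "ordered_simplex \<in> sets borel" by (intro borel_closed compact_imp_closed compact_ordered_simplex)
    moreover have "{x \<in> space seq_borel. x \<in> ordered_simplex} = seq_space \<inter> ordered_simplex"
      by (auto simp: space_restrict_space)
    ultimately show ?thesis by (auto simp: sets_restrict_space)
  qed
  show "prob_space (distr (mallows n (\<beta> n)) seq_borel (?X n))" for n
    by (rule prob_space.prob_space_distr[OF prob_space_mallows measurable_cycle_len])
  show "sets (distr (mallows n (\<beta> n)) seq_borel (?X n)) = sets seq_borel" for n by simp
  show "AE x in distr (mallows n (\<beta> n)) seq_borel (?X n). x \<in> ordered_simplex" for n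
  proof (subst AE_distr_iff[OF measurable_cycle_len simplex_sets])
    show "AE \<sigma> in mallows n (\<beta> n). ?X n \<sigma> \<in> ordered_simplex"
      by (rule AE_I2) (simp add: mallows_def space_point_measure cycle_len_in_ordered_simplex)
  qed
  show "prob_space poisson_dirichlet1" by (rule prob_space_poisson_dirichlet1)
  show "sets poisson_dirichlet1 = sets seq_borel" by (simp add: poisson_dirichlet1_def)
  have D_power: "power_sum p (?D v) = power_sum p (stick_breaking v)"
    if "\<And>i. v i \<in> {0..1}" "p \<ge> 1" for v p
    using stick_breaking_props[OF that(1)] that(2) by (intro power_sum_decr_rearr) auto
  have "AE v in unif_product. ?D v \<in> ordered_simplex"
  proof (rule AE_I2)
    fix v assume "v \<in> space unif_product"
    then have v: "\<And>i. v i \<in> {0..1}" by (simp add: space_unif_product)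
    show "?D v \<in> ordered_simplex"
    proof (rule in_ordered_simplexI)
      show "?D v \<in> seq_space" using stick_breaking_props[OF v] by (intro decr_rearr_in_seq_space) auto
      show "power_sum 1 (?D v) \<le> 1" using D_power[OF v, of 1] power_sum_stick_bounds(2)[OF v, of 1] by simp
    qed
  qed
  then show "AE x in poisson_dirichlet1. x \<in> ordered_simplex"
    unfolding poisson_dirichlet1_def by (subst AE_distr_iff[OF measurable_poisson_dirichlet1 simplex_sets])
  fix ps :: "nat list" assume ps: "\<And>p. p \<in> set ps \<Longrightarrow> p \<ge> 2"
  define J where "J = {..<length ps}"
  define e where "e j = ps ! j" for j
  have e: "e j \<ge> 1" if "j \<in> J" for j using ps[of "ps ! j"] that by (simp add: J_def e_def)
  have J: "finite J" by (simp add: J_def)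
  have prod: "(\<Prod>p\<leftarrow>ps. power_sum p x) = (\<Prod>j\<in>J. power_sum (e j) x)" for x
    by (simp add: prod_list_map_nth J_def e_def)
  have qm: "(\<lambda>x. \<Prod>j\<in>J. power_sum (e j) x) \<in> borel_measurable seq_borel"
    by (intro borel_measurable_prod measurable_power_sum)
  have "(\<integral>x. (\<Prod>p\<leftarrow>ps. power_sum p x) \<partial>poisson_dirichlet1) = (\<integral>v. (\<Prod>j\<in>J. power_sum (e j) (?D v)) \<partial>unif_product)"
    unfolding prod poisson_dirichlet1_def by (rule integral_distr[OF measurable_poisson_dirichlet1 qm])
  also have "\<dots> = stick_moment e J" unfolding stick_moment_def
    by (intro Bochner_Integration.integral_cong refl prod.cong D_power e) (simp_all add: space_unif_product)
  also have "\<dots> = ewens_sum e J / fact (\<Sum>j\<in>J. e j)" by (rule stick_moment_eq[OF J e])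
  finally have limit: "(\<integral>x. (\<Prod>p\<leftarrow>ps. power_sum p x) \<partial>poisson_dirichlet1) = ewens_sum e J / fact (\<Sum>j\<in>J. e j)" .
  have "(\<integral>x. (\<Prod>p\<leftarrow>ps. power_sum p x) \<partial>distr (mallows n (\<beta> n)) seq_borel (?X n)) =
     mallows_expect n (\<beta> n) (\<lambda>\<sigma>. \<Prod>j\<in>J. \<Sum>C\<in>cycle_sets n \<sigma>. (real (card C) / real n) ^ e j)" for n
  proof -
    have "(\<integral>x. (\<Prod>p\<leftarrow>ps. power_sum p x) \<partial>distr (mallows n (\<beta> n)) seq_borel (?X n)) =
       (\<integral>\<sigma>. (\<Prod>j\<in>J. power_sum (e j) (?X n \<sigma>)) \<partial>mallows n (\<beta> n))"
      unfolding prod by (rule integral_distr[OF measurable_cycle_len qm])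
    also have "\<dots> = mallows_expect n (\<beta> n) (\<lambda>\<sigma>. \<Prod>j\<in>J. \<Sum>C\<in>cycle_sets n \<sigma>. (real (card C) / real n) ^ e j)"
      unfolding integral_mallows using power_sum_cycle_len[OF e]
      by (intro mallows_expect_cong prod.cong) auto
    finally show ?thesis .
  qed
  then show "(\<lambda>n. \<integral>x. (\<Prod>p\<leftarrow>ps. power_sum p x) \<partial>distr (mallows n (\<beta> n)) seq_borel (?X n)) \<longlonglongrightarrow>
     (\<integral>x. (\<Prod>p\<leftarrow>ps. power_sum p x) \<partial>poisson_dirichlet1)"
    unfolding limit using cycle_moment_limit[OF pos lim J e] by simp
qed

theorem theorem1p3:
  fixes \<beta> :: "nat \<Rightarrow> real"
  assumes pos: "\<And>n. n \<ge> 1 \<Longrightarrow> \<beta> n > 0"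
    and lim: "(\<lambda>n. sqrt (real n) * \<beta> n) \<longlonglongrightarrow> 0"
  shows "weak_conv_on seq_space
           (\<lambda>n. distr (mallows n (\<beta> n)) (restrict_space borel seq_space)
                  (\<lambda>\<sigma> k. real (cycle_len n \<sigma> k) / real n))
           poisson_dirichlet1 \<and>
         (\<forall>s. (\<forall>n\<ge>1. s n \<in> {1..n}) \<longrightarrow>
           weak_conv_m
             (\<lambda>n. distr (mallows n (\<beta> n)) borel (\<lambda>\<sigma>. real (card (orbit \<sigma> (s n))) / real n))
             unif01)"
proof (intro conjI allI impI)
  show "weak_conv_on seq_space
      (\<lambda>n. distr (mallows n (\<beta> n)) (restrict_space borel seq_space)
        (\<lambda>\<sigma> k. real (cycle_len n \<sigma> k) / real n)) poisson_dirichlet1"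
    by (rule cycle_lengths_weak_conv[OF pos lim])
next
  fix s :: "nat \<Rightarrow> nat" assume "\<forall>n\<ge>1. s n \<in> {1..n}"
  then show "weak_conv_m
      (\<lambda>n. distr (mallows n (\<beta> n)) borel (\<lambda>\<sigma>. real (card (orbit \<sigma> (s n))) / real n)) unif01"
    by (intro orbit_weak_conv pos lim) auto
qed

end
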